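(* Let $\Lambda$ be an infinite separable $\mathbb{F}_q$-lattice in $C_\infty$, normalized by $\lambda_0=1$, with critical radii $q^{r_0}<q^{r_1}<\dots$ (so $r_0=0$). Let $k\in\mathbb{N}$ and suppose that $k$ is $(i+1)$-regular for some $i\in\mathbb{N}_0$. (i) All zeroes $z$ of $C_{k,\Lambda}$ with $\log z<r_{i+1}$ lie on critical spheres $\{z: |z|=|\lambda_j|\}$ with $j\le i$; that is, for $j\le i$ one has $\tilde\gamma_\Lambda^{(j)}(k)=\tilde\gamma_{j,\Lambda}(k)$. Correspondingly $\gamma_\Lambda^{(j)}(k)=\gamma_{j,\Lambda}(k)$ for $j\le i$, and all slopes $s$ of the Newton polygon of $G_{k,\Lambda}$ with $s>L(i+1)$ are of the form $s=L(j)$ for some $j\in\mathbb{N}_0$ with $j\le i$. (ii) For $0\le j\le i$, $$\gamma_{j,\Lambda}(k)=\frac{(q-1)k+q\,\mu_j(k)-\mu_{j+1}(k)}{q^{j+1}},$$ and this number is independent of $\Lambda$. (iii) If $k$ is even regular (that is, $i$-regular for all $i\in\mathbb{N}$), then $\gamma_\Lambda(k)$ is independent of $\Lambda$.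
   Context: $q=p^f$ is a power of the prime $p$; $\mathbb{N}=\{1,2,\dots\}$, $\mathbb{N}_0=\{0,1,2,\dots\}$. $C_\infty$ is the completed algebraic closure of $\mathbb{F}_q((T^{-1}))$ with absolute value normalized by $|T|=q$; $\log z:=\log_q|z|$, $\log 0=-\infty$. An $\mathbb{F}_q$-lattice $\Lambda\subset C_\infty$ is an $\mathbb{F}_q$-subspace having finite intersection with each ball of finite radius. It is separable if it has an $\mathbb{F}_q$-basis $\lambda_0,\lambda_1,\dots$ with $|\lambda_0|<|\lambda_1|<\cdots$; put $r_i=\log\lambda_i$. The functions are $C_{k,\Lambda}(z)=\sum_{\lambda\in\Lambda}(z-\lambda)^{-k}$ and $t_\Lambda=C_{1,\Lambda}$; the Goss polynomial $G_{k,\Lambda}$ is the unique (monic, degree $k$) polynomial over $C_\infty$ with $C_{k,\Lambda}(z)=G_{k,\Lambda}(t_\Lambda(z))$. Zeroes are always counted with multiplicity. For $i\in\mathbb{N}_0$ put $L(i)=(q-1)\sum_{0\le j<i}r_jq^j-r_iq^i$ (a strictly decreasing sequence, $L(0)=0$), and $\tilde\gamma_{i,\Lambda}(k)=\#\{\text{zeroes } z \text{ of } C_{k,\Lambda}:\log z=r_i\}$, $\tilde\gamma^{(i)}_\Lambda(k)=\#\{\text{zeroes } z\text{ of }C_{k,\Lambda}: r_i\le\log z<r_{i+1}\}$, $\gamma_{i,\Lambda}(k)=\#\{\text{zeroes }x\text{ of }G_{k,\Lambda}:\log x=L(i)\}$, $\gamma^{(i)}_\Lambda(k)=\#\{\text{zeroes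 }x\text{ of }G_{k,\Lambda}:L(i+1)<\log x\le L(i)\}$, $\gamma_\Lambda(k)=$ multiplicity of $0$ as a zero of $G_{k,\Lambda}$. The Newton polygon of $\sum_j a_jX^j$ is the lower convex hull of the points $(j,-\log a_j)$ with $a_j\neq0$; a segment of slope $s$ and horizontal length $m$ corresponds to $m$ zeroes $x$ with $\log x=s$. For $p$-adic integers $a,b$ with base-$p$ digits $a_j,b_j\in\{0,\dots,p-1\}$, $a<_pb$ means $a_j\le b_j$ for all $j$ (equality allowed). For $a,b\in\mathbb{N}_0$, $a\prec b$ means $a<_pb$ and $a\equiv b\pmod{q-1}$. The height $\mathrm{ht}(n)$ of $n\in\mathbb{N}_0$ is the maximal $h$ for which there are pairwise distinct $0=n_0\prec n_1\prec\cdots\prec n_h<_pn$. For $k\in\mathbb{N}$, $i\in\mathbb{N}_0$ the approximation number is $$\mu_i(k)=\min\{n\in\mathbb{N}_0: n\equiv0\ (\mathrm{mod}\ q-1),\ n<_p\kappa,\ \mathrm{ht}(n)\ge i\},$$ where $\kappa=-k\in\mathbb{Z}_p$ (so $\mu_0(k)=0$). $k$ is called $i$-regular if $\mu_1(k)\prec\mu_2(k)\prec\dots\prec\mu_i(k)$, and regular if it is $i$-regular for all $i\in\mathbb{N}$. *)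

theory Defs
  imports
    "HOL-Analysis.Analysis"
    "HOL-Number_Theory.Cong"
    "HOL-Computational_Algebra.Computational_Algebra"
begin

section \<open>The field of definition\<close>

definition absv :: "'c::{field,complete_space} \<Rightarrow> real" where
  "absv x = dist x 0"

text \<open>
  A model of the completed algebraic closure of the field of Laurent series in 1/T over the
  finite field 'a with q elements.  In the type 'a fls the generator fls_X plays the role of
  1/T, so that fls_X_inv is T and has absolute value q.  The type 'c is complete as a metric
  space, its metric comes from a multiplicative ultrametric absolute value extending the one of
  'a fls, and the elements algebraic over the image of 'a fls form an algebraically closed
  (hence: an algebraic closure of 'a fls) and dense subfield of 'c.
\<close>

definition algebraic_over :: "'c::field set \<Rightarrow> 'c set" where
  "algebraic_over K = {x. \<exists>P. P \<noteq> 0 \<and> (\<forall>n. coeff P n \<in> K) \<and> poly P x = 0}"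

locale C_infinity =
  fixes q :: nat
    and \<iota> :: "'a::{field,finite} fls \<Rightarrow> 'c::{field,complete_space}"
  assumes card_q: "CARD('a) = q"
    and emb_1: "\<iota> 1 = 1"
    and emb_add: "\<And>x y. \<iota> (x + y) = \<iota> x + \<iota> y"
    and emb_mult: "\<And>x y. \<iota> (x * y) = \<iota> x * \<iota> y"
    and dist_absv: "\<And>x y :: 'c. dist x y = absv (x - y)"
    and absv_mult: "\<And>x y :: 'c. absv (x * y) = absv x * absv y"
    and absv_add: "\<And>x y :: 'c. absv (x + y) \<le> max (absv x) (absv y)"
    and absv_emb: "\<And>x. x \<noteq> 0 \<Longrightarrow> absv (\<iota> x) = real q powi (- fls_subdegree x)"
    and alg_closed: "\<And>P. (\<forall>n. coeff P n \<in> algebraic_over (range \<iota>)) \<Longrightarrow> degree P > 0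
        \<Longrightarrow> \<exists>x \<in> algebraic_over (range \<iota>). poly P x = 0"
    and alg_dense: "closure (algebraic_over (range \<iota>)) = UNIV"

definition vlog :: "nat \<Rightarrow> 'c::{field,complete_space} \<Rightarrow> ereal" where
  "vlog q z = (if z = 0 then - \<infinity> else ereal (log (real q) (absv z)))"


section \<open>Separable lattices\<close>

definition fq_scale :: "('a::{field,finite} fls \<Rightarrow> 'c::{field,complete_space}) \<Rightarrow> 'a \<Rightarrow> 'c \<Rightarrow> 'c" where
  "fq_scale \<iota> c x = \<iota> (fls_const c) * x"

definition fq_lattice :: "('a::{field,finite} fls \<Rightarrow> 'c::{field,complete_space}) \<Rightarrow> 'c set \<Rightarrow> bool" where
  "fq_lattice \<iota> \<Lambda> \<longleftrightarrow> module.subspace (fq_scale \<iota>) \<Lambda> \<and> (\<forall>R. finite (\<Lambda> \<inter> cball 0 R))"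

text \<open>
  The infinite separable lattices with a chosen basis as in the definition of separability.
  The basis is indexed by all natural numbers, which makes the lattice infinite-dimensional, and
  the strict monotonicity makes the family injective, so that independence of its range
  is independence of the family.
\<close>

definition separable_lattice ::
    "('a::{field,finite} fls \<Rightarrow> 'c::{field,complete_space}) \<Rightarrow> 'c set \<Rightarrow> (nat \<Rightarrow> 'c) \<Rightarrow> bool" where
  "separable_lattice \<iota> \<Lambda> lam \<longleftrightarrow>
     fq_lattice \<iota> \<Lambda> \<and> strict_mono (\<lambda>i. absv (lam i)) \<and>
     \<not> module.dependent (fq_scale \<iota>) (range lam) \<and> module.span (fq_scale \<iota>) (range lam) = \<Lambda>"

definition normalized_separable_lattice ::
    "('a::{field,finite} fls \<Rightarrow> 'c::{field,complete_space}) \<Rightarrow> 'c set \<Rightarrow> (nat \<Rightarrow> 'c) \<Rightarrow> bool" where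
  "normalized_separable_lattice \<iota> \<Lambda> lam \<longleftrightarrow> separable_lattice \<iota> \<Lambda> lam \<and> lam 0 = 1"

text \<open>The logarithms of the critical radii.  They depend on the lattice only, not on the basis.\<close>

definition crit :: "nat \<Rightarrow> (nat \<Rightarrow> 'c::{field,complete_space}) \<Rightarrow> nat \<Rightarrow> real" where
  "crit q lam i = log (real q) (absv (lam i))"

definition critL :: "nat \<Rightarrow> (nat \<Rightarrow> 'c::{field,complete_space}) \<Rightarrow> nat \<Rightarrow> real" where
  "critL q lam i =
     (real q - 1) * (\<Sum>j<i. crit q lam j * real q ^ j) - crit q lam i * real q ^ i"


section \<open>The functions C and the Goss polynomials\<close>

text \<open>
  On the lattice itself, where the function has its poles, the value given by this definition is
  meaningless (1 / 0 = 0); below it is only used off the lattice.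
\<close>

definition Cfun :: "'c::{field,complete_space} set \<Rightarrow> nat \<Rightarrow> 'c \<Rightarrow> 'c" where
  "Cfun \<Lambda> k z = (\<Sum>\<^sub>\<infinity>l\<in>\<Lambda>. 1 / (z - l) ^ k)"

text \<open>
  The equation determines the polynomial, since Cfun 1 takes infinitely many values off the
  lattice; the polynomial is then monic of degree k.
\<close>

definition goss_poly :: "'c::{field,complete_space} set \<Rightarrow> nat \<Rightarrow> 'c poly" where
  "goss_poly \<Lambda> k = (THE G. \<forall>z. z \<notin> \<Lambda> \<longrightarrow> Cfun \<Lambda> k z = poly G (Cfun \<Lambda> 1 z))"

text \<open>The order of vanishing at z of a function that is given by a nonzero power series near z.\<close>

definition vanishing_order :: "('c::{field,complete_space} \<Rightarrow> 'c) \<Rightarrow> 'c \<Rightarrow> nat" where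
  "vanishing_order g z = (THE m. \<exists>(F :: 'c fps) r. F \<noteq> 0 \<and> r > 0 \<and>
      (\<forall>w. dist w z < r \<longrightarrow> (\<lambda>n. fps_nth F n * (w - z) ^ n) sums g w) \<and> m = subdegree F)"

definition Czeroes :: "'c::{field,complete_space} set \<Rightarrow> nat \<Rightarrow> 'c set" where
  "Czeroes \<Lambda> k = {z. z \<notin> \<Lambda> \<and> Cfun \<Lambda> k z = 0}"

text \<open>
  The numbers of zeroes, with multiplicity, in prescribed logarithmic regions.  The zeroes
  of the meromorphic function in a bounded region, and the zeroes of the polynomial, are finite
  in number, so these are finite sums.
\<close>

definition gamma_tilde :: "nat \<Rightarrow> 'c::{field,complete_space} set \<Rightarrow> (nat \<Rightarrow> 'c) \<Rightarrow> nat \<Rightarrow> nat \<Rightarrow> nat" where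
  "gamma_tilde q \<Lambda> lam i k =
     (\<Sum>z | z \<in> Czeroes \<Lambda> k \<and> vlog q z = ereal (crit q lam i). vanishing_order (Cfun \<Lambda> k) z)"

definition gamma_tilde_shell :: "nat \<Rightarrow> 'c::{field,complete_space} set \<Rightarrow> (nat \<Rightarrow> 'c) \<Rightarrow> nat \<Rightarrow> nat \<Rightarrow> nat" where
  "gamma_tilde_shell q \<Lambda> lam i k =
     (\<Sum>z | z \<in> Czeroes \<Lambda> k \<and> ereal (crit q lam i) \<le> vlog q z \<and> vlog q z < ereal (crit q lam (Suc i)).
        vanishing_order (Cfun \<Lambda> k) z)"

definition gamma :: "nat \<Rightarrow> 'c::{field,complete_space} set \<Rightarrow> (nat \<Rightarrow> 'c) \<Rightarrow> nat \<Rightarrow> nat \<Rightarrow> nat" where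
  "gamma q \<Lambda> lam i k =
     (\<Sum>x | poly (goss_poly \<Lambda> k) x = 0 \<and> vlog q x = ereal (critL q lam i). order x (goss_poly \<Lambda> k))"

definition gamma_shell :: "nat \<Rightarrow> 'c::{field,complete_space} set \<Rightarrow> (nat \<Rightarrow> 'c) \<Rightarrow> nat \<Rightarrow> nat \<Rightarrow> nat" where
  "gamma_shell q \<Lambda> lam i k =
     (\<Sum>x | poly (goss_poly \<Lambda> k) x = 0 \<and>
            ereal (critL q lam (Suc i)) < vlog q x \<and> vlog q x \<le> ereal (critL q lam i).
        order x (goss_poly \<Lambda> k))"

definition gamma_zero :: "'c::{field,complete_space} set \<Rightarrow> nat \<Rightarrow> nat" where
  "gamma_zero \<Lambda> k = order 0 (goss_poly \<Lambda> k)"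


section \<open>Newton polygons\<close>

definition newton_points :: "nat \<Rightarrow> 'c::{field,complete_space} poly \<Rightarrow> (real \<times> real) set" where
  "newton_points q P = {(real j, - log (real q) (absv (coeff P j))) | j. coeff P j \<noteq> 0}"

text \<open>The lower boundary of the convex hull, as a function on the projection of the hull.\<close>

definition newton_polygon :: "nat \<Rightarrow> 'c::{field,complete_space} poly \<Rightarrow> real \<Rightarrow> real" where
  "newton_polygon q P x = Inf {y. (x, y) \<in> convex hull (newton_points q P)}"

definition newton_slope :: "nat \<Rightarrow> 'c::{field,complete_space} poly \<Rightarrow> real \<Rightarrow> bool" where
  "newton_slope q P s \<longleftrightarrow> (\<exists>u v. u < v \<and> {u..v} \<subseteq> fst ` (convex hull (newton_points q P)) \<and>
      (\<forall>x\<in>{u..v}. newton_polygon q P x = newton_polygon q P u + s * (x - u)))"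


section \<open>Digits, heights and approximation numbers\<close>

text \<open>
  The p-adic integers that occur are rational integers, possibly negative.  As div and mod on int
  round towards minus infinity, this is the j-th digit of the p-adic expansion also for a < 0.
\<close>

definition padic_digit :: "nat \<Rightarrow> int \<Rightarrow> nat \<Rightarrow> int" where
  "padic_digit p a j = (a div int p ^ j) mod int p"

definition digit_le :: "nat \<Rightarrow> int \<Rightarrow> int \<Rightarrow> bool" where
  "digit_le p a b \<longleftrightarrow> (\<forall>j. padic_digit p a j \<le> padic_digit p b j)"

definition prec :: "nat \<Rightarrow> nat \<Rightarrow> nat \<Rightarrow> nat \<Rightarrow> bool" where
  "prec p q a b \<longleftrightarrow> digit_le p (int a) (int b) \<and> [a = b] (mod (q - 1))"

definition height :: "nat \<Rightarrow> nat \<Rightarrow> nat \<Rightarrow> nat" where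
  "height p q n = Max {h. \<exists>c :: nat \<Rightarrow> nat. c 0 = 0 \<and> inj_on c {..h} \<and>
      (\<forall>j<h. prec p q (c j) (c (Suc j))) \<and> digit_le p (int (c h)) (int n)}"

definition approx_num :: "nat \<Rightarrow> nat \<Rightarrow> nat \<Rightarrow> nat \<Rightarrow> nat" where
  "approx_num p q i k =
     (LEAST n. [n = 0] (mod (q - 1)) \<and> digit_le p (int n) (- int k) \<and> height p q n \<ge> i)"

definition i_regular :: "nat \<Rightarrow> nat \<Rightarrow> nat \<Rightarrow> nat \<Rightarrow> bool" where
  "i_regular p q i k \<longleftrightarrow>
     (\<forall>j. 1 \<le> j \<and> j < i \<longrightarrow> prec p q (approx_num p q j k) (approx_num p q (Suc j) k))"

definition regular :: "nat \<Rightarrow> nat \<Rightarrow> nat \<Rightarrow> bool" where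
  "regular p q k \<longleftrightarrow> (\<forall>i\<ge>1. i_regular p q i k)"

end

theory Submission
  imports Defs
begin

text \<open>
  Write \<open>V m\<close> for the span of the first m basis vectors of the lattice.  The idea is to read off
  the absolute value of \<open>C\<^sub>k(z)\<close> for \<open>|\<lambda>\<^sub>m\<^sub>-\<^sub>1| < |z| < |\<lambda>\<^sub>m|\<close> from a single dominant term, to
  transport it to the Goss polynomial by \<open>C\<^sub>k = G\<^sub>k(t)\<close>, and to count zeroes by slopes.

  For \<open>|z| > |\<lambda>\<^sub>m\<^sub>-\<^sub>1|\<close> the sum of \<open>(z - v)\<^sup>-\<^sup>k\<close> over \<open>v \<in> V m\<close> expands into powers of 1/z.  As
  the sum of \<open>c\<^sup>n\<close> over the finite field is -1 if n is a positive multiple of q - 1 and 0 otherwise,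
  only exponent vectors \<open>(n\<^sub>0, ..., n\<^sub>m\<^sub>-\<^sub>1)\<close> of positive multiples of q - 1 contribute, and by Lucas'
  theorem the coefficient is nonzero modulo p iff the \<open>n\<^sub>j\<close> add up without carries in base p to
  a number whose digits are at most those of -k.  Then it has absolute value 1.  The partial sum
  \<open>n\<^sub>0 + ... + n\<^sub>s\<^sub>-\<^sub>1\<close> is therefore a candidate in the definition of the approximation number
  \<open>\<mu>\<^sub>s(k)\<close>, hence at least \<open>\<mu>\<^sub>s(k)\<close>, and regularity says precisely that equality is possible for
  all s at once.  Since the numbers \<open>|\<lambda>\<^sub>j/z|\<close> increase with j and are less than 1, Abel summation
  shows that this vector gives the unique term of largest absolute value
  (exps_term_less).  So the absolute value of the sum over \<open>V m\<close> is
  a constant times \<open>|z|\<close> to the power \<open>-(k + \<mu>\<^sub>m(k))\<close> (absv_finite_C_regular).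
  The other cosets of \<open>V m\<close> in the lattice contribute strictly smaller values
  of the same decreasing function of the absolute value (coset_dominance).
  Thus \<open>C\<^sub>k\<close> has no zero z off the critical spheres with \<open>|z| < |\<lambda>\<^sub>i\<^sub>+\<^sub>1|\<close>, which is the part of (i) about \<open>C\<^sub>k\<close>.

  The polynomial \<open>G\<^sub>k\<close> comes from partial fractions: expanding \<open>C\<^sub>1 C\<^sub>k\<close> as a double sum over a
  finite group and separating the diagonal gives \<open>C\<^sub>k\<^sub>+\<^sub>1\<close> in terms of \<open>C\<^sub>1, ..., C\<^sub>k\<close>
  (finite_goss_recursion), and the identity survives the limit over m.
  Also \<open>C\<^sub>1\<close> is a constant divided by the product of the z - v on \<open>V m\<close>, because its numerator is
  invariant under translation by \<open>V m\<close> and has degree less than the order of \<open>V m\<close>.  So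
  \<open>log t(z)\<close> is an affine function of \<open>log z\<close> with slope \<open>-q\<^sup>m\<close> that maps the interval
  from \<open>r\<^sub>m\<^sub>-\<^sub>1\<close> to \<open>r\<^sub>m\<close> onto the interval from L(m) to L(m - 1).  Consequently
  \<open>log G\<^sub>k(x)\<close> is affine of slope \<open>(k + \<mu>\<^sub>m(k)) / q\<^sup>m\<close> in \<open>log x\<close> for a dense set
  of radii in that interval.

  The completion is algebraically closed (monic_splits), so \<open>G\<^sub>k\<close> is a product of linear
  factors.  For a split polynomial such affine growth excludes zeroes in the open interval, and
  the slope is the number of zeroes x with \<open>log x \<le> L(m)\<close> (roots_of_linear_growth).  Taking
  differences for m = j and m = j + 1 gives (ii) and the rest of (i), as a Newton slope is the logarithm of a
  zero.  For regular k the multiplicity of 0 is the eventual value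
  of \<open>(k + \<mu>\<^sub>m(k)) / q\<^sup>m\<close>, which does not involve the lattice; this is (iii).
\<close>

section \<open>Digits and binomial coefficients modulo a prime\<close>

text \<open>In Vandermonde's convolution for \<open>(b + p) choose a\<close> the factor \<open>p choose j\<close>
  vanishes modulo p except for j = 0 and j = p.\<close>

lemma choose_prime_shift:
  assumes "prime p"
  shows "[(b + p) choose a = (b choose a) + (if p \<le> a then b choose (a - p) else 0)] (mod p)"
proof -
  have p0: "p > 0" using assms prime_gt_0_nat by blast
  have "(b + p) choose a = (\<Sum>j\<le>a. (p choose j) * (b choose (a - j)))"
    using vandermonde[of p b a] by (simp add: add.commute)
  also have "[\<dots> = (\<Sum>j\<le>a. if j = 0 then b choose a else if j = p then b choose (a - p) else 0)] (mod p)"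
  proof (rule cong_sum)
    fix j assume "j \<in> {..a}"
    show "[(p choose j) * (b choose (a - j)) =
      (if j = 0 then b choose a else if j = p then b choose (a - p) else 0)] (mod p)"
    proof (cases "j = 0 \<or> j \<ge> p")
      case True then show ?thesis using p0 by (auto simp: binomial_eq_0 cong_def le_less)
    next
      case False
      hence "p dvd (p choose j)" using assms by (intro dvd_choose_prime) auto
      then show ?thesis using False by (auto simp: cong_0_iff)
    qed
  qed
  also have "(\<Sum>j\<le>a. if j = 0 then b choose a else if j = p then b choose (a - p) else 0)
    = (\<Sum>j\<le>a. (if j = 0 then b choose a else 0) + (if j = p then b choose (a - p) else 0))"
    using p0 by (intro sum.cong) auto
  also have "\<dots> = (b choose a) + (if p \<le> a then b choose (a - p) else 0)"
    by (simp add: sum.distrib)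
  finally show ?thesis .
qed

text \<open>One digit of Lucas' theorem, by induction on the number of times that p fits into the upper entry.\<close>

lemma lucas_step:
  assumes "prime p" "b0 < p"
  shows "[(p * B + b0) choose a = (B choose (a div p)) * (b0 choose (a mod p))] (mod p)"
proof (induction B arbitrary: a)
  case 0
  show ?case
  proof (cases "a < p")
    case False
    hence "a div p > 0" by (metis assms(1) div_greater_zero_iff not_less prime_gt_0_nat)
    then show ?thesis using False assms by (simp add: binomial_eq_0)
  qed simp
next
  case (Suc B)
  have p0: "p > 0" using assms prime_gt_0_nat by blast
  have "[(p * B + b0 + p) choose a = (p * B + b0 choose a) + (if p \<le> a then p * B + b0 choose (a - p) else 0)] (mod p)"
    by (rule choose_prime_shift[OF assms(1)])
  also have "[(p * B + b0 choose a) + (if p \<le> a then p * B + b0 choose (a - p) else 0) =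
     (B choose (a div p)) * (b0 choose (a mod p)) +
     (if p \<le> a then (B choose ((a - p) div p)) * (b0 choose ((a - p) mod p)) else 0)] (mod p)"
    using Suc.IH by (intro cong_add) (auto simp del: mult_Suc_right)
  also have "(B choose (a div p)) * (b0 choose (a mod p)) +
     (if p \<le> a then (B choose ((a - p) div p)) * (b0 choose ((a - p) mod p)) else 0)
     = (Suc B choose (a div p)) * (b0 choose (a mod p))"
  proof (cases "p \<le> a")
    case True
    then obtain d where d: "a div p = Suc d" "(a - p) div p = d" "(a - p) mod p = a mod p"
      using p0 by (metis le_div_geq le_mod_geq)
    show ?thesis unfolding d using True by (simp add: algebra_simps)
  qed simp
  finally show ?case by (simp add: algebra_simps)
qed

lemma prime_dvd_small_choose:
  assumes "prime p" "b < p"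
  shows "p dvd (b choose a) \<longleftrightarrow> b < a"
proof
  assume d: "p dvd (b choose a)"
  show "b < a"
  proof (rule ccontr)
    assume "\<not> b < a"
    hence "(b choose a) dvd fact b"
      by (metis binomial_fact_lemma dvd_triv_right not_less)
    with d have "p dvd fact b" by (rule dvd_trans)
    thus False using assms prime_dvd_fact_iff by auto
  qed
qed (simp add: binomial_eq_0)

text \<open>By Kummer's theorem this says that adding a and b - a in base p produces no carries.  The
  divisibility form makes transitivity and the regrouping of summands consequences of identities
  between binomial coefficients.\<close>

definition carry_free :: "nat \<Rightarrow> nat \<Rightarrow> nat \<Rightarrow> bool" where
  "carry_free p a b \<longleftrightarrow> \<not> p dvd (b choose a)"

lemma carry_free_div_mod:
  assumes "prime p"
  shows "carry_free p a b \<longleftrightarrow> a mod p \<le> b mod p \<and> carry_free p (a div p) (b div p)"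
proof -
  have lt: "b mod p < p" using assms prime_gt_0_nat by simp
  have "[b choose a = (b div p choose (a div p)) * (b mod p choose (a mod p))] (mod p)"
    using lucas_step[OF assms lt, of "b div p" a] by simp
  hence "p dvd (b choose a) \<longleftrightarrow> p dvd (b div p choose (a div p)) * (b mod p choose (a mod p))"
    by (rule cong_dvd_iff) 
  also have "\<dots> \<longleftrightarrow> p dvd (b div p choose (a div p)) \<or> b mod p < a mod p"
    using prime_dvd_mult_iff[OF assms] prime_dvd_small_choose[OF assms lt] by blast
  finally show ?thesis unfolding carry_free_def by auto
qed

lemma padic_digit_nat: "padic_digit p (int a) j = int ((a div p ^ j) mod p)"
  unfolding padic_digit_def by (simp add: zdiv_int zmod_int)

lemma digit_le_nat: "digit_le p (int a) (int b) \<longleftrightarrow> (\<forall>j. (a div p ^ j) mod p \<le> (b div p ^ j) mod p)"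
  unfolding digit_le_def padic_digit_nat by simp

lemma digit_le_div_mod:
  "digit_le p (int a) (int b) \<longleftrightarrow> a mod p \<le> b mod p \<and> digit_le p (int (a div p)) (int (b div p))"
proof -
  have "(\<forall>j. P j) \<longleftrightarrow> P 0 \<and> (\<forall>j. P (Suc j))" for P :: "nat \<Rightarrow> bool"
    by (metis not0_implies_Suc)
  from this[of "\<lambda>j. (a div p ^ j) mod p \<le> (b div p ^ j) mod p"]
  show ?thesis unfolding digit_le_nat by (simp add: div_mult2_eq)
qed

text \<open>Lucas' theorem: both sides obey the same recursion on the base p digits.\<close>

lemma digit_le_iff_carry_free:
  assumes "prime p"
  shows "digit_le p (int a) (int b) \<longleftrightarrow> carry_free p a b"
proof (induction "a + b" arbitrary: a b rule: less_induct)
  case less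
  have p1: "p > 1" using assms prime_gt_1_nat by blast
  show ?case
  proof (cases "a + b = 0")
    case True
    hence "a = 0" "b = 0" by simp_all
    thus ?thesis using p1 by (simp only: digit_le_nat carry_free_def) simp
  next
    case False
    have "a div p \<le> a" "b div p \<le> b" by simp_all
    moreover have "a > 0 \<Longrightarrow> a div p < a" "b > 0 \<Longrightarrow> b div p < b" using p1 by simp_all
    ultimately have "a div p + b div p < a + b" using False by linarith
    from less[OF this] show ?thesis
      using digit_le_div_mod[of p a b] carry_free_div_mod[OF assms, of a b] by blast
  qed
qed

lemma carry_free_le: "carry_free p a b \<Longrightarrow> a \<le> b"
  unfolding carry_free_def by (metis binomial_eq_0 dvd_0_right not_less)

lemma carry_free_0 [simp]: "prime p \<Longrightarrow> carry_free p 0 b"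
  unfolding carry_free_def by auto

lemma carry_free_trans:
  assumes "prime p" "carry_free p a b" "carry_free p b c"
  shows "carry_free p a c"
proof -
  have "a \<le> b" "b \<le> c" using assms carry_free_le by blast+
  hence "(c choose b) * (b choose a) = (c choose a) * (c - a choose (b - a))"
    using choose_mult by blast
  thus ?thesis using assms prime_dvd_mult_iff[OF assms(1)] unfolding carry_free_def by (metis)
qed

text \<open>Choosing n + a elements and then n among them, or n elements and then a among the rest, is
  counted by the same product.\<close>

lemma carry_free_add_iff:
  assumes "prime p" "n + a \<le> K"
  shows "carry_free p a (n + a) \<and> carry_free p (n + a) K \<longleftrightarrow> carry_free p n K \<and> carry_free p a (K - n)"
proof -
  have "(K choose (n + a)) * (n + a choose n) = (K choose n) * (K - n choose a)"
    using choose_mult[of n "n + a" K] assms by simp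
  moreover have "(n + a choose n) = (n + a choose a)"
    by (metis add_diff_cancel_left' binomial_symmetric le_add1)
  ultimately show ?thesis using prime_dvd_mult_iff[OF assms(1)] unfolding carry_free_def by metis
qed

text \<open>The p-adic integers -k and \<open>p\<^sup>M - k\<close> agree in their first M digits.  This replaces the
  infinite digit expansion of -k, and the binomial series with exponent -k, by finite ones.\<close>

lemma digit_le_minus_iff:
  assumes "prime p" "k \<le> p ^ M" "n < p ^ M"
  shows "digit_le p (int n) (- int k) \<longleftrightarrow> carry_free p n (p ^ M - k)"
proof -
  have p1: "p > 1" using assms prime_gt_1_nat by blast
  have "padic_digit p (int n) j \<le> padic_digit p (- int k) j \<longleftrightarrow>
        padic_digit p (int n) j \<le> padic_digit p (int (p ^ M - k)) j" for j
  proof (cases "j < M")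
    case True
    then obtain d where d: "M = j + Suc d" using less_iff_Suc_add by auto
    have "int (p ^ M - k) = - int k + int p ^ j * int p ^ Suc d"
      using assms d by (simp add: of_nat_diff power_add)
    hence "int (p ^ M - k) div int p ^ j = - int k div int p ^ j + int p ^ Suc d"
      using p1 div_mult_self2[of "int p ^ j" "- int k" "int p ^ Suc d"] by simp
    hence "padic_digit p (int (p ^ M - k)) j = padic_digit p (- int k) j"
      unfolding padic_digit_def by (simp add: mod_add_right_eq[symmetric, of _ "_ * _"] del: mod_add_right_eq)
    thus ?thesis by simp
  next
    case False
    hence "p ^ M \<le> p ^ j" using p1 by (intro power_increasing) auto
    hence "n div p ^ j = 0" using assms by simp
    hence "padic_digit p (int n) j = 0" by (simp add: padic_digit_nat)
    thus ?thesis using p1 by (simp add: padic_digit_def)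
  qed
  thus ?thesis using digit_le_iff_carry_free[OF assms(1), of n "p ^ M - k"] unfolding digit_le_def by blast
qed

lemma digit_le_minus_trans:
  assumes "digit_le p (int a) (int b)" "digit_le p (int b) c"
  shows "digit_le p (int a) c"
  using assms unfolding digit_le_def by (meson order_trans)

section \<open>Heights and approximation numbers\<close>

context
  fixes p q :: nat
  assumes p: "prime p" 
begin

definition chains :: "nat \<Rightarrow> nat set" where
  "chains n = {h. \<exists>c :: nat \<Rightarrow> nat. c 0 = 0 \<and> inj_on c {..h} \<and>
      (\<forall>j<h. prec p q (c j) (c (Suc j))) \<and> digit_le p (int (c h)) (int n)}"

lemma chain_strict:
  assumes "inj_on c {..h}" "\<forall>j<h. prec p q (c j) (c (Suc j))" "j < h"
  shows "c j < c (Suc j)"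
proof -
  have "c j \<le> c (Suc j)"
    using assms digit_le_iff_carry_free[OF p] carry_free_le unfolding prec_def by blast
  moreover have "c j \<noteq> c (Suc j)" using inj_onD[OF assms(1), of j "Suc j"] assms(3) by auto
  ultimately show ?thesis by simp
qed

lemma chain_ge:
  assumes "inj_on c {..h}" "\<forall>j<h. prec p q (c j) (c (Suc j))" "j \<le> h"
  shows "j \<le> c j"
  using assms(3)
proof (induction j)
  case (Suc j)
  then show ?case using chain_strict[OF assms(1,2), of j] by force
qed simp

lemma chains_le: "h \<in> chains n \<Longrightarrow> h \<le> n"
proof -
  assume "h \<in> chains n"
  then obtain c where c: "inj_on c {..h}" "\<forall>j<h. prec p q (c j) (c (Suc j))" "digit_le p (int (c h)) (int n)"
    unfolding chains_def by blast
  have "h \<le> c h" using chain_ge[OF c(1,2)] by simp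
  also have "c h \<le> n" using c(3) digit_le_iff_carry_free[OF p] carry_free_le by blast
  finally show ?thesis .
qed

lemma height_eq: "height p q n = Max (chains n)"
  unfolding height_def chains_def ..

lemma finite_chains: "finite (chains n)"
  using chains_le by (meson finite_nat_iff_bounded_le subsetI atMost_iff)

lemma chains_zero: "0 \<in> chains n"
proof -
  have "digit_le p (int 0) (int n)" unfolding digit_le_nat by simp
  thus ?thesis unfolding chains_def by (auto intro!: exI[of _ "\<lambda>_. 0"])
qed

text \<open>A chain of maximal length can be cut off at any place, so a lower bound for the height is
  the existence of one chain of exactly that length.\<close>

lemma height_ge_iff: "height p q n \<ge> h \<longleftrightarrow> (\<exists>c :: nat \<Rightarrow> nat. c 0 = 0 \<and> inj_on c {..h} \<and>
      (\<forall>j<h. prec p q (c j) (c (Suc j))) \<and> digit_le p (int (c h)) (int n))" (is "_ \<longleftrightarrow> ?R h")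
proof
  assume h: "h \<le> height p q n"
  have "Max (chains n) \<in> chains n" using finite_chains chains_zero by (intro Max_in) auto
  then obtain c where c: "c 0 = 0" "inj_on c {..height p q n}" 
    "\<forall>j<height p q n. prec p q (c j) (c (Suc j))" "digit_le p (int (c (height p q n))) (int n)"
    unfolding height_eq[symmetric] unfolding chains_def by blast
  have "digit_le p (int (c j)) (int n)" if "j \<le> height p q n" for j
    using that
  proof (induction rule: inc_induct)
    case (step m)
    then show ?case using c(3) digit_le_minus_trans unfolding prec_def by blast
  qed (rule c(4))
  with c h show "?R h" by (intro exI[of _ c]) (auto elim!: inj_on_subset)
next
  assume "?R h"
  hence "h \<in> chains n" unfolding chains_def by blast
  thus "h \<le> height p q n" unfolding height_eq using finite_chains by simp
qed

lemma strict_chain_height: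
  assumes "c 0 = 0" "\<And>j. j < h \<Longrightarrow> c j < c (Suc j)"
    "\<And>j. j < h \<Longrightarrow> carry_free p (c j) (c (Suc j))" "\<And>j. j \<le> h \<Longrightarrow> (q - 1) dvd c j"
  shows "height p q (c h) \<ge> h"
  unfolding height_ge_iff
proof (intro exI[of _ c] conjI)
  have "c a < c b" if "a < b" "b \<le> h" for a b
    using that
  proof (induction b)
    case (Suc b)
    then show ?case using assms(2)[of b] by (cases "a = b") force+
  qed simp
  thus "inj_on c {..h}" by (metis (no_types, lifting) atMost_iff inj_onI nat_neq_iff)
  show "\<forall>j<h. prec p q (c j) (c (Suc j))"
    using assms(3,4) digit_le_iff_carry_free[OF p] unfolding prec_def
    by (auto simp: cong_def mod_eq_0_iff_dvd[symmetric] Suc_le_eq)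
  show "digit_le p (int (c h)) (int (c h))" by (simp add: digit_le_def)
qed (rule assms(1))

end


lemma digit_minus_small:
  assumes "p > 1" "k \<ge> 1" "k \<le> p ^ j"
  shows "padic_digit p (- int k) j = int p - 1"
proof -
  have "int k \<le> int p ^ j" using assms by (metis of_nat_le_iff of_nat_power)
  hence "- int k div int p ^ j = - 1"
    using assms by (intro int_div_pos_eq[where r = "int p ^ j - int k"]) auto
  thus ?thesis using assms by (simp add: padic_digit_def zmod_minus1)
qed

lemma digit_block_above:
  assumes "p > 1" "a + b \<le> j"
  shows "p ^ a * (p ^ b - 1) div p ^ j mod p = (0::nat)"
proof -
  have "p ^ a * (p ^ b - 1) < p ^ a * p ^ b" using assms by simp
  also have "\<dots> \<le> p ^ j" unfolding power_add[symmetric] using assms by (intro power_increasing) auto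
  finally show ?thesis by simp
qed

lemma digit_block_below:
  assumes "p > 1" "j < a"
  shows "p ^ a * c div p ^ j mod p = (0::nat)"
proof -
  obtain d where d: "a = j + Suc d" using assms less_iff_Suc_add by auto
  have "p ^ a * c = p ^ j * (p * (p ^ d * c))" unfolding d power_add by (simp add: mult_ac)
  moreover have "p ^ j > 0" using assms by simp
  ultimately have "p ^ a * c div p ^ j = p * (p ^ d * c)" by (metis nonzero_mult_div_cancel_left neq0_conv)
  thus ?thesis by simp
qed

lemma digit_block_inside:
  assumes "p > 1" "a \<le> j" "j < a + b"
  shows "p ^ a * (p ^ b - 1) div p ^ j mod p = (p - 1::nat)"
proof -
  obtain d where d: "j = a + d" using assms le_Suc_ex by blast
  obtain e where e: "b = d + Suc e" using assms d less_iff_Suc_add by auto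
  have split: "p ^ b - 1 = (p ^ d - 1) + (p ^ Suc e - 1) * p ^ d"
  proof -
    have "p ^ d \<ge> 1" "p ^ Suc e \<ge> 1" using assms by simp_all
    hence "(p ^ d - 1) + (p ^ Suc e - 1) * p ^ d + 1 = p ^ Suc e * p ^ d"
      using mult_le_mono1[of 1 "p ^ Suc e" "p ^ d"] unfolding diff_mult_distrib mult_1
      by linarith
    thus ?thesis unfolding e power_add by (simp add: mult.commute)
  qed
  have "p ^ a * (p ^ b - 1) div p ^ j = (p ^ b - 1) div p ^ d"
    unfolding d power_add using assms by (simp add: div_mult2_eq)
  also have "\<dots> = (p ^ Suc e - 1) + (p ^ d - 1) div p ^ d"
    unfolding split using assms by (intro div_mult_self1) auto
  also have "\<dots> = p ^ Suc e - 1" using assms by simp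
  also have "\<dots> = (p - 1) + p * (p ^ e - 1)"
  proof -
    have "p ^ e \<ge> 1" using assms by simp
    hence "(p - 1) + p * (p ^ e - 1) + 1 = p ^ Suc e"
      using assms by (simp add: diff_mult_distrib2)
    thus ?thesis by simp
  qed
  also have "\<dots> mod p = (p - 1) mod p" by (rule mod_mult_self2)
  also have "\<dots> = p - 1" using assms by simp
  finally show ?thesis .
qed

context
  fixes p f q :: nat
  assumes p: "prime p" and f: "f \<ge> 1" and q: "q = p ^ f"
begin

text \<open>The digits of -k are p - 1 from some position on.  Above that position
  there is room for blocks of f such digits, each of which is a multiple of q - 1, and
  the first j blocks for \<open>j \<le> i\<close> form a chain.\<close>

lemma approx_exists:
  assumes "k \<ge> 1"
  shows "\<exists>n. [n = 0] (mod (q - 1)) \<and> digit_le p (int n) (- int k) \<and> height p q n \<ge> i"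
proof -
  have p1: "p > 1" using p prime_gt_1_nat by blast
  have kt: "k \<le> p ^ j" if "f * k \<le> j" for j
  proof -
    have "k < 2 ^ k" by (rule less_exp)
    also have "(2::nat) ^ k \<le> p ^ k" using p1 by (intro power_mono) auto
    also have "p ^ k \<le> p ^ j" using p1 f that by (intro power_increasing) (auto intro: order_trans[rotated])
    finally show ?thesis by simp
  qed
  define c where "c j = p ^ (f * k) * (p ^ (f * j) - 1)" for j
  have dvd: "(q - 1) dvd c j" for j
  proof -
    have q0: "q \<ge> 1" using p1 q by simp
    have "q - 1 dvd q ^ j - 1"
    proof (induction j)
      case (Suc j)
      have "q ^ j \<ge> 1" using q0 by simp
      hence "q ^ Suc j - 1 = q * (q ^ j - 1) + (q - 1)"
        using q0 by (simp add: diff_mult_distrib2)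
      thus ?case using Suc by simp
    qed simp
    thus ?thesis unfolding c_def q power_mult by simp
  qed
  have "height p q (c i) \<ge> i"
  proof (rule strict_chain_height[OF p])
    fix j assume "j < i"
    show "c j < c (Suc j)" unfolding c_def using p1 f by (simp add: diff_less_mono)
    show "carry_free p (c j) (c (Suc j))"
      unfolding digit_le_iff_carry_free[OF p, symmetric] digit_le_nat
    proof
      fix l
      have lt: "c j div p ^ l mod p \<le> p - 1"         using mod_less_divisor[of p "c j div p ^ l"] p1 by linarith
      consider "l < f * k" | "f * k \<le> l" "l < f * k + f * Suc j" | "f * k + f * j \<le> l"
        by (fastforce)
      thus "c j div p ^ l mod p \<le> c (Suc j) div p ^ l mod p"
      proof cases
        case 1 thus ?thesis using digit_block_below[OF p1] unfolding c_def by simp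
      next
        case 2 thus ?thesis using digit_block_inside[OF p1 2] lt unfolding c_def by simp
      next
        case 3 thus ?thesis using digit_block_above[OF p1 3] unfolding c_def by simp
      qed
    qed
  qed (use dvd in \<open>auto simp: c_def\<close>)
  moreover have "digit_le p (int (c i)) (- int k)"
    unfolding digit_le_def
  proof
    fix l
    show "padic_digit p (int (c i)) l \<le> padic_digit p (- int k) l"
    proof (cases "l < f * k")
      case True
      thus ?thesis using digit_block_below[OF p1, of l "f * k"] p1
        unfolding padic_digit_nat c_def by (simp add: padic_digit_def)
    next
      case False
      hence "padic_digit p (- int k) l = int p - 1"
        using digit_minus_small[OF p1 assms kt] by simp
      moreover have "c i div p ^ l mod p < p" using p1 by simp
      ultimately show ?thesis unfolding padic_digit_nat by linarith
    qed
  qed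
  ultimately show ?thesis using dvd[of i] by (auto simp: cong_0_iff)
qed

lemma approx_num_props:
  assumes "k \<ge> 1"
  shows "(q - 1) dvd approx_num p q i k" "digit_le p (int (approx_num p q i k)) (- int k)"
    "height p q (approx_num p q i k) \<ge> i"
  using LeastI_ex[OF approx_exists[OF assms, of i]] unfolding approx_num_def[symmetric]
  by (auto simp: cong_0_iff)

lemma approx_num_le:
  assumes "(q - 1) dvd n" "digit_le p (int n) (- int k)" "height p q n \<ge> i"
  shows "approx_num p q i k \<le> n"
  unfolding approx_num_def by (rule Least_le) (use assms in \<open>auto simp: cong_0_iff\<close>)

lemma approx_num_0: "approx_num p q 0 k = 0"
proof -
  have "digit_le p (int 0) (- int k)"
    using p prime_gt_0_nat[OF p] unfolding digit_le_def by (auto simp: padic_digit_def)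
  thus ?thesis using approx_num_le[of 0 k 0] by simp
qed

text \<open>Dropping the last member of a chain below \<open>\<mu>\<^sub>i\<^sub>+\<^sub>1(k)\<close> leaves a strictly smaller candidate for
  \<open>\<mu>\<^sub>i(k)\<close>.\<close>

lemma approx_num_less_Suc:
  assumes "k \<ge> 1"
  shows "approx_num p q i k < approx_num p q (Suc i) k"
proof -
  let ?n = "approx_num p q (Suc i) k"
  note n = approx_num_props[OF assms, of "Suc i"]
  from n(3) obtain c where c: "c 0 = 0" "inj_on c {..Suc i}"
    "\<forall>j<Suc i. prec p q (c j) (c (Suc j))" "digit_le p (int (c (Suc i))) (int ?n)"
    unfolding height_ge_iff[OF p] by blast
  have lt: "c j < c (Suc j)" if "j < Suc i" for j by (rule chain_strict[OF p c(2,3) that])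
  have dvd: "(q - 1) dvd c j" if "j \<le> Suc i" for j
    using that
  proof (induction j)
    case (Suc j)
    hence "[c j = c (Suc j)] (mod (q - 1))" using c(3) unfolding prec_def by auto
    thus ?case using Suc cong_dvd_modulus_nat cong_0_iff cong_sym cong_trans
      by (metis Suc_leD)
  qed (simp add: c)
  have cf: "carry_free p (c j) (c (Suc j))" if "j < Suc i" for j
    using c(3) that digit_le_iff_carry_free[OF p] unfolding prec_def by blast
  have "height p q (c i) \<ge> i"
    using lt dvd cf by (intro strict_chain_height[OF p, of c i q] c(1)) auto
  moreover have "digit_le p (int (c i)) (int (c (Suc i)))"
    using c(3) unfolding prec_def by blast
  hence "digit_le p (int (c i)) (- int k)" using c(4) n(2) digit_le_minus_trans by blast
  ultimately have "approx_num p q i k \<le> c i" using dvd[of i] by (intro approx_num_le) auto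
  also have "\<dots> < c (Suc i)" using lt by simp
  also have "\<dots> \<le> ?n" using c(4) digit_le_iff_carry_free[OF p] carry_free_le by blast
  finally show ?thesis .
qed

lemma regular_carry_free:
  assumes "i_regular p q m k" "s < m"
  shows "carry_free p (approx_num p q s k) (approx_num p q (Suc s) k)"
proof (cases "s = 0")
  case True then show ?thesis using approx_num_0 p by simp
next
  case False
  hence "prec p q (approx_num p q s k) (approx_num p q (Suc s) k)"
    using assms unfolding i_regular_def by auto
  thus ?thesis using digit_le_iff_carry_free[OF p] unfolding prec_def by blast
qed

end

section \<open>Ultrametric absolute values\<close>

lemma absv_nonneg [simp]: "absv x \<ge> 0" by (simp add: absv_def)
lemma absv_0 [simp]: "absv 0 = 0" by (simp add: absv_def)
lemma absv_eq_0_iff [simp]: "absv x = 0 \<longleftrightarrow> x = 0" by (simp add: absv_def)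
lemma absv_pos [simp]: "absv x > 0 \<longleftrightarrow> x \<noteq> 0" by (simp add: absv_def)

context C_infinity
begin

lemma q_ge_2: "q \<ge> 2"
proof -
  have "card {0, 1 :: 'a} \<le> CARD('a)" by (intro card_mono) auto
  thus ?thesis using card_q by simp
qed

lemma absv_1 [simp]: "absv (1 :: 'c) = 1"
  using absv_mult[of 1 1] by simp

lemma absv_minus [simp]: "absv (- x :: 'c) = absv x"
proof -
  have "absv (- 1 :: 'c) * absv (- 1 :: 'c) = 1" using absv_mult[of "-1" "-1"] by simp
  hence "absv (- 1 :: 'c) = 1" using absv_nonneg[of "- 1 :: 'c"]
    by (metis abs_of_nonneg abs_mult_self_eq abs_square_eq_1 power2_eq_square)
  thus ?thesis using absv_mult[of "-1" x] by simp
qed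

lemma absv_power: "absv (x ^ n :: 'c) = absv x ^ n"
  by (induction n) (simp_all add: absv_mult)

lemma absv_inverse: "absv (inverse x :: 'c) = inverse (absv x)"
proof (cases "x = 0")
  case False
  hence "absv x * absv (inverse x) = 1" using absv_mult[of x "inverse x"] by simp
  thus ?thesis by (simp add: inverse_unique)
qed simp

lemma absv_divide: "absv (x / y :: 'c) = absv x / absv y"
  by (simp add: divide_inverse absv_mult absv_inverse)

lemma absv_prod: "absv (prod g S :: 'c) = (\<Prod>i\<in>S. absv (g i))"
  by (induction S rule: infinite_finite_induct) (simp_all add: absv_mult)

lemma absv_diff: "absv (x - y :: 'c) \<le> max (absv x) (absv y)"
  using absv_add[of x "- y"] by simp

lemma absv_diff_commute: "absv (x - y :: 'c) = absv (y - x)"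
  using absv_minus[of "x - y"] by simp

lemma absv_add_dom: "absv y < absv x \<Longrightarrow> absv (x + y :: 'c) = absv x"
proof -
  assume l: "absv y < absv x"
  have "absv x \<le> max (absv (x + y)) (absv y)" using absv_diff[of "x + y" y] by simp
  moreover have "absv (x + y) \<le> max (absv x) (absv y)" by (rule absv_add)
  ultimately show ?thesis using l by linarith
qed

lemma absv_diff_dom: "absv y < absv x \<Longrightarrow> absv (x - y :: 'c) = absv x"
  using absv_add_dom[of "- y" x] by simp

lemma absv_diff_max: "absv x \<noteq> absv y \<Longrightarrow> absv (x - y :: 'c) = max (absv x) (absv y)"
  using absv_diff_dom[of x y] absv_diff_dom[of y x] absv_diff_commute[of x y] by linarith

lemma absv_sum_le:
  assumes "B \<ge> 0" "\<And>i. i \<in> S \<Longrightarrow> absv (g i :: 'c) \<le> B"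
  shows "absv (sum g S) \<le> B"
  using assms(2)
proof (induction S rule: infinite_finite_induct)
  case (insert x F)
  hence "absv (g x) \<le> B" "absv (sum g F) \<le> B" by auto
  thus ?case using absv_add[of "g x" "sum g F"] unfolding sum.insert[OF insert.hyps] by linarith
qed (use assms(1) in simp_all)

lemma absv_sum_less:
  assumes "B > 0" "finite S" "\<And>i. i \<in> S \<Longrightarrow> absv (g i :: 'c) < B"
  shows "absv (sum g S) < B"
  using assms(2,3)
proof (induction S rule: finite_induct)
  case (insert x F)
  hence "absv (g x) < B" "absv (sum g F) < B" by auto
  thus ?case using absv_add[of "g x" "sum g F"] unfolding sum.insert[OF insert.hyps] by linarith
qed (use assms(1) in simp_all)

text \<open>A sum in which one term strictly dominates has the absolute value of that term.\<close>

lemma absv_sum_dominant: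
  assumes "finite S" "d \<in> S" "\<And>i. i \<in> S \<Longrightarrow> i \<noteq> d \<Longrightarrow> absv (g i :: 'c) < absv (g d)"
  shows "absv (sum g S) = absv (g d)"
proof -
  have eq: "sum g S = g d + sum g (S - {d})" using assms by (simp add: sum.remove)
  show ?thesis
  proof (cases "absv (g d) > 0")
    case True
    thus ?thesis unfolding eq using assms
      by (intro absv_add_dom absv_sum_less) auto
  next
    case False
    hence z: "g d = 0" by simp
    have "S - {d} = {}" using assms(3) z absv_nonneg by (metis Diff_iff absv_0 ex_in_conv not_less singletonI)
    thus ?thesis unfolding eq by (simp only: sum.empty) simp
  qed
qed

lemma emb_0 [simp]: "\<iota> 0 = 0"
  using emb_add[of 0 0] by (metis add.right_neutral add_left_cancel)

lemma emb_minus: "\<iota> (- x) = - \<iota> x"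
  using emb_add[of x "- x"] by (simp add: minus_unique)

lemma emb_diff: "\<iota> (x - y) = \<iota> x - \<iota> y"
  using emb_add[of x "- y"] by (simp add: emb_minus)

lemma emb_eq_0_iff [simp]: "\<iota> x = 0 \<longleftrightarrow> x = 0"
proof
  assume "\<iota> x = 0"
  show "x = 0"
  proof (rule ccontr)
    assume "x \<noteq> 0"
    hence "\<iota> (x * inverse x) = 1" by (simp add: emb_1)
    thus False using \<open>\<iota> x = 0\<close> by (simp add: emb_mult)
  qed
qed simp

lemma emb_power: "\<iota> (x ^ n) = \<iota> x ^ n"
  by (induction n) (simp_all add: emb_1 emb_mult)

section \<open>Limits\<close>

text \<open>
  The type carries a metric and a field structure, but no type class relates them; continuity of the
  field operations is derived here from the absolute value.
\<close>

lemma tendsto_absv_iff: "X \<longlonglongrightarrow> (x :: 'c) \<longleftrightarrow> (\<lambda>n. absv (X n - x)) \<longlonglongrightarrow> 0"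
  by (simp add: tendsto_dist_iff[of X] dist_absv)

lemma tendsto_plus:
  assumes "X \<longlonglongrightarrow> (x :: 'c)" "Y \<longlonglongrightarrow> y"
  shows "(\<lambda>n. X n + Y n) \<longlonglongrightarrow> x + y"
  unfolding tendsto_absv_iff
proof (rule Lim_null_comparison[OF always_eventually])
  show "(\<lambda>n. absv (X n - x) + absv (Y n - y)) \<longlonglongrightarrow> 0"
    using tendsto_add[OF assms[unfolded tendsto_absv_iff]] by simp
  show "\<forall>n. norm (absv (X n + Y n - (x + y))) \<le> absv (X n - x) + absv (Y n - y)"
  proof
    fix n
    have "absv (X n + Y n - (x + y)) \<le> max (absv (X n - x)) (absv (Y n - y))"
      using absv_add[of "X n - x" "Y n - y"] by (simp add: algebra_simps)
    thus "norm (absv (X n + Y n - (x + y))) \<le> absv (X n - x) + absv (Y n - y)"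
      using absv_nonneg[of "X n - x"] absv_nonneg[of "Y n - y"] absv_nonneg[of "X n + Y n - (x + y)"]
      unfolding real_norm_def by linarith
  qed
qed

lemma tendsto_absv:
  assumes "X \<longlonglongrightarrow> (x :: 'c)"
  shows "(\<lambda>n. absv (X n)) \<longlonglongrightarrow> absv x"
  unfolding absv_def by (intro tendsto_dist assms tendsto_const)

lemma tendsto_times:
  assumes "X \<longlonglongrightarrow> (x :: 'c)" "Y \<longlonglongrightarrow> y"
  shows "(\<lambda>n. X n * Y n) \<longlonglongrightarrow> x * y"
  unfolding tendsto_absv_iff
proof (rule Lim_null_comparison[OF always_eventually])
  show "(\<lambda>n. absv (X n - x) * absv (Y n) + absv x * absv (Y n - y)) \<longlonglongrightarrow> 0"
    using tendsto_add[OF tendsto_mult[OF assms(1)[unfolded tendsto_absv_iff] tendsto_absv[OF assms(2)]]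
      tendsto_mult[OF tendsto_const assms(2)[unfolded tendsto_absv_iff]], of "absv x"] by simp
  show "\<forall>n. norm (absv (X n * Y n - x * y)) \<le> absv (X n - x) * absv (Y n) + absv x * absv (Y n - y)"
  proof
    fix n
    have "absv (X n * Y n - x * y) \<le> max (absv ((X n - x) * Y n)) (absv (x * (Y n - y)))"
      using absv_add[of "(X n - x) * Y n" "x * (Y n - y)"] by (simp add: algebra_simps)
    moreover have "absv ((X n - x) * Y n) \<ge> 0" "absv (x * (Y n - y)) \<ge> 0" by simp_all
    ultimately show "norm (absv (X n * Y n - x * y)) \<le> absv (X n - x) * absv (Y n) + absv x * absv (Y n - y)"
      using absv_nonneg[of "X n * Y n - x * y"] unfolding absv_mult real_norm_def by linarith
  qed
qed

lemma tendsto_sum':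
  assumes "\<And>i. i \<in> S \<Longrightarrow> (\<lambda>n. X i n) \<longlonglongrightarrow> (x i :: 'c)"
  shows "(\<lambda>n. \<Sum>i\<in>S. X i n) \<longlonglongrightarrow> (\<Sum>i\<in>S. x i)"
  using assms by (induction S rule: infinite_finite_induct) (simp_all add: tendsto_plus)

lemma tendsto_power':
  assumes "X \<longlonglongrightarrow> (x :: 'c)"
  shows "(\<lambda>n. X n ^ k) \<longlonglongrightarrow> x ^ k"
  by (induction k) (simp_all add: tendsto_times assms)

lemma tendsto_poly':
  assumes "X \<longlonglongrightarrow> (x :: 'c)"
  shows "(\<lambda>n. poly P (X n)) \<longlonglongrightarrow> poly P x"
  unfolding poly_altdef by (intro tendsto_sum' tendsto_times tendsto_const tendsto_power' assms)

lemma ultrametric_Cauchy: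
  assumes "e \<longlonglongrightarrow> 0" "\<And>n. absv (X (Suc n) - X n :: 'c) \<le> e n"
  shows "convergent X"
proof -
  have "Cauchy X"
  proof (rule metric_CauchyI)
    fix r :: real assume r: "r > 0"
    have "eventually (\<lambda>n. e n < r / 2) sequentially"
      using assms(1) r by (intro order_tendstoD(2)) auto
    then obtain N where N: "\<And>n. n \<ge> N \<Longrightarrow> e n < r / 2" unfolding eventually_sequentially by blast
    have d: "absv (X n - X N) \<le> r / 2" if "n \<ge> N" for n
      using that
    proof (induction n rule: dec_induct)
      case (step n)
      have "absv (X (Suc n) - X N) \<le> max (absv (X (Suc n) - X n)) (absv (X n - X N))"
        using absv_add[of "X (Suc n) - X n" "X n - X N"] by simp
      thus ?case using step assms(2)[of n] N[of n] by linarith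
    qed (use r in simp)
    have "dist (X m) (X n) < r" if "m \<ge> N" "n \<ge> N" for m n
    proof -
      have "absv (X m - X n) \<le> max (absv (X m - X N)) (absv (X n - X N))"
        using absv_diff[of "X m - X N" "X n - X N"] by simp
      thus ?thesis using d[OF that(1)] d[OF that(2)] r unfolding dist_absv by linarith
    qed
    thus "\<exists>M. \<forall>m\<ge>M. \<forall>n\<ge>M. dist (X m) (X n) < r" by blast
  qed
  thus ?thesis by (rule Cauchy_convergent)
qed

section \<open>Algebraic elements\<close>

abbreviation Kalg :: "'c set" where "Kalg \<equiv> algebraic_over (range \<iota>)"

text \<open>The field is viewed as a vector space over the Laurent series, so that the dimension theory
  of vector spaces applies to algebraic elements.\<close>

definition scl :: "'a fls \<Rightarrow> 'c \<Rightarrow> 'c" where "scl a x = \<iota> a * x"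

lemma vector_space_scl: "vector_space scl"
  by unfold_locales (simp_all add: scl_def emb_add emb_mult emb_1 algebra_simps)

sublocale scl: vector_space scl by (rule vector_space_scl)

text \<open>If multiplication by x preserves a finite-dimensional space that contains 1, then the
  powers of x lie in that space and satisfy a linear relation, which is a polynomial with root x.\<close>

lemma algebraic_if_stable:
  assumes "finite B" "1 \<in> scl.span B" "\<And>b. b \<in> scl.span B \<Longrightarrow> x * b \<in> scl.span B"
  shows "x \<in> Kalg"
proof -
  have pw: "x ^ n \<in> scl.span B" for n
    by (induction n) (use assms in auto)
  show ?thesis
  \<comment> \<open>If the powers coincide somewhere, they do not form a family to which the dimension bound applies.\<close>
  proof (cases "inj_on (\<lambda>n. x ^ n) {..card B}")
    case False
    then obtain i j where ij: "i < j" "x ^ i = x ^ j"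
      unfolding inj_on_def by (metis nat_neq_iff)
    let ?P = "monom 1 j - monom (1 :: 'c) i"
    have "coeff ?P j = 1" using ij by simp
    hence "?P \<noteq> 0" by (metis coeff_0 zero_neq_one)
    moreover have "coeff ?P n \<in> range \<iota>" for n
    proof -
      have "coeff ?P n = \<iota> ((if n = j then 1 else 0) - (if n = i then 1 else 0))"
        by (simp add: emb_diff emb_1 split: if_splits) 
      thus ?thesis by blast
    qed
    moreover have "poly ?P x = 0" using ij by (simp add: poly_monom)
    ultimately show ?thesis unfolding algebraic_over_def by blast
  next
    case True
    let ?S = "(\<lambda>n. x ^ n) ` {..card B}"
    have "\<not> scl.independent ?S"
    proof
      assume "scl.independent ?S"
      from scl.independent_span_bound[OF assms(1) this] pw have "card ?S \<le> card B" by blast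
      thus False using True by (simp add: card_image)
    qed
    then obtain u v where u: "v \<in> ?S" "u v \<noteq> 0" "(\<Sum>v\<in>?S. scl (u v) v) = 0"
      using scl.dependent_finite[of ?S] by auto
    let ?P = "\<Sum>n\<le>card B. monom (\<iota> (u (x ^ n))) n"
    have cf: "coeff ?P n = (if n \<le> card B then \<iota> (u (x ^ n)) else 0)" for n
      by (simp add: coeff_sum)
    have "?P \<noteq> 0"
    proof
      assume "?P = 0"
      hence z: "coeff ?P n = 0" for n by (simp only: coeff_0)
      obtain n where n: "n \<le> card B" "v = x ^ n" using u(1) by auto
      have "\<iota> (u (x ^ n)) = 0" using z[of n] cf[of n] n(1) by simp
      thus False using u(2) n(2) by simp
    qed
    moreover have "coeff ?P n \<in> range \<iota>" for n
      unfolding cf by (metis emb_0 rangeI)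
    moreover have "poly ?P x = (\<Sum>v\<in>?S. scl (u v) v)"
      using True by (simp add: poly_sum poly_monom sum.reindex scl_def)
    ultimately show ?thesis using u(3) unfolding algebraic_over_def by (auto intro!: exI[of _ ?P])
  qed
qed

lemma algebraic_power_reduce:
  assumes "x \<in> Kalg"
  obtains n where "\<And>g B. (\<And>i. i < n \<Longrightarrow> g * x ^ i \<in> scl.span B) \<Longrightarrow> g * x ^ n \<in> scl.span B"
proof -
  obtain P where P: "P \<noteq> 0" "\<And>n. coeff P n \<in> range \<iota>" "poly P x = 0"
    using assms unfolding algebraic_over_def by blast
  have "\<forall>n. \<exists>a. coeff P n = \<iota> a" using P(2) by blast
  then obtain c where c: "\<And>n. coeff P n = \<iota> (c n)" by metis
  define n where "n = degree P"
  have cn: "c n \<noteq> 0" using P(1) c[of n] unfolding n_def by (metis emb_0 leading_coeff_0_iff)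
  have "g * x ^ n \<in> scl.span B" if "\<And>i. i < n \<Longrightarrow> g * x ^ i \<in> scl.span B" for g B
  proof -
    have "0 = g * poly P x" using P by simp
    also have "\<dots> = (\<Sum>i\<le>n. scl (c i) (g * x ^ i))"
      unfolding poly_altdef n_def[symmetric] scl_def c sum_distrib_left by (simp add: algebra_simps)
    also have "\<dots> = (\<Sum>i<n. scl (c i) (g * x ^ i)) + scl (c n) (g * x ^ n)"
      by (simp add: lessThan_Suc_atMost[symmetric])
    finally have "scl (c n) (g * x ^ n) = - (\<Sum>i<n. scl (c i) (g * x ^ i))"
      by (metis add.commute minus_unique)
    moreover have "(\<Sum>i<n. scl (c i) (g * x ^ i)) \<in> scl.span B"
      using that by (intro scl.span_sum scl.span_scale) auto
    ultimately have "scl (c n) (g * x ^ n) \<in> scl.span B" by (simp add: scl.span_neg)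
    hence "scl (inverse (c n)) (scl (c n) (g * x ^ n)) \<in> scl.span B" by (rule scl.span_scale)
    thus ?thesis using cn by simp
  qed
  thus ?thesis using that by blast
qed

lemma span_stable:
  assumes "\<And>b. b \<in> B \<Longrightarrow> x * b \<in> scl.span B" "b \<in> scl.span B"
  shows "x * b \<in> scl.span B"
  using assms(2)
proof (induction rule: scl.span_induct_alt)
  case (step c b w)
  have "x * (scl c b + w) = scl c (x * b) + x * w" by (simp add: scl_def algebra_simps)
  thus ?case using step assms(1) by (simp add: scl.span_add scl.span_scale)
qed (simp add: scl.span_zero)

text \<open>The span of the products \<open>x\<^sup>i y\<^sup>j\<close> with bounded exponents is stable under both x and y, hence
  under x + y and xy.\<close>

lemma algebraic_pair_span:
  assumes "x \<in> Kalg" "y \<in> Kalg"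
  obtains B where "finite B" "1 \<in> scl.span B" "\<And>b. b \<in> scl.span B \<Longrightarrow> x * b \<in> scl.span B"
    "\<And>b. b \<in> scl.span B \<Longrightarrow> y * b \<in> scl.span B"
proof -
  obtain n where n: "\<And>g B. (\<And>i. i < n \<Longrightarrow> g * x ^ i \<in> scl.span B) \<Longrightarrow> g * x ^ n \<in> scl.span B"
    using algebraic_power_reduce[OF assms(1)] by blast
  obtain m where m: "\<And>g B. (\<And>i. i < m \<Longrightarrow> g * y ^ i \<in> scl.span B) \<Longrightarrow> g * y ^ m \<in> scl.span B"
    using algebraic_power_reduce[OF assms(2)] by blast
  define B where "B = (\<lambda>(i, j). x ^ i * y ^ j) ` ({..<n} \<times> {..<m})"
  have mem: "x ^ i * y ^ j \<in> scl.span B" if "i < n" "j < m" for i j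
    using that unfolding B_def by (intro scl.span_base) auto
  have memx: "x ^ i * y ^ j \<in> scl.span B" if "i \<le> n" "j < m" for i j
  proof (cases "i = n")
    case True
    thus ?thesis using n[of "y ^ j" B] mem that by (simp add: mult.commute)
  qed (use that mem in auto)
  have memy: "x ^ i * y ^ j \<in> scl.span B" if "i < n" "j \<le> m" for i j
  proof (cases "j = m")
    case True
    thus ?thesis using m[of "x ^ i" B] mem that by simp
  qed (use that mem in auto)
  have one: "1 \<in> scl.span B"
  proof (cases "n = 0 \<or> m = 0")
    case True
    thus ?thesis using n[of 1 B] m[of 1 B] by auto
  qed (use mem[of 0 0] in auto)
  have "x * b \<in> scl.span B" if "b \<in> B" for b
    using that memx[of "Suc _"] unfolding B_def by (auto simp: mult.assoc[symmetric] Suc_le_eq)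
  moreover have "y * b \<in> scl.span B" if "b \<in> B" for b
    using that memy[of _ "Suc _"] unfolding B_def by (auto simp: mult_ac Suc_le_eq)
  ultimately show ?thesis using that[of B] one span_stable[of B] by (simp add: B_def)
qed

lemma Kalg_add: "x \<in> Kalg \<Longrightarrow> y \<in> Kalg \<Longrightarrow> x + y \<in> Kalg"
proof -
  assume "x \<in> Kalg" "y \<in> Kalg"
  then obtain B where "finite B" "1 \<in> scl.span B" "\<And>b. b \<in> scl.span B \<Longrightarrow> x * b \<in> scl.span B"
    "\<And>b. b \<in> scl.span B \<Longrightarrow> y * b \<in> scl.span B" using algebraic_pair_span by metis
  thus ?thesis by (intro algebraic_if_stable[of B]) (auto simp: distrib_right scl.span_add)
qed

lemma Kalg_mult: "x \<in> Kalg \<Longrightarrow> y \<in> Kalg \<Longrightarrow> x * y \<in> Kalg"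
proof -
  assume "x \<in> Kalg" "y \<in> Kalg"
  then obtain B where "finite B" "1 \<in> scl.span B" "\<And>b. b \<in> scl.span B \<Longrightarrow> x * b \<in> scl.span B"
    "\<And>b. b \<in> scl.span B \<Longrightarrow> y * b \<in> scl.span B" using algebraic_pair_span by metis
  thus ?thesis by (intro algebraic_if_stable[of B]) (auto simp: mult.assoc)
qed

lemma Kalg_emb: "\<iota> a \<in> Kalg"
proof -
  have "coeff [:- \<iota> a, 1:] n \<in> range \<iota>" for n
    by (metis coeff_pCons emb_0 emb_1 emb_minus rangeI coeff_0 coeff_pCons_0 coeff_pCons_Suc not0_implies_Suc)
  thus ?thesis unfolding algebraic_over_def by (auto intro!: exI[of _ "[:- \<iota> a, 1:]"])
qed

end

section \<open>Algebraic closedness of the completion\<close>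

definition linear_prod :: "'c::comm_ring_1 multiset \<Rightarrow> 'c poly" where
  "linear_prod A = (\<Prod>a\<in>#A. [:- a, 1:])"

lemma linear_prod_empty [simp]: "linear_prod {#} = 1"
  by (simp add: linear_prod_def)

lemma linear_prod_add [simp]: "linear_prod (add_mset a A) = [:- a, 1:] * linear_prod A"
  by (simp add: linear_prod_def)

lemma linear_prod_monic [simp]: "lead_coeff (linear_prod A :: 'c::idom poly) = 1"
  by (induction A) (simp_all add: lead_coeff_mult del: mult_pCons_left)

lemma linear_prod_neq_0 [simp]: "linear_prod A \<noteq> (0 :: 'c::idom poly)"
  by (metis leading_coeff_0_iff linear_prod_monic zero_neq_one)

lemma degree_linear_prod [simp]: "degree (linear_prod A :: 'c::idom poly) = size A"
  by (induction A) (simp_all add: degree_mult_eq del: mult_pCons_left)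

lemma proots_linear_prod [simp]: "proots (linear_prod A :: 'c::idom poly) = A"
  by (induction A) (simp_all add: proots_mult del: mult_pCons_left)

lemma poly_linear_prod_eq_0_iff: "poly (linear_prod A) x = 0 \<longleftrightarrow> x \<in># (A :: 'c::idom multiset)"
  by (induction A) auto

text \<open>The set S allows the same induction to be used for the polynomials with algebraic coefficients and for
  all polynomials.\<close>

lemma splits_if_roots:
  fixes P :: "'c::idom poly"
  assumes root: "\<And>P. P \<in> S \<Longrightarrow> lead_coeff P = 1 \<Longrightarrow> degree P > 0 \<Longrightarrow> \<exists>a Q. P = [:- a, 1:] * Q \<and> Q \<in> S"
    and "P \<in> S" "lead_coeff P = 1"
  shows "\<exists>A. P = linear_prod A"
  using assms(2,3)
proof (induction "degree P" arbitrary: P)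
  case 0
  hence "P = [:1:]" by (metis degree_0_id)
  thus ?case by (auto intro!: exI[of _ "{#}"])
next
  case (Suc n)
  then obtain a Q where Q: "P = [:- a, 1:] * Q" "Q \<in> S" using root[of P] by auto
  have "lead_coeff Q = 1" using Suc.prems Q by (simp add: lead_coeff_mult del: mult_pCons_left)
  moreover have "degree P = Suc (degree Q)"
    using Q calculation by (subst Q(1), subst degree_mult_eq) auto
  ultimately obtain A where "Q = linear_prod A" using Suc Q by auto
  thus ?case using Q by (intro exI[of _ "add_mset a A"]) simp
qed

context C_infinity
begin

text \<open>Synthetic division, from the top coefficient downwards.\<close>

lemma Kalg_coeff_quotient:
  assumes "\<And>n. coeff ([:- a, 1:] * Q) n \<in> Kalg" "a \<in> Kalg"
  shows "coeff Q n \<in> Kalg"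
proof -
  have rec: "coeff Q n = coeff ([:- a, 1:] * Q) (Suc n) + a * coeff Q (Suc n)" for n
    by simp
  have "n \<le> n + degree Q + 1" by simp
  thus ?thesis
  proof (induction n rule: inc_induct)
    case base
    have "coeff Q (n + degree Q + 1) = \<iota> 0" by (simp add: coeff_eq_0)
    thus ?case using Kalg_emb by metis
  next
    case (step m)
    show ?case unfolding rec[of m] by (intro Kalg_add Kalg_mult assms step.IH)
  qed
qed

lemma Kalg_splits:
  assumes "\<And>n. coeff P n \<in> Kalg" "lead_coeff P = 1"
  shows "\<exists>A. P = linear_prod A"
proof (rule splits_if_roots[of "{P. \<forall>n. coeff P n \<in> Kalg}"])
  fix P assume P: "P \<in> {P. \<forall>n. coeff P n \<in> Kalg}" "degree P > 0"
  then obtain a where a: "a \<in> Kalg" "poly P a = 0" using alg_closed by blast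
  then obtain Q where "P = [:- a, 1:] * Q" by (auto simp: poly_eq_0_iff_dvd)
  thus "\<exists>a Q. P = [:- a, 1:] * Q \<and> Q \<in> {P. \<forall>n. coeff P n \<in> Kalg}"
    using Kalg_coeff_quotient[of a Q] a P by blast
qed (use assms in auto)

lemma Kalg_approx:
  assumes "lead_coeff P = 1" "e > 0"
  shows "\<exists>Q. degree Q = degree P \<and> lead_coeff Q = 1 \<and> (\<forall>n. coeff Q n \<in> Kalg) \<and>
    (\<forall>n. absv (coeff Q n - coeff P n) < e)"
proof -
  have "\<exists>a \<in> Kalg. absv (a - coeff P n) < e" for n
    using alg_dense closure_approachable[of "coeff P n" Kalg] assms(2) dist_absv by (metis UNIV_I)
  then obtain a where a: "\<And>n. a n \<in> Kalg" "\<And>n. absv (a n - coeff P n) < e" by metis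
  define Q where "Q = (\<Sum>n<degree P. monom (a n) n) + monom 1 (degree P)"
  have cf: "coeff Q n = (if n < degree P then a n else if n = degree P then 1 else 0)" for n
    unfolding Q_def by (simp add: coeff_sum)
  have "degree Q = degree P"
    by (intro antisym degree_le le_degree) (auto simp: cf)
  moreover have "coeff Q n \<in> Kalg" for n
    using a(1) Kalg_emb[of 0] Kalg_emb[of 1] by (simp add: cf emb_1)
  moreover have "absv (coeff Q n - coeff P n) < e" for n
    using a(2)[of n] assms by (auto simp: cf coeff_eq_0)
  ultimately show ?thesis by (intro exI[of _ Q]) (simp add: cf)
qed

lemma monic_root_bound:
  assumes "lead_coeff P = 1" "\<And>n. absv (coeff P n) \<le> R" "poly P a = (0 :: 'c)"
  shows "absv a \<le> R"
proof (rule ccontr)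
  assume "\<not> absv a \<le> R"
  hence aR: "R < absv a" by simp
  have R1: "R \<ge> 1" using assms(1) assms(2)[of "degree P"] by simp
  have "absv (poly P a) = absv (coeff P (degree P) * a ^ degree P)"
    unfolding poly_altdef
  proof (rule absv_sum_dominant)
    fix i assume i: "i \<in> {..degree P}" "i \<noteq> degree P"
    have "absv (coeff P i * a ^ i) \<le> R * absv a ^ i"
      unfolding absv_mult absv_power by (intro mult_right_mono assms) simp
    also have "\<dots> < absv a * absv a ^ i"
      using aR R1 by (intro mult_strict_right_mono zero_less_power) linarith+
    also have "\<dots> = absv a ^ Suc i" by simp
    also have "\<dots> \<le> absv a ^ degree P" using i aR R1 by (intro power_increasing) auto
    finally show "absv (coeff P i * a ^ i) < absv (coeff P (degree P) * a ^ degree P)"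
      using assms(1) by (simp add: absv_power)
  qed auto
  hence "absv a ^ degree P = 0" using assms by (simp add: absv_power)
  thus False using aR R1 by simp
qed

lemma poly_diff_bound:
  assumes "degree P \<le> n" "degree Q \<le> n" "\<And>i. absv (coeff P i - coeff Q i) \<le> e" "absv a \<le> R" "R \<ge> 1" "e \<ge> 0"
  shows "absv (poly P a - poly Q a :: 'c) \<le> e * R ^ n"
proof -
  have "poly P a - poly Q a = poly (P - Q) a" by simp
  also have "\<dots> = (\<Sum>i\<le>n. coeff (P - Q) i * a ^ i)"
    unfolding poly_altdef using degree_diff_le[OF assms(1,2)]
    by (intro sum.mono_neutral_left) (auto simp: coeff_eq_0 simp del: coeff_diff)
  also have "absv \<dots> \<le> e * R ^ n"
  proof (rule absv_sum_le)
    fix i assume i: "i \<in> {..n}"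
    have "absv (coeff (P - Q) i * a ^ i) \<le> e * absv a ^ i"
      unfolding absv_mult absv_power using assms by (intro mult_right_mono) auto
    also have "\<dots> \<le> e * R ^ i" using assms by (intro mult_left_mono power_mono) auto
    also have "\<dots> \<le> e * R ^ n" using assms i by (intro mult_left_mono power_increasing) auto
    finally show "absv (coeff (P - Q) i * a ^ i) \<le> e * R ^ n" .
  qed (use assms in simp)
  finally show ?thesis .
qed

text \<open>If all n factors had absolute value larger than d, the product would exceed \<open>d\<^sup>n\<close>.\<close>

lemma near_root:
  assumes "absv (poly (linear_prod A) a) \<le> d ^ size A" "A \<noteq> {#}" "d > 0"
  shows "\<exists>b \<in># A. absv (a - b :: 'c) \<le> d"
proof (rule ccontr)
  assume "\<not> ?thesis"
  hence far: "\<And>b. b \<in># A \<Longrightarrow> d < absv (a - b)" by (auto simp: not_le)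
  have ge: "d ^ size B \<le> absv (poly (linear_prod B) a)" if "B \<subseteq># A" for B
    using that
  proof (induction B)
    case (add b B)
    hence "b \<in># A" "B \<subseteq># A" by (auto dest: subset_mset.dual_order.trans mset_subset_eq_insertD)
    hence "d * d ^ size B \<le> absv (a - b) * absv (poly (linear_prod B) a)"
      using far[of b] add assms(3) by (intro mult_mono) auto
    also have "\<dots> = absv (poly (linear_prod (add_mset b B)) a)"
      by (simp add: absv_mult[symmetric] algebra_simps)
    finally show ?case by simp
  qed simp
  obtain b B where A: "A = add_mset b B" using assms(2) by (meson multiset_cases)
  have "d * d ^ size B < absv (a - b) * absv (poly (linear_prod B) a)"
    using far[of b] ge[of B] assms(3) by (intro mult_less_le_imp_less) (auto simp: A)
  also have "\<dots> = absv (poly (linear_prod A) a)"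
    by (simp add: absv_mult[symmetric] algebra_simps A)
  finally show False using assms(1) by (simp add: A)
qed

text \<open>Approximate the polynomial by polynomials with algebraic coefficients.  These split, and
  a root of one of them is a near-root of the next, so it lies close to one of the roots of the next.  The roots chosen in
  this way form a Cauchy sequence whose limit is a root.\<close>

lemma monic_has_root:
  assumes "lead_coeff P = 1" "degree P > 0"
  shows "\<exists>a :: 'c. poly P a = 0"
proof -
  define n where "n = degree P"
  define R where "R = Max ((\<lambda>i. absv (coeff P i)) ` {..n})"
  have R: "absv (coeff P i) \<le> R" for i
  proof (cases "i \<le> n")
    case False
    have "absv (coeff P n) \<le> R" unfolding R_def by (intro Max_ge) auto
    thus ?thesis using False assms by (simp add: n_def coeff_eq_0)
  qed (auto simp: R_def)
  have R1: "R \<ge> 1" using R[of n] assms unfolding n_def by simp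
  \<comment> \<open>With this precision of the coefficients, consecutive roots differ by at most \<open>(1 / 2) ^ m\<close>.\<close>
  define e where "e m = (((1 / 2) ^ m) ^ n) / R ^ n" for m :: nat
  have Rn1: "R ^ n \<ge> 1" using R1 by (rule one_le_power)
  have e: "e m > 0" "e m \<le> 1" for m
  proof -
    have "((1 / 2 :: real) ^ m) ^ n \<le> 1" by (intro power_le_one) auto
    thus "e m \<le> 1" unfolding e_def using Rn1 by simp
    show "e m > 0" using R1 by (simp add: e_def)
  qed
  have "\<exists>Q. degree Q = n \<and> lead_coeff Q = 1 \<and> (\<forall>i. coeff Q i \<in> Kalg) \<and>
    (\<forall>i. absv (coeff Q i - coeff P i) < e m)" for m
    unfolding n_def by (rule Kalg_approx[OF assms(1) e(1)])
  then obtain Q where Q: "\<And>m. degree (Q m) = n" "\<And>m. lead_coeff (Q m) = 1"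
    "\<And>m i. coeff (Q m) i \<in> Kalg" "\<And>m i. absv (coeff (Q m) i - coeff P i) < e m"
    by metis
  have QR: "absv (coeff (Q m) i) \<le> R" for m i
    using absv_add[of "coeff (Q m) i - coeff P i" "coeff P i"] Q(4)[of m i] e(2)[of m] R[of i] R1 by simp
  have "\<exists>A. Q m = linear_prod A" for m using Kalg_splits[OF Q(3) Q(2)] .
  then obtain A where A: "\<And>m. Q m = linear_prod (A m)" by metis
  have sz: "size (A m) = n" for m using Q(1)[of m] A by simp
  have rt: "poly (Q m) b = 0 \<longleftrightarrow> b \<in># A m" for m b
    using poly_linear_prod_eq_0_iff[of "A m" b] by (simp add: A)
  have step: "\<exists>b. poly (Q (Suc m)) b = 0 \<and> absv (a - b) \<le> (1 / 2) ^ m" if "poly (Q m) a = 0" for a m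
  proof -
    have aR: "absv a \<le> R" by (rule monic_root_bound[OF Q(2) QR that])
    have "e (Suc m) \<le> e m"
      unfolding e_def using R1 by (intro divide_right_mono power_mono power_decreasing) auto
    hence "absv (coeff (Q (Suc m)) i - coeff (Q m) i) \<le> e m" for i
      using absv_diff[of "coeff (Q (Suc m)) i - coeff P i" "coeff (Q m) i - coeff P i"]
        Q(4)[of m i] Q(4)[of "Suc m" i] by simp
    hence "absv (poly (Q (Suc m)) a - poly (Q m) a) \<le> e m * R ^ n"
      using aR R1 e[of m] Q(1) by (intro poly_diff_bound) auto
    also have "\<dots> = ((1 / 2) ^ m) ^ n" using R1 by (simp add: e_def)
    finally have "absv (poly (linear_prod (A (Suc m))) a) \<le> ((1 / 2) ^ m) ^ size (A (Suc m))"
      using that by (simp add: A sz)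
    moreover have "A (Suc m) \<noteq> {#}" using sz[of "Suc m"] assms(2) unfolding n_def by auto
    ultimately show ?thesis using near_root[of "A (Suc m)" a "(1 / 2) ^ m"] rt by auto
  qed
  obtain a where a: "\<And>m. poly (Q m) (a m) = 0" "\<And>m. absv (a m - a (Suc m)) \<le> (1 / 2) ^ m"
  proof -
    have "\<exists>b. poly (Q 0) b = 0"
      using sz[of 0] assms(2) rt[of 0] unfolding n_def by (metis size_empty less_irrefl multiset_nonemptyE)
    with step that dependent_nat_choice[of "\<lambda>m a. poly (Q m) a = 0" "\<lambda>m a b. absv (a - b) \<le> (1 / 2) ^ m"]
    show ?thesis by blast
  qed
  have half: "(\<lambda>m. (1 / 2 :: real) ^ m) \<longlonglongrightarrow> 0" by (intro LIMSEQ_power_zero) auto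
  have "convergent a"
    using ultrametric_Cauchy[OF half] a(2) absv_diff_commute by metis
  then obtain l where l: "a \<longlonglongrightarrow> l" unfolding convergent_def by blast
  have "(\<lambda>m. absv (poly P (a m))) \<longlonglongrightarrow> 0"
  proof (rule Lim_null_comparison[OF always_eventually half])
    show "\<forall>m. norm (absv (poly P (a m))) \<le> (1 / 2) ^ m"
    proof
      fix m
      have "absv (poly P (a m) - poly (Q m) (a m)) \<le> e m * R ^ n"
        using monic_root_bound[OF Q(2) QR a(1)] R1 e[of m] Q(1) Q(4)[THEN less_imp_le]
        by (intro poly_diff_bound) (auto simp: absv_diff_commute n_def)
      also have "\<dots> = (1 / 2) ^ (m * n)" using R1 by (simp add: e_def power_mult)
      also have "\<dots> \<le> (1 / 2) ^ m" using assms(2) n_def by (intro power_decreasing) auto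
      finally show "norm (absv (poly P (a m))) \<le> (1 / 2) ^ m" using a(1) by simp
    qed
  qed
  moreover have "(\<lambda>m. absv (poly P (a m))) \<longlonglongrightarrow> absv (poly P l)"
    by (intro tendsto_absv tendsto_poly' l)
  ultimately have "absv (poly P l) = 0" by (rule LIMSEQ_unique[rotated])
  thus ?thesis by auto
qed

lemma monic_splits:
  assumes "lead_coeff P = (1 :: 'c)"
  shows "\<exists>A. P = linear_prod A"
proof (rule splits_if_roots[of UNIV])
  fix P :: "'c poly" assume P: "lead_coeff P = 1" "degree P > 0"
  then obtain a where "poly P a = 0" using monic_has_root by blast
  then obtain Q where "P = [:- a, 1:] * Q" by (auto simp: poly_eq_0_iff_dvd)
  thus "\<exists>a Q. P = [:- a, 1:] * Q \<and> Q \<in> UNIV" by blast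
qed (use assms in simp_all)

section \<open>The value group\<close>

definition lg :: "'c \<Rightarrow> real" where "lg x = log (real q) (absv x)"

lemma q_gt_1: "real q > 1" using q_ge_2 by simp

lemma lg_less_iff: "x \<noteq> 0 \<Longrightarrow> y \<noteq> 0 \<Longrightarrow> lg x < lg y \<longleftrightarrow> absv x < absv y"
  unfolding lg_def using q_gt_1 by simp

lemma lg_eq_iff: "x \<noteq> 0 \<Longrightarrow> y \<noteq> 0 \<Longrightarrow> lg x = lg y \<longleftrightarrow> absv x = absv y"
  unfolding lg_def using q_gt_1 inj_onD[OF log_inj[of "real q"], of "absv x" "absv y"] by auto

lemma lg_mult: "x \<noteq> 0 \<Longrightarrow> y \<noteq> 0 \<Longrightarrow> lg (x * y) = lg x + lg y"
  unfolding lg_def using q_gt_1 by (simp add: absv_mult log_mult)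

lemma lg_power: "x \<noteq> 0 \<Longrightarrow> lg (x ^ n) = n * lg x"
  unfolding lg_def using q_gt_1 by (simp add: absv_power log_nat_power)

text \<open>The logarithms of absolute values contain all rationals u / n, as those of the roots of \<open>X\<^sup>n - T\<^sup>u\<close>.\<close>

lemma value_group_dense:
  assumes "a < b"
  shows "\<exists>z. z \<noteq> 0 \<and> a < lg z \<and> lg z < b"
proof -
  obtain r :: rat where r: "a < of_rat r" "of_rat r < b" using of_rat_dense[OF assms] by blast
  obtain u v where uv: "quotient_of r = (u, v)" by force
  define n where "n = nat v"
  have v: "v > 0" using quotient_of_denom_pos[OF uv] .
  hence n: "n > 0" unfolding n_def by simp
  have r_eq: "real_of_rat r = real_of_int u / real n"
    using quotient_of_div[OF uv] v by (simp add: of_rat_divide n_def)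
  let ?c = "\<iota> (fls_X_intpow (- u))"
  have c: "absv ?c = real q powi u"
    by (subst absv_emb) (auto simp: fls_shift_eq0_iff)
  let ?P = "monom 1 n - [:?c:]"
  have cf: "coeff ?P i = \<iota> ((if i = n then 1 else 0) - (if i = 0 then fls_X_intpow (- u) else 0))" for i
    by (auto simp: emb_diff emb_1 coeff_pCons split: nat.split)
  have "coeff ?P n \<noteq> 0" using n by (simp add: coeff_pCons split: nat.split)
  hence "degree ?P > 0" using n le_degree[of ?P n] by linarith
  moreover have "\<forall>i. coeff ?P i \<in> Kalg" using cf Kalg_emb by metis
  ultimately obtain z where z: "poly ?P z = 0" using alg_closed by blast
  hence "z ^ n = ?c" by (simp add: poly_monom)
  hence *: "absv z ^ n = real q powi u" using c absv_power by metis
  hence z0: "z \<noteq> 0" using n q_gt_1 by (auto simp: zero_power power_int_eq_0_iff)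
  have "real n * lg z = log (real q) (absv z ^ n)"
    using z0 by (simp add: lg_def log_nat_power)
  also have "\<dots> = log (real q) (real q powr real_of_int u)"
    unfolding * using q_gt_1 by (simp add: powr_real_of_int')
  also have "\<dots> = real_of_int u" using q_gt_1 by simp
  finally have "lg z = real_of_rat r" using n by (simp add: r_eq field_simps)
  thus ?thesis using r z0 by auto
qed

end

section \<open>Power sums over the finite field\<close>

context C_infinity
begin

definition sc :: "'a \<Rightarrow> 'c" where "sc c = \<iota> (fls_const c)"

lemma sc_0 [simp]: "sc 0 = 0" by (simp add: sc_def)
lemma sc_1 [simp]: "sc 1 = 1" by (simp add: sc_def emb_1)
lemma sc_add: "sc (a + b) = sc a + sc b"
  unfolding sc_def emb_add[symmetric] by (simp add: fls_plus_const)
lemma sc_minus: "sc (- a) = - sc a" by (simp add: sc_def emb_minus)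
lemma sc_diff: "sc (a - b) = sc a - sc b" using sc_add[of a "- b"] by (simp add: sc_minus)
lemma sc_mult: "sc (a * b) = sc a * sc b"
  unfolding sc_def emb_mult[symmetric] by simp
lemma sc_power: "sc (a ^ n) = sc a ^ n" by (simp add: sc_def fls_const_power emb_power)
lemma sc_sum: "sc (sum g S) = (\<Sum>i\<in>S. sc (g i))"
  by (induction S rule: infinite_finite_induct) (simp_all add: sc_add)
lemma sc_of_nat: "sc (of_nat n) = of_nat n"
  by (induction n) (simp_all add: sc_add)
lemma sc_eq_0_iff [simp]: "sc c = 0 \<longleftrightarrow> c = 0"
  unfolding sc_def emb_eq_0_iff using fls_const_nonzero[of c] by auto
lemma absv_sc: "c \<noteq> 0 \<Longrightarrow> absv (sc c) = 1"
  unfolding sc_def by (subst absv_emb) (simp_all add: fls_const_nonzero)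
lemma absv_sc_le: "absv (sc c) \<le> 1"
  by (cases "c = 0") (simp_all add: absv_sc)

lemma finite_field_power_card:
  assumes "(a :: 'a) \<noteq> 0"
  shows "a ^ (q - 1) = 1"
proof -
  have "(\<Prod>x\<in>UNIV - {0}. x) = (\<Prod>x\<in>UNIV - {0}. a * x)"
    using assms by (intro prod.reindex_bij_witness[of _ "\<lambda>x. a * x" "\<lambda>x. x / a"]) auto
  also have "\<dots> = a ^ (q - 1) * (\<Prod>x\<in>UNIV - {0}. x)"
    by (simp add: prod.distrib card_Diff_singleton card_q)
  finally show ?thesis by auto
qed

lemma of_nat_q: "of_nat q = (0 :: 'a)"
proof -
  have "(\<Sum>x\<in>UNIV. x) = (\<Sum>x\<in>UNIV. x + (1 :: 'a))"
    by (intro sum.reindex_bij_witness[of _ "\<lambda>x. x + 1" "\<lambda>x. x - 1"]) auto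
  also have "\<dots> = (\<Sum>x\<in>UNIV. x) + of_nat q" by (simp add: sum.distrib card_q)
  finally show ?thesis by simp
qed

text \<open>If q - 1 does not divide n, some nonzero a has \<open>a\<^sup>n \<noteq> 1\<close>, and the sum is invariant
  under multiplication by \<open>a\<^sup>n\<close>.\<close>

lemma finite_field_power_sum:
  "(\<Sum>c\<in>UNIV. (c :: 'a) ^ n) = (if n > 0 \<and> (q - 1) dvd n then - 1 else 0)"
proof (cases "n > 0 \<and> (q - 1) dvd n")
  case True
  then obtain d where d: "n = (q - 1) * d" by auto
  have "(\<Sum>c\<in>UNIV. c ^ n) = (\<Sum>c\<in>UNIV - {0}. (c :: 'a) ^ n)"
    using True by (intro sum.mono_neutral_right) auto
  also have "\<dots> = (\<Sum>c\<in>UNIV - {0 :: 'a}. 1)"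
  proof (intro sum.cong refl)
    fix c :: 'a assume "c \<in> UNIV - {0}"
    thus "c ^ n = 1" unfolding d power_mult using finite_field_power_card[of c] by simp
  qed
  also have "\<dots> = of_nat (q - 1)" by (simp add: card_Diff_singleton card_q)
  also have "\<dots> = - 1" using of_nat_q q_ge_2 by (simp add: of_nat_diff)
  finally show ?thesis using True by simp
next
  case False
  show ?thesis
  proof (cases "n = 0")
    case True
    thus ?thesis using of_nat_q card_q by simp
  next
    case n0: False
    \<comment> \<open>The reduced exponent r is less than q - 1, too small for \<open>X\<^sup>r - 1\<close> to vanish on all nonzero elements.\<close>
    define r where "r = n mod (q - 1)"
    have r: "r > 0" "r < q - 1" using False n0 q_ge_2 by (auto simp: r_def dvd_eq_mod_eq_0)
    let ?P = "monom 1 r - [:1 :: 'a:]"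
    have "coeff ?P r = 1" using r by (simp add: coeff_pCons split: nat.split)
    hence P0: "?P \<noteq> 0" by (metis coeff_0 zero_neq_one)
    have "degree ?P \<le> r" by (intro degree_diff_le degree_monom_le) auto
    hence "card {x. poly ?P x = 0} \<le> r" using card_poly_roots_bound[OF P0] by linarith
    moreover have "card (UNIV - {0 :: 'a}) = q - 1" by (simp add: card_Diff_singleton card_q)
    ultimately have "\<not> UNIV - {0} \<subseteq> {x. poly ?P x = 0}"
      using r card_mono[of "{x. poly ?P x = 0}" "UNIV - {0}"] by auto
    then obtain a :: 'a where a: "a \<noteq> 0" "a ^ r \<noteq> 1" by (auto simp: poly_monom)
    have "n = (q - 1) * (n div (q - 1)) + r" unfolding r_def by simp
    hence "a ^ n = a ^ r" using finite_field_power_card[OF a(1)]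
      by (metis mult_1 power_add power_mult power_one)
    hence an: "a ^ n \<noteq> 1" using a by simp
    have "(\<Sum>c\<in>UNIV. c ^ n) = (\<Sum>c\<in>UNIV. (a * c) ^ n)"
      using a by (intro sum.reindex_bij_witness[of _ "\<lambda>x. a * x" "\<lambda>x. x / a"]) auto
    also have "\<dots> = a ^ n * (\<Sum>c\<in>UNIV. c ^ n)" by (simp add: power_mult_distrib sum_distrib_left)
    finally have "(1 - a ^ n) * (\<Sum>c\<in>UNIV. c ^ n) = 0" by (simp add: algebra_simps)
    thus ?thesis using an False by auto
  qed
qed

lemma sc_power_sum: "(\<Sum>c\<in>UNIV. sc c ^ n) = (if n > 0 \<and> (q - 1) dvd n then - 1 else 0)"
  using arg_cong[OF finite_field_power_sum[of n], of sc]
  by (simp add: sc_sum sc_power sc_minus)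

end

locale C_infinity_p = C_infinity q \<iota>
  for q and \<iota> :: "'a::{field,finite} fls \<Rightarrow> 'c::{field,complete_space}" +
  fixes p f :: nat
  assumes p: "prime p" and f: "f \<ge> 1" and q: "q = p ^ f"
begin

lemma of_nat_eq_0_iff: "of_nat n = (0 :: 'c) \<longleftrightarrow> p dvd n"
proof -
  have "of_nat n = (0 :: 'c) \<longleftrightarrow> of_nat n = (0 :: 'a)"
    using sc_eq_0_iff[of "of_nat n"] by (simp add: sc_of_nat)
  also have "\<dots> \<longleftrightarrow> CHAR('a) dvd n" by (rule of_nat_eq_0_iff_char_dvd)
  also have "CHAR('a) = p"
  proof -
    have "(of_nat p :: 'a) ^ f = 0" using of_nat_q q by simp
    hence "of_nat p = (0 :: 'a)" using f by simp
    hence "CHAR('a) dvd p" by (simp add: of_nat_eq_0_iff_char_dvd)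
    thus ?thesis using p CHAR_not_1' prime_nat_iff by (metis One_nat_def)
  qed
  finally show ?thesis .
qed

lemma absv_of_nat: "\<not> p dvd n \<Longrightarrow> absv (of_nat n :: 'c) = 1"
  using absv_sc[of "of_nat n"] of_nat_eq_0_iff[of n] sc_eq_0_iff[of "of_nat n"] by (simp add: sc_of_nat)

lemma diff_power_p: "(x - y :: 'c) ^ (p ^ M) = x ^ (p ^ M) - y ^ (p ^ M)"
proof -
  have "CHAR('c) = p" using of_nat_eq_0_iff by (intro CHAR_eqI) auto
  hence "(x - y + y) ^ (p ^ M) = (x - y) ^ (p ^ M) + y ^ (p ^ M)"
    using p by (intro freshmans_dream') auto
  thus ?thesis by simp
qed

end

section \<open>Finite layers of the lattice\<close>

locale sep_lattice = C_infinity_p q \<iota> p f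
  for q and \<iota> :: "'a::{field,finite} fls \<Rightarrow> 'c::{field,complete_space}" and p f +
  fixes \<Lambda> :: "'c set" and lam :: "nat \<Rightarrow> 'c"
  assumes lattice: "normalized_separable_lattice \<iota> \<Lambda> lam"
begin

lemma lam_0 [simp]: "lam 0 = 1" using lattice unfolding normalized_separable_lattice_def by blast

lemma lam_mono: "strict_mono (\<lambda>i. absv (lam i))"
  using lattice unfolding normalized_separable_lattice_def separable_lattice_def by blast

lemma lam_less_iff: "absv (lam i) < absv (lam j) \<longleftrightarrow> i < j"
  using strict_mono_less[OF lam_mono] by simp

lemma lam_le_iff: "absv (lam i) \<le> absv (lam j) \<longleftrightarrow> i \<le> j"
  using strict_mono_less_eq[OF lam_mono] by simp

lemma lam_ge_1: "absv (lam i) \<ge> 1"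
  using lam_le_iff[of 0 i] by simp

lemma lam_neq_0 [simp]: "lam i \<noteq> 0"
  using lam_ge_1[of i] by auto

text \<open>The span of the d basis vectors \<open>\<lambda>\<^sub>m, ..., \<lambda>\<^sub>m\<^sub>+\<^sub>d\<^sub>-\<^sub>1\<close>.  Apart from the initial layers with m = 0, the general ones
  serve as systems of coset representatives.\<close>

primrec W :: "nat \<Rightarrow> nat \<Rightarrow> 'c set" where
  "W m 0 = {0}"
| "W m (Suc d) = (\<lambda>(c, v). sc c * lam (m + d) + v) ` (UNIV \<times> W m d)"

abbreviation V :: "nat \<Rightarrow> 'c set" where "V \<equiv> W 0"

lemma finite_W [simp]: "finite (W m d)"
  by (induction d) auto

lemma zero_in_W [simp]: "0 \<in> W m d"
proof (induction d)
  case (Suc d)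
  thus ?case by (auto intro!: image_eqI[of _ _ "(0, 0)"])
qed simp

lemma W_less: "v \<in> W m d \<Longrightarrow> absv v < absv (lam (m + d))"
proof (induction d arbitrary: v)
  case (Suc d)
  then obtain c w where w: "v = sc c * lam (m + d) + w" "w \<in> W m d" by auto
  have "absv (sc c * lam (m + d)) \<le> 1 * absv (lam (m + d))"
    unfolding absv_mult by (intro mult_right_mono absv_sc_le) simp
  hence "absv v \<le> absv (lam (m + d))"
    using absv_add[of "sc c * lam (m + d)" w] Suc.IH[OF w(2)] unfolding w(1) by linarith
  also have "\<dots> < absv (lam (m + Suc d))" by (simp add: lam_less_iff)
  finally show ?case .
qed simp

lemma absv_W_step:
  assumes "w \<in> W m d" "c \<noteq> 0"
  shows "absv (sc c * lam (m + d) + w) = absv (lam (m + d))"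
proof -
  have "absv (sc c * lam (m + d)) = absv (lam (m + d))" using assms by (simp add: absv_mult absv_sc)
  thus ?thesis using absv_add_dom[of w "sc c * lam (m + d)"] W_less[OF assms(1)] by simp
qed

lemma W_nonzero_ge: "v \<in> W m d \<Longrightarrow> v \<noteq> 0 \<Longrightarrow> absv (lam m) \<le> absv v"
proof (induction d arbitrary: v)
  case (Suc d)
  then obtain c w where w: "v = sc c * lam (m + d) + w" "w \<in> W m d" by auto
  show ?case
  proof (cases "c = 0")
    case False
    hence "absv v = absv (lam (m + d))" unfolding w(1) by (rule absv_W_step[OF w(2)])
    thus ?thesis by (simp add: lam_le_iff)
  qed (use Suc w in auto)
qed simp

lemma W_closed: "u \<in> W m d \<Longrightarrow> v \<in> W m d \<Longrightarrow> u - v \<in> W m d"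
proof (induction d arbitrary: u v)
  case (Suc d)
  obtain a u' where u: "u = sc a * lam (m + d) + u'" "u' \<in> W m d" using Suc.prems by auto
  obtain b v' where v: "v = sc b * lam (m + d) + v'" "v' \<in> W m d" using Suc.prems by auto
  have "u - v = sc (a - b) * lam (m + d) + (u' - v')" unfolding u v sc_diff by (simp add: algebra_simps)
  thus ?case using Suc.IH[OF u(2) v(2)] by (auto intro!: image_eqI[of _ _ "(a - b, u' - v')"])
qed simp

lemma W_minus: "v \<in> W m d \<Longrightarrow> - v \<in> W m d"
  using W_closed[of 0 m d v] by simp

lemma W_plus: "u \<in> W m d \<Longrightarrow> v \<in> W m d \<Longrightarrow> u + v \<in> W m d"
  using W_closed[of u m d "- v"] W_minus by simp

lemma W_scale: "v \<in> W m d \<Longrightarrow> sc c * v \<in> W m d"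
proof (induction d arbitrary: v)
  case (Suc d)
  obtain b v' where v: "v = sc b * lam (m + d) + v'" "v' \<in> W m d" using Suc.prems by auto
  have "sc c * v = sc (c * b) * lam (m + d) + sc c * v'" unfolding v sc_mult by (simp add: algebra_simps)
  thus ?case using Suc.IH[OF v(2)] by (auto intro!: image_eqI[of _ _ "(c * b, sc c * v')"])
qed simp

text \<open>A nonzero multiple of \<open>\<lambda>\<^sub>m\<^sub>+\<^sub>d\<close> is larger than every element of the layer below it, so the
  coefficient is determined by the absolute values.\<close>

lemma W_inj: "inj_on (\<lambda>(c, v). sc c * lam (m + d) + v) (UNIV \<times> W m d)"
proof (rule inj_onI, clarify)
  fix a u b v assume uv: "u \<in> W m d" "v \<in> W m d" "sc a * lam (m + d) + u = sc b * lam (m + d) + v"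
  have eq: "sc (a - b) * lam (m + d) + (u - v) = 0" using uv(3) unfolding sc_diff by (simp add: algebra_simps)
  have "a = b"
  proof (rule ccontr)
    assume "a \<noteq> b"
    hence "absv (sc (a - b) * lam (m + d) + (u - v)) = absv (lam (m + d))"
      by (intro absv_W_step W_closed uv) simp
    thus False unfolding eq by simp
  qed
  thus "a = b \<and> u = v" using uv(3) by simp
qed

lemma sum_W_Suc: "(\<Sum>v\<in>W m (Suc d). h v) = (\<Sum>c\<in>UNIV. \<Sum>v\<in>W m d. h (sc c * lam (m + d) + v))"
  unfolding W.simps sum.reindex[OF W_inj] sum.cartesian_product by (simp add: case_prod_unfold)

text \<open>\<open>W m d\<close> is a system of representatives for the cosets of \<open>V m\<close> in \<open>V (m + d)\<close>.\<close>

lemma sum_W_split: "(\<Sum>v\<in>V (m + d). h v) = (\<Sum>u\<in>W m d. \<Sum>v\<in>V m. h (u + v))"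
proof (induction d arbitrary: h)
  case (Suc d)
  have "(\<Sum>v\<in>V (m + Suc d). h v) = (\<Sum>c\<in>UNIV. \<Sum>v\<in>V (m + d). h (sc c * lam (m + d) + v))"
    using sum_W_Suc[of h 0 "m + d"] by simp
  thus ?case by (simp add: Suc sum_W_Suc add.assoc del: W.simps)
qed simp

lemma card_V: "card (V m) = q ^ m"
  using card_q by (induction m) (simp_all add: card_image[OF W_inj[of 0, simplified]])

lemma V_mono: "m \<le> n \<Longrightarrow> V m \<subseteq> V n"
proof (induction rule: dec_induct)
  case (step n)
  have "V n \<subseteq> V (Suc n)"
  proof
    fix v assume "v \<in> V n"
    thus "v \<in> V (Suc n)" by (auto intro!: image_eqI[of _ _ "(0, v)"])
  qed
  thus ?case using step by blast
qed simp

lemma module_fq: "module (fq_scale \<iota>)"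
proof -
  have "fq_scale \<iota> = (\<lambda>c x. sc c * x)" by (simp add: fun_eq_iff fq_scale_def sc_def)
  thus ?thesis by unfold_locales (simp_all add: sc_add sc_mult distrib_left distrib_right)
qed

lemma lattice_span: "module.span (fq_scale \<iota>) (range lam) = \<Lambda>"
  using lattice unfolding normalized_separable_lattice_def separable_lattice_def by blast

lemma lattice_eq_Union: "\<Lambda> = (\<Union>m. V m)"
proof -
  interpret fq: module "fq_scale \<iota>" by (rule module_fq)
  have fq: "fq_scale \<iota> c x = sc c * x" for c x by (simp add: fq_scale_def sc_def)
  have "V m \<subseteq> fq.span (range lam)" for m
  proof (induction m)
    case (Suc m)
    show ?case
    proof
      fix v assume "v \<in> V (Suc m)"
      then obtain c w where w: "v = sc c * lam m + w" "w \<in> V m" by auto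
      have "fq_scale \<iota> c (lam m) + w \<in> fq.span (range lam)"
        using w(2) Suc by (intro fq.span_add fq.span_scale fq.span_base[OF rangeI]) auto
      thus "v \<in> fq.span (range lam)" by (simp add: w fq)
    qed
  qed (simp add: fq.span_zero)
  moreover have "fq.span (range lam) \<subseteq> (\<Union>m. V m)"
  proof (rule fq.span_minimal)
    have "lam m \<in> V (Suc m)" for m by (auto intro!: image_eqI[of _ _ "(1, 0)"])
    thus "range lam \<subseteq> (\<Union>m. V m)" by blast
    show "fq.subspace (\<Union>m. V m)"
    proof (rule fq.subspaceI)
      fix x y assume "x \<in> (\<Union>m. V m)" "y \<in> (\<Union>m. V m)"
      then obtain a b where "x \<in> V a" "y \<in> V b" by blast
      hence "x \<in> V (max a b)" "y \<in> V (max a b)" using V_mono by (meson max.cobounded1 max.cobounded2 subsetD)+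
      thus "x + y \<in> (\<Union>m. V m)" using W_plus by blast
    next
      fix c x assume "x \<in> (\<Union>m. V m)"
      thus "fq_scale \<iota> c x \<in> (\<Union>m. V m)" using W_scale unfolding fq by blast
    qed auto
  qed
  ultimately show ?thesis unfolding lattice_span[symmetric] by blast
qed

lemma V_subset: "V m \<subseteq> \<Lambda>" unfolding lattice_eq_Union by blast

lemma finite_lattice_ball: "finite {l \<in> \<Lambda>. absv l \<le> R}"
proof -
  have "{l \<in> \<Lambda>. absv l \<le> R} = \<Lambda> \<inter> cball 0 R" by (auto simp: absv_def dist_commute)
  thus ?thesis using lattice
    unfolding normalized_separable_lattice_def separable_lattice_def fq_lattice_def by simp
qed

lemma finite_lattice_in_V:
  assumes "finite S" "S \<subseteq> \<Lambda>"
  shows "\<exists>m. S \<subseteq> V m"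
  using assms
proof (induction S rule: finite_induct)
  case (insert x S)
  then obtain m where "S \<subseteq> V m" by auto
  moreover obtain n where "x \<in> V n" using insert.prems lattice_eq_Union by auto
  ultimately show ?case using V_mono[of m "max m n"] V_mono[of n "max m n"] by (intro exI[of _ "max m n"]) auto
qed simp

lemma lam_unbounded: "\<exists>n. R < absv (lam n)"
proof (rule ccontr)
  assume "\<not> ?thesis"
  hence le: "absv (lam n) \<le> R" for n by (simp add: not_less)
  have "lam n \<in> V (Suc n)" for n by (auto intro!: image_eqI[of _ _ "(1, 0)"])
  hence "range lam \<subseteq> {l \<in> \<Lambda>. absv l \<le> R}" using V_subset le by blast
  hence "finite (range lam)" using finite_lattice_ball finite_subset by blast
  moreover have "inj lam" by (rule injI) (metis lam_less_iff linorder_neqE_nat less_irrefl)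
  ultimately show False using finite_imageD by blast
qed

section \<open>Convergence of the lattice sums\<close>

text \<open>In a complete ultrametric field a family that tends to 0 is summable, and its sum may be
  computed along the exhausting finite layers.\<close>

lemma lattice_sum_limit:
  assumes small: "\<And>e. e > 0 \<Longrightarrow> finite {l \<in> \<Lambda>. e \<le> absv (h l :: 'c)}"
  shows "(\<lambda>n. \<Sum>v\<in>V n. h v) \<longlonglongrightarrow> (\<Sum>\<^sub>\<infinity>l\<in>\<Lambda>. h l)"
proof -
  have tail: "\<exists>N. \<forall>S. finite S \<and> V N \<subseteq> S \<and> S \<subseteq> \<Lambda> \<longrightarrow> absv (sum h S - sum h (V N)) < e" if e: "e > 0" for e
  proof -
    obtain N where N: "{l \<in> \<Lambda>. e \<le> absv (h l)} \<subseteq> V N"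
      using finite_lattice_in_V[OF small[OF e]] by blast
    have "absv (sum h S - sum h (V N)) < e" if "finite S" "V N \<subseteq> S" "S \<subseteq> \<Lambda>" for S
    proof -
      have "sum h S - sum h (V N) = sum h (S - V N)" using that by (simp add: sum_diff)
      also have "absv \<dots> < e" using N that e by (intro absv_sum_less) (auto simp: not_le[symmetric] finite_subset)
      finally show ?thesis .
    qed
    thus ?thesis by blast
  qed
  have "Cauchy (\<lambda>n. sum h (V n))"
  proof (rule metric_CauchyI)
    fix e :: real assume e: "e > 0"
    obtain N where N: "\<And>S. finite S \<Longrightarrow> V N \<subseteq> S \<Longrightarrow> S \<subseteq> \<Lambda> \<Longrightarrow> absv (sum h S - sum h (V N)) < e"
      using tail[OF e] by blast
    have "dist (sum h (V m)) (sum h (V n)) < e" if "m \<ge> N" "n \<ge> N" for m n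
    proof -
      have "absv (sum h (V m) - sum h (V N)) < e" "absv (sum h (V n) - sum h (V N)) < e"
        using N V_mono[OF that(1)] V_mono[OF that(2)] V_subset by auto
      thus ?thesis using absv_diff[of "sum h (V m) - sum h (V N)" "sum h (V n) - sum h (V N)"]
        unfolding dist_absv by simp
    qed
    thus "\<exists>M. \<forall>m\<ge>M. \<forall>n\<ge>M. dist (sum h (V m)) (sum h (V n)) < e" by blast
  qed
  then obtain s where s: "(\<lambda>n. sum h (V n)) \<longlonglongrightarrow> s" using Cauchy_convergent convergent_def by blast
  have "(h has_sum s) \<Lambda>"
    unfolding has_sum_def tendsto_iff
  proof (intro allI impI)
    fix e :: real assume e: "e > 0"
    obtain N where N: "\<And>S. finite S \<Longrightarrow> V N \<subseteq> S \<Longrightarrow> S \<subseteq> \<Lambda> \<Longrightarrow> absv (sum h S - sum h (V N)) < e"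
      using tail[OF e] by blast
    obtain M where M: "\<And>n. n \<ge> M \<Longrightarrow> absv (sum h (V n) - s) < e"
      using metric_LIMSEQ_D[OF s e] dist_absv by metis
    define n where "n = max M N"
    have n: "absv (sum h (V n) - s) < e" "absv (sum h (V n) - sum h (V N)) < e"
      using M[of n] N[of "V n"] V_mono[of N n] V_subset unfolding n_def by auto
    have "dist (sum h S) s < e" if "finite S" "V N \<subseteq> S" "S \<subseteq> \<Lambda>" for S
    proof -
      have "absv (sum h S - sum h (V n)) < e"
        using absv_diff[of "sum h S - sum h (V N)" "sum h (V n) - sum h (V N)"] n(2) N[OF that] by simp
      thus ?thesis using absv_add[of "sum h S - sum h (V n)" "sum h (V n) - s"] n(1) unfolding dist_absv by simp
    qed
    thus "\<forall>\<^sub>F S in finite_subsets_at_top \<Lambda>. dist (sum h S) s < e"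
      unfolding eventually_finite_subsets_at_top using V_subset[of N] by (intro exI[of _ "V N"]) auto
  qed
  hence "(\<Sum>\<^sub>\<infinity>l\<in>\<Lambda>. h l) = s" by (rule infsumI)
  thus ?thesis using s by simp
qed

lemma Cfun_limit:
  assumes "k \<ge> 1"
  shows "(\<lambda>n. \<Sum>v\<in>V n. 1 / (z - v) ^ k) \<longlonglongrightarrow> Cfun \<Lambda> k z"
  unfolding Cfun_def
proof (rule lattice_sum_limit)
  fix e :: real assume e: "e > 0"
  define R where "R = max 1 (1 / e)"
  have "{l \<in> \<Lambda>. e \<le> absv (1 / (z - l) ^ k)} \<subseteq> {l \<in> \<Lambda>. absv l \<le> max (absv z) R}"
  proof clarify
    fix l assume l: "l \<in> \<Lambda>" "e \<le> absv (1 / (z - l) ^ k)"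
    have "absv (z - l) \<le> R"
    proof (rule ccontr)
      assume "\<not> absv (z - l) \<le> R"
      hence gt: "absv (z - l) > R" by simp
      hence g1: "absv (z - l) > 1" "absv (z - l) > 1 / e" unfolding R_def by auto
      have "1 / e < absv (z - l) ^ 1" using g1 by simp
      also have "\<dots> \<le> absv (z - l) ^ k" using g1 assms by (intro power_increasing) auto
      finally have *: "1 / e < absv (z - l) ^ k" .
      hence "absv (z - l) ^ k > 0" using e by (meson less_trans zero_less_divide_1_iff)
      with * have "1 / absv (z - l) ^ k < e" using e by (simp add: field_simps)
      thus False using l by (simp add: absv_divide absv_power)
    qed
    thus "absv l \<le> max (absv z) R" using absv_diff[of z "z - l"] by simp
  qed
  thus "finite {l \<in> \<Lambda>. e \<le> absv (1 / (z - l) ^ k)}" using finite_lattice_ball finite_subset by blast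
qed

end

section \<open>Power sums over the finite layers\<close>

text \<open>Abel summation: moving weight from \<open>l\<^sub>j\<close> to larger values, or to the bound L above all of
  them, increases a sum whose partial sums of weights are nonnegative.\<close>

lemma abel_weighted_le:
  fixes d l :: "nat \<Rightarrow> real"
  assumes "\<And>s. s \<le> m \<Longrightarrow> 0 \<le> (\<Sum>j<s. d j)" "strict_mono l" "\<And>j. j < m \<Longrightarrow> l j < L"
  shows "(\<Sum>j<m. d j * l j) \<le> (\<Sum>j<m. d j) * L"
    "(\<exists>s\<le>m. 0 < (\<Sum>j<s. d j)) \<Longrightarrow> (\<Sum>j<m. d j * l j) < (\<Sum>j<m. d j) * L"
  using assms(1,3)
proof (induction m arbitrary: L)
  case (Suc m)
  {
    case 1
    have "(\<Sum>j<m. d j * l j) \<le> (\<Sum>j<m. d j) * l m"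
      using 1 strict_monoD[OF assms(2)] by (intro Suc.IH) auto
    hence "(\<Sum>j<Suc m. d j * l j) \<le> (\<Sum>j<Suc m. d j) * l m" by (simp add: algebra_simps)
    also have "\<dots> \<le> (\<Sum>j<Suc m. d j) * L" using 1(1)[of "Suc m"] 1(2)[of m] by (intro mult_left_mono) auto
    finally show ?case .
  next
    case 2
    have le: "(\<Sum>j<m. d j * l j) \<le> (\<Sum>j<m. d j) * l m"
      using 2 strict_monoD[OF assms(2)] by (intro Suc.IH) auto
    show ?case
    proof (cases "0 < (\<Sum>j<Suc m. d j)")
      case True
      have "(\<Sum>j<Suc m. d j * l j) \<le> (\<Sum>j<Suc m. d j) * l m" using le by (simp add: algebra_simps)
      also have "\<dots> < (\<Sum>j<Suc m. d j) * L" using True 2(3)[of m] by (intro mult_strict_left_mono) auto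
      finally show ?thesis .
    next
      case False
      then obtain s where "s \<le> m" "0 < (\<Sum>j<s. d j)" using 2(1) le_Suc_eq by auto
      hence "(\<Sum>j<m. d j * l j) < (\<Sum>j<m. d j) * l m"
        using 2 strict_monoD[OF assms(2)] by (intro Suc.IH(2)) auto
      hence "(\<Sum>j<Suc m. d j * l j) < (\<Sum>j<Suc m. d j) * l m" by (simp add: algebra_simps)
      also have "\<dots> \<le> (\<Sum>j<Suc m. d j) * L" using 2(2)[of "Suc m"] 2(3)[of m] by (intro mult_left_mono) auto
      finally show ?thesis .
    qed
  }
qed simp_all

context sep_lattice
begin

text \<open>The exponents n for which \<open>c\<^sup>n\<close> has a nonzero sum over the finite field and \<open>K choose n\<close> is
  nonzero modulo p.\<close>

definition peel :: "nat \<Rightarrow> nat set" where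
  "peel K = {n. 0 < n \<and> (q - 1) dvd n \<and> carry_free p n K}"

text \<open>The exponent vectors that survive in the expansion of the power sum with exponent K over \<open>V m\<close>.  The
  recursion mirrors the summation over the last basis vector; exps_iff describes the result by partial sums,
  as needed for chains.\<close>

primrec exps :: "nat \<Rightarrow> nat \<Rightarrow> (nat \<Rightarrow> nat) set" where
  "exps 0 K = {\<lambda>_. 0}"
| "exps (Suc m) K = (\<lambda>(n, g). g(m := n)) ` (SIGMA n:peel K. exps m (K - n))"

lemma finite_peel [simp]: "finite (peel K)"
  by (rule finite_subset[of _ "{..K}"]) (auto simp: peel_def dest: carry_free_le)

lemma finite_exps [simp]: "finite (exps m K)"
  by (induction m arbitrary: K) auto

lemma exps_support: "g \<in> exps m K \<Longrightarrow> j \<ge> m \<Longrightarrow> g j = 0"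
  by (induction m arbitrary: K g) auto

lemma exps_Suc_iff: "g \<in> exps (Suc m) K \<longleftrightarrow> (\<forall>j>m. g j = 0) \<and> g m \<in> peel K \<and> g(m := 0) \<in> exps m (K - g m)"
proof
  assume "g \<in> exps (Suc m) K"
  then obtain n h where h: "g = h(m := n)" "n \<in> peel K" "h \<in> exps m (K - n)" by auto
  have "h(m := 0) = h" using exps_support[OF h(3), of m] by (simp add: fun_upd_idem)
  thus "(\<forall>j>m. g j = 0) \<and> g m \<in> peel K \<and> g(m := 0) \<in> exps m (K - g m)"
    using h exps_support[OF h(3)] by simp
next
  assume "(\<forall>j>m. g j = 0) \<and> g m \<in> peel K \<and> g(m := 0) \<in> exps m (K - g m)"
  thus "g \<in> exps (Suc m) K" by (auto intro!: image_eqI[of _ _ "(g m, g(m := 0))"])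
qed

lemma exps_iff:
  "g \<in> exps m K \<longleftrightarrow> (\<forall>j\<ge>m. g j = 0) \<and> (\<forall>j<m. 0 < g j \<and> (q - 1) dvd g j) \<and>
     (\<forall>s<m. carry_free p (\<Sum>j<s. g j) (\<Sum>j<Suc s. g j)) \<and> carry_free p (\<Sum>j<m. g j) K"
proof (induction m arbitrary: g K)
  case 0
  show ?case using p by (auto simp: fun_eq_iff)
next
  case (Suc m)
  let ?h = "g(m := 0)"
  have sums: "(\<Sum>j<s. ?h j) = (\<Sum>j<s. g j)" if "s \<le> m" for s
    using that by (intro sum.cong) auto
  have cf: "carry_free p (\<Sum>j<m. g j) (g m + (\<Sum>j<m. g j)) \<and> carry_free p (g m + (\<Sum>j<m. g j)) K \<longleftrightarrow>
    carry_free p (g m) K \<and> carry_free p (\<Sum>j<m. g j) (K - g m)"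
  proof (cases "g m + (\<Sum>j<m. g j) \<le> K")
    case True thus ?thesis by (rule carry_free_add_iff[OF p])
  next
    case False
    hence "\<not> (g m \<le> K \<and> (\<Sum>j<m. g j) \<le> K - g m)" by linarith
    with False show ?thesis using carry_free_le by blast
  qed
  have "?h \<in> exps m (K - g m) \<longleftrightarrow> (\<forall>j>m. g j = 0) \<and> (\<forall>j<m. 0 < g j \<and> (q - 1) dvd g j) \<and>
     (\<forall>s<m. carry_free p (\<Sum>j<s. g j) (\<Sum>j<Suc s. g j)) \<and> carry_free p (\<Sum>j<m. g j) (K - g m)"
    if "\<forall>j>m. g j = 0"
  proof -
    have "(\<forall>j\<ge>m. ?h j = 0)" using that by simp
    moreover have "(\<forall>j<m. 0 < ?h j \<and> (q - 1) dvd ?h j) \<longleftrightarrow> (\<forall>j<m. 0 < g j \<and> (q - 1) dvd g j)" by auto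
    moreover have "(\<forall>s<m. carry_free p (\<Sum>j<s. ?h j) (\<Sum>j<Suc s. ?h j)) \<longleftrightarrow>
      (\<forall>s<m. carry_free p (\<Sum>j<s. g j) (\<Sum>j<Suc s. g j))"
      using sums by (metis Suc_leI less_imp_le_nat)
    ultimately show ?thesis using that sums[of m] unfolding Suc.IH by simp
  qed
  hence "g \<in> exps (Suc m) K \<longleftrightarrow> (\<forall>j>m. g j = 0) \<and> g m \<in> peel K \<and> (\<forall>j<m. 0 < g j \<and> (q - 1) dvd g j) \<and>
     (\<forall>s<m. carry_free p (\<Sum>j<s. g j) (\<Sum>j<Suc s. g j)) \<and> carry_free p (\<Sum>j<m. g j) (K - g m)"
    unfolding exps_Suc_iff by blast
  also have "\<dots> \<longleftrightarrow> (\<forall>j\<ge>Suc m. g j = 0) \<and> (\<forall>j<Suc m. 0 < g j \<and> (q - 1) dvd g j) \<and>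
     (\<forall>s<Suc m. carry_free p (\<Sum>j<s. g j) (\<Sum>j<Suc s. g j)) \<and> carry_free p (\<Sum>j<Suc m. g j) K"
    using cf unfolding peel_def All_less_Suc Suc_le_eq by (auto simp: add.commute)
  finally show ?case .
qed

lemma power_sum_step:
  "(\<Sum>v\<in>V (Suc m). (z - v) ^ K) =
     (\<Sum>n\<in>peel K. - (of_nat (K choose n) * (- lam m) ^ n) * (\<Sum>v\<in>V m. (z - v) ^ (K - n)))"
proof -
  have "(\<Sum>v\<in>V (Suc m). (z - v) ^ K) = (\<Sum>c\<in>UNIV. \<Sum>v\<in>V m. (sc c * (- lam m) + (z - v)) ^ K)"
    unfolding sum_W_Suc by (simp add: algebra_simps)
  also have "\<dots> = (\<Sum>c\<in>UNIV. \<Sum>v\<in>V m. \<Sum>n\<le>K. sc c ^ n * (of_nat (K choose n) * (- lam m) ^ n * (z - v) ^ (K - n)))"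
    unfolding binomial_ring power_mult_distrib by (simp add: mult_ac)
  also have "\<dots> = (\<Sum>c\<in>UNIV. \<Sum>n\<le>K. \<Sum>v\<in>V m. sc c ^ n * (of_nat (K choose n) * (- lam m) ^ n * (z - v) ^ (K - n)))"
    by (intro sum.cong refl sum.swap)
  also have "\<dots> = (\<Sum>n\<le>K. \<Sum>c\<in>UNIV. \<Sum>v\<in>V m. sc c ^ n * (of_nat (K choose n) * (- lam m) ^ n * (z - v) ^ (K - n)))"
    by (rule sum.swap)
  also have "\<dots> = (\<Sum>n\<le>K. (\<Sum>c\<in>UNIV. sc c ^ n) * (of_nat (K choose n) * (- lam m) ^ n) * (\<Sum>v\<in>V m. (z - v) ^ (K - n)))"
    by (intro sum.cong refl) (simp add: sum_distrib_left sum_distrib_right mult_ac)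
  also have "\<dots> = (\<Sum>n\<in>peel K. - (of_nat (K choose n) * (- lam m) ^ n) * (\<Sum>v\<in>V m. (z - v) ^ (K - n)))"
  proof (rule sum.mono_neutral_cong_right)
    show "peel K \<subseteq> {..K}" by (auto simp: peel_def dest: carry_free_le)
    show "\<forall>n\<in>{..K} - peel K. (\<Sum>c\<in>UNIV. sc c ^ n) * (of_nat (K choose n) * (- lam m) ^ n) * (\<Sum>v\<in>V m. (z - v) ^ (K - n)) = 0"
    proof
      fix n assume "n \<in> {..K} - peel K"
      hence "\<not> (0 < n \<and> (q - 1) dvd n) \<or> p dvd (K choose n)" by (auto simp: peel_def carry_free_def)
      thus "(\<Sum>c\<in>UNIV. sc c ^ n) * (of_nat (K choose n) * (- lam m) ^ n) * (\<Sum>v\<in>V m. (z - v) ^ (K - n)) = 0"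
        using of_nat_eq_0_iff[of "K choose n"] unfolding sc_power_sum by auto
    qed
  qed (auto simp: peel_def sc_power_sum)
  finally show ?thesis .
qed

text \<open>The coefficients are only needed up to absolute value: they are products of signs and of binomial
  coefficients that are nonzero modulo p.\<close>

lemma power_sum_expansion:
  "\<exists>a. (\<forall>g\<in>exps m K. absv (a g) = 1) \<and>
     (\<Sum>v\<in>V m. (z - v) ^ K) = (\<Sum>g\<in>exps m K. a g * ((\<Prod>j<m. lam j ^ g j) * z ^ (K - (\<Sum>j<m. g j))))"
proof (induction m arbitrary: K)
  case 0
  show ?case by (intro exI[of _ "\<lambda>_. 1"]) simp
next
  case (Suc m)
  have "\<exists>b. \<forall>K. (\<forall>g\<in>exps m K. absv (b K g) = 1) \<and>
     (\<Sum>v\<in>V m. (z - v) ^ K) = (\<Sum>g\<in>exps m K. b K g * ((\<Prod>j<m. lam j ^ g j) * z ^ (K - (\<Sum>j<m. g j))))"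
    using Suc by (intro choice) blast
  then obtain b where b: "\<And>K g. g\<in>exps m K \<Longrightarrow> absv (b K g) = 1"
    "\<And>K. (\<Sum>v\<in>V m. (z - v) ^ K) = (\<Sum>g\<in>exps m K. b K g * ((\<Prod>j<m. lam j ^ g j) * z ^ (K - (\<Sum>j<m. g j))))"
    by blast
  define a where "a g = - (of_nat (K choose g m) * (- 1) ^ g m) * b (K - g m) (g(m := 0))" for g
  have upd: "g(m := 0) = g" if "g \<in> exps m L" for g L
    using exps_support[OF that, of m] by (simp add: fun_upd_idem)
  have inj: "inj_on (\<lambda>(n, g). g(m := n)) (SIGMA n:peel K. exps m (K - n))"
  proof (rule inj_onI, clarify)
    fix n g n' g' assume gg: "g \<in> exps m (K - n)" "g' \<in> exps m (K - n')" "g(m := n) = g'(m := n')"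
    have "n = n'" using fun_cong[OF gg(3), of m] by simp
    moreover have "g(m := n, m := 0) = g'(m := n', m := 0)" using gg(3) by simp
    hence "g = g'" using upd[OF gg(1)] upd[OF gg(2)] by simp
    ultimately show "n = n' \<and> g = g'" by simp
  qed
  have "(\<Sum>v\<in>V (Suc m). (z - v) ^ K) = (\<Sum>n\<in>peel K. \<Sum>g\<in>exps m (K - n).
     - (of_nat (K choose n) * (- lam m) ^ n) * (b (K - n) g * ((\<Prod>j<m. lam j ^ g j) * z ^ (K - n - (\<Sum>j<m. g j)))))"
    unfolding power_sum_step b(2) sum_distrib_left ..
  also have "\<dots> = (\<Sum>(n, g)\<in>(SIGMA n:peel K. exps m (K - n)).
     - (of_nat (K choose n) * (- lam m) ^ n) * (b (K - n) g * ((\<Prod>j<m. lam j ^ g j) * z ^ (K - n - (\<Sum>j<m. g j)))))"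
    by (rule sum.Sigma) auto
  also have "\<dots> = (\<Sum>g\<in>exps (Suc m) K. a g * ((\<Prod>j<Suc m. lam j ^ g j) * z ^ (K - (\<Sum>j<Suc m. g j))))"
    unfolding exps.simps sum.reindex[OF inj]
  proof (rule sum.cong[OF refl], clarify)
    fix n g assume g: "g \<in> exps m (K - n)"
    have "(- lam m) ^ n = (- 1) ^ n * lam m ^ n" by (simp add: power_mult_distrib[symmetric])
    moreover have "(\<Sum>j<m. if j = m then n else g j) = (\<Sum>j<m. g j)" by (intro sum.cong) auto
    moreover have "(\<Prod>j<m. lam j ^ (if j = m then n else g j)) = (\<Prod>j<m. lam j ^ g j)" by (intro prod.cong) auto
    ultimately show "- (of_nat (K choose n) * (- lam m) ^ n) * (b (K - n) g * ((\<Prod>j<m. lam j ^ g j) * z ^ (K - n - (\<Sum>j<m. g j)))) =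
      ((\<lambda>g. a g * ((\<Prod>j<Suc m. lam j ^ g j) * z ^ (K - (\<Sum>j<Suc m. g j)))) \<circ> (\<lambda>(n, g). g(m := n))) (n, g)"
      using upd[OF g] by (simp add: a_def fun_upd_apply add.commute mult_ac)
  qed
  finally have "(\<Sum>v\<in>V (Suc m). (z - v) ^ K) = (\<Sum>g\<in>exps (Suc m) K. a g * ((\<Prod>j<Suc m. lam j ^ g j) * z ^ (K - (\<Sum>j<Suc m. g j))))" .
  moreover have "absv (a g) = 1" if "g \<in> exps (Suc m) K" for g
  proof -
    have "g m \<in> peel K" "g(m := 0) \<in> exps m (K - g m)" using that unfolding exps_Suc_iff by auto
    thus ?thesis using absv_of_nat b(1) unfolding a_def peel_def carry_free_def by (simp add: absv_mult absv_power)
  qed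
  ultimately show ?case by blast
qed


section \<open>Absolute values between the critical radii\<close>

lemma V_less: "\<forall>j<m. absv (lam j) < R \<Longrightarrow> 0 < R \<Longrightarrow> v \<in> V m \<Longrightarrow> absv v < R"
proof (induction m arbitrary: v)
  case (Suc m)
  then obtain c w where w: "v = sc c * lam m + w" "w \<in> V m" by auto
  have "absv (sc c * lam m) \<le> 1 * absv (lam m)"
    unfolding absv_mult by (intro mult_right_mono absv_sc_le) simp
  moreover have "absv w < R" using Suc w by simp
  moreover have "absv (lam m) < R" using Suc by simp
  ultimately show ?case using absv_add[of "sc c * lam m" w] unfolding w(1) by linarith
qed simp

abbreviation mu :: "nat \<Rightarrow> nat \<Rightarrow> nat" where "mu k i \<equiv> approx_num p q i k"

lemma lg_prod: "(\<And>i. i \<in> S \<Longrightarrow> g i \<noteq> 0) \<Longrightarrow> lg (prod g S) = (\<Sum>i\<in>S. lg (g i))"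
proof (induction S rule: infinite_finite_induct)
  case (insert x S)
  hence "prod g S \<noteq> 0" by (cases "finite S") (auto simp: prod_zero_iff)
  thus ?case using insert by (simp add: lg_mult)
qed (simp_all add: lg_def)

text \<open>The partial sums of an exponent vector form a chain whose last member fits into the digits of
  -k.\<close>

lemma partial_sum_ge_approx:
  assumes k: "k \<ge> 1" "k \<le> p ^ M" and g: "g \<in> exps m (p ^ M - k)" and s: "s \<le> m"
  shows "mu k s \<le> (\<Sum>j<s. g j)"
proof -
  note g' = g[unfolded exps_iff]
  have dvd: "(q - 1) dvd (\<Sum>j<r. g j)" if "r \<le> m" for r
    using g' that by (intro dvd_sum) auto
  have cf: "carry_free p (\<Sum>j<s. g j) (p ^ M - k)"
    using s
  proof (induction s rule: inc_induct)
    case (step r)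
    thus ?case using g' carry_free_trans[OF p, of "\<Sum>j<r. g j" "\<Sum>j<Suc r. g j"] by blast
  qed (use g' in blast)
  have "(\<Sum>j<s. g j) < p ^ M"
    using carry_free_le[OF cf] k by linarith
  hence "digit_le p (int (\<Sum>j<s. g j)) (- int k)"
    using cf digit_le_minus_iff[OF p k(2)] by blast
  moreover have "height p q (\<Sum>j<s. g j) \<ge> s"
    using g' s dvd by (intro strict_chain_height[OF p]) auto
  ultimately show ?thesis using dvd[OF s] by (intro approx_num_le[OF p f q])
qed

text \<open>The exponent vector whose partial sums are the approximation numbers.\<close>

definition mu_exps :: "nat \<Rightarrow> nat \<Rightarrow> nat \<Rightarrow> nat" where
  "mu_exps k m j = (if j < m then mu k (Suc j) - mu k j else 0)"

lemma sum_mu_exps: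
  assumes "k \<ge> 1" "s \<le> m"
  shows "(\<Sum>j<s. mu_exps k m j) = mu k s"
  using assms(2)
proof (induction s)
  case 0
  show ?case using approx_num_0[OF p f q] by simp
next
  case (Suc s)
  thus ?case using approx_num_less_Suc[OF p f q assms(1), of s] by (simp add: mu_exps_def)
qed

text \<open>This is where regularity enters: it makes the increments of the approximation numbers add up
  without carries.\<close>

lemma mu_exps_in_exps:
  assumes k: "k \<ge> 1" "k \<le> p ^ M" and reg: "i_regular p q m k" and M: "mu k m < p ^ M"
  shows "mu_exps k m \<in> exps m (p ^ M - k)"
  unfolding exps_iff
proof (intro conjI allI impI)
  fix j assume j: "j < m"
  show "0 < mu_exps k m j" using j approx_num_less_Suc[OF p f q k(1), of j] by (simp add: mu_exps_def)
  show "(q - 1) dvd mu_exps k m j"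
    using j approx_num_props(1)[OF p f q k(1)] by (simp add: mu_exps_def dvd_diff_nat)
  show "carry_free p (\<Sum>i<j. mu_exps k m i) (\<Sum>i<Suc j. mu_exps k m i)"
    using j regular_carry_free[OF p f q reg j] sum_mu_exps[OF k(1), of j m] sum_mu_exps[OF k(1), of "Suc j" m] by simp
next
  show "carry_free p (\<Sum>j<m. mu_exps k m j) (p ^ M - k)"
    using sum_mu_exps[OF k(1), of m m] digit_le_minus_iff[OF p k(2) M] approx_num_props(2)[OF p f q k(1)] by simp
qed (simp add: mu_exps_def)

text \<open>All partial sums of another exponent vector are at least those of the increments of the
  approximation numbers, and some are larger; Abel summation applied to the logarithms does the rest.\<close>

lemma exps_term_less:
  assumes k: "k \<ge> 1" "k \<le> p ^ M" and reg: "i_regular p q m k" and M: "mu k m < p ^ M"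
    and z: "z \<noteq> 0" "\<forall>j<m. absv (lam j) < absv z"
    and g: "g \<in> exps m (p ^ M - k)" "g \<noteq> mu_exps k m"
  shows "absv ((\<Prod>j<m. lam j ^ g j) * z ^ (p ^ M - k - (\<Sum>j<m. g j))) <
    absv ((\<Prod>j<m. lam j ^ mu_exps k m j) * z ^ (p ^ M - k - (\<Sum>j<m. mu_exps k m j)))"
proof -
  let ?e = "mu_exps k m" and ?K = "p ^ M - k"
  let ?T = "\<lambda>g. (\<Prod>j<m. lam j ^ g j) * z ^ (?K - (\<Sum>j<m. g j))"
  have T0: "?T h \<noteq> 0" for h using z by (simp add: prod_zero_iff)
  have lgT: "lg (?T h) = (\<Sum>j<m. real (h j) * lg (lam j)) + (real ?K - (\<Sum>j<m. real (h j))) * lg z"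
    if "h \<in> exps m ?K" for h
  proof -
    have "(\<Sum>j<m. h j) \<le> ?K" using that unfolding exps_iff by (blast dest: carry_free_le)
    hence "real (?K - (\<Sum>j<m. h j)) = real ?K - (\<Sum>j<m. real (h j))"
      by (simp only: of_nat_diff of_nat_sum)
    moreover have "lg (?T h) = lg (\<Prod>j<m. lam j ^ h j) + lg (z ^ (?K - (\<Sum>j<m. h j)))"
      using z by (intro lg_mult) (simp_all add: prod_zero_iff)
    moreover have "lg (\<Prod>j<m. lam j ^ h j) = (\<Sum>j<m. real (h j) * lg (lam j))"
      by (simp add: lg_prod lg_power)
    ultimately show ?thesis using lg_power[OF z(1), of "?K - (\<Sum>j<m. h j)"] by simp
  qed
  have e: "?e \<in> exps m ?K" by (rule mu_exps_in_exps[OF k reg M])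
  define d where "d j = real (g j) - real (?e j)" for j
  have D: "(\<Sum>j<s. d j) = real (\<Sum>j<s. g j) - real (mu k s)" if "s \<le> m" for s
    using sum_mu_exps[OF k(1) that] unfolding d_def sum_subtractf by (metis of_nat_sum)
  have D0: "0 \<le> (\<Sum>j<s. d j)" if "s \<le> m" for s
    unfolding D[OF that] using partial_sum_ge_approx[OF k g(1) that] by (simp del: of_nat_sum)
  have "\<exists>s\<le>m. 0 < (\<Sum>j<s. d j)"
  proof (rule ccontr)
    assume "\<not> ?thesis"
    hence z0: "(\<Sum>j<s. d j) = 0" if "s \<le> m" for s using D0[OF that] that by fastforce
    have "g j = ?e j" for j
    proof (cases "j < m")
      case True
      hence "d j = 0" using z0[of j] z0[of "Suc j"] by simp
      thus ?thesis by (simp add: d_def)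
    next
      case False
      thus ?thesis using exps_support[OF g(1)] by (simp add: mu_exps_def)
    qed
    thus False using g(2) by blast
  qed
  moreover have "strict_mono (\<lambda>j. lg (lam j))"
    by (rule strict_monoI) (simp add: lg_less_iff lam_less_iff)
  moreover have "lg (lam j) < lg z" if "j < m" for j using z that by (simp add: lg_less_iff)
  ultimately have "(\<Sum>j<m. d j * lg (lam j)) < (\<Sum>j<m. d j) * lg z"
    by (intro abel_weighted_le(2) D0)
  hence "lg (?T g) < lg (?T ?e)"
    unfolding lgT[OF g(1)] lgT[OF e] d_def by (simp add: algebra_simps sum_subtractf)
  thus ?thesis using lg_less_iff[OF T0 T0] by blast
qed

text \<open>Since \<open>(z - v)\<^sup>Q = z\<^sup>Q - v\<^sup>Q\<close> for \<open>Q = p\<^sup>M\<close>, the summand \<open>(z - v)\<^sup>-\<^sup>k\<close> is close to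
  \<open>(z - v)\<^sup>K / z\<^sup>Q\<close> with \<open>K = Q - k \<ge> 0\<close>; for large M the error is smaller than the dominant term of
  the resulting finite expansion, which does not depend on M.\<close>

lemma absv_finite_C_regular:
  assumes k: "k \<ge> 1" and reg: "i_regular p q m k"
    and z: "z \<noteq> 0" "\<forall>j<m. absv (lam j) < absv z"
  shows "absv (\<Sum>v\<in>V m. 1 / (z - v) ^ k) =
    (\<Prod>j<m. absv (lam j) ^ mu_exps k m j) / absv z ^ (k + mu k m)"
proof -
  define B where "B = (\<Prod>j<m. absv (lam j) ^ mu_exps k m j) / absv z ^ (k + mu k m)"
  have B0: "B > 0" unfolding B_def using z by (intro divide_pos_pos prod_pos) auto
  define r where "r = Max ((\<lambda>v. absv v / absv z) ` V m)"
  have vz: "absv v < absv z" if "v \<in> V m" for v using V_less[OF z(2) _ that] z by simp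
  have ne: "V m \<noteq> {}" using zero_in_W by blast
  have r1: "r < 1" unfolding r_def using vz z ne by (subst Max_less_iff) auto
  have rv: "absv v / absv z \<le> r" if "v \<in> V m" for v unfolding r_def using that by (intro Max_ge) auto
  have r0: "r \<ge> 0" using rv[of 0] by simp
  have "(\<lambda>n. r ^ n) \<longlonglongrightarrow> 0" using r0 r1 by (intro LIMSEQ_power_zero) auto
  hence "eventually (\<lambda>n. r ^ n < B * absv z ^ k) sequentially"
    using B0 z by (intro order_tendstoD(2)) auto
  then obtain N where N: "\<And>n. n \<ge> N \<Longrightarrow> r ^ n < B * absv z ^ k" unfolding eventually_sequentially by blast
  define M where "M = max N (max k (mu k m))"
  have "M < 2 ^ M" by (rule less_exp)
  also have "(2::nat) ^ M \<le> p ^ M" using prime_ge_2_nat[OF p] by (intro power_mono) auto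
  finally have M: "k \<le> p ^ M" "mu k m < p ^ M" "N \<le> p ^ M" unfolding M_def by auto
  define Q K where "Q = p ^ M" and "K = Q - k"
  have KQ: "K + k = Q" using M(1) by (simp add: K_def Q_def)
  define main where "main = (\<Sum>v\<in>V m. (z - v) ^ K) / z ^ Q"
  obtain a where a: "\<And>g. g\<in>exps m K \<Longrightarrow> absv (a g) = 1"
     "(\<Sum>v\<in>V m. (z - v) ^ K) = (\<Sum>g\<in>exps m K. a g * ((\<Prod>j<m. lam j ^ g j) * z ^ (K - (\<Sum>j<m. g j))))"
    using power_sum_expansion[of m K z] by blast
  have e: "mu_exps k m \<in> exps m K"
    unfolding K_def Q_def by (rule mu_exps_in_exps[OF k M(1) reg M(2)])
  have "absv (\<Sum>v\<in>V m. (z - v) ^ K) = absv (a (mu_exps k m) * ((\<Prod>j<m. lam j ^ mu_exps k m j) * z ^ (K - (\<Sum>j<m. mu_exps k m j))))"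
    unfolding a(2)
  proof (rule absv_sum_dominant[OF finite_exps e])
    fix g assume g: "g \<in> exps m K" "g \<noteq> mu_exps k m"
    show "absv (a g * ((\<Prod>j<m. lam j ^ g j) * z ^ (K - (\<Sum>j<m. g j)))) <
      absv (a (mu_exps k m) * ((\<Prod>j<m. lam j ^ mu_exps k m j) * z ^ (K - (\<Sum>j<m. mu_exps k m j))))"
      using exps_term_less[OF k M(1) reg M(2) z g[unfolded K_def Q_def]] a(1)[OF g(1)] a(1)[OF e]
      unfolding K_def[symmetric] Q_def[symmetric] absv_mult[of "a _"] by simp
  qed
  also have "\<dots> = (\<Prod>j<m. absv (lam j) ^ mu_exps k m j) * absv z ^ (K - mu k m)"
    using a(1)[OF e] sum_mu_exps[OF k, of m m] by (simp add: absv_mult absv_prod absv_power)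
  finally have main: "absv main = B"
  proof -
    assume eq: "absv (\<Sum>v\<in>V m. (z - v) ^ K) = (\<Prod>j<m. absv (lam j) ^ mu_exps k m j) * absv z ^ (K - mu k m)"
    have "mu k m \<le> K" using e sum_mu_exps[OF k, of m m] unfolding exps_iff by (metis carry_free_le order_refl)
    hence "(K - mu k m) + (k + mu k m) = Q" using KQ by linarith
    hence "absv z ^ Q = absv z ^ (K - mu k m) * absv z ^ (k + mu k m)" by (metis power_add)
    thus ?thesis unfolding main_def absv_divide eq absv_power B_def using z by simp
  qed
  have err: "absv (1 / (z - v) ^ k - (z - v) ^ K / z ^ Q) < B" if v: "v \<in> V m" for v
  proof -
    have zv: "absv (z - v) = absv z" using vz[OF v] by (rule absv_diff_dom)
    hence zv0: "z - v \<noteq> 0" using z by (metis absv_eq_0_iff)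
    have "(z - v) ^ Q = z ^ Q - v ^ Q" unfolding Q_def by (rule diff_power_p)
    hence "v ^ Q = z ^ Q - (z - v) ^ K * (z - v) ^ k" by (simp add: power_add[symmetric] KQ)
    hence "1 / (z - v) ^ k - (z - v) ^ K / z ^ Q = v ^ Q / (z ^ Q * (z - v) ^ k)"
      using z zv0 by (simp add: field_simps)
    hence "absv (1 / (z - v) ^ k - (z - v) ^ K / z ^ Q) = (absv v / absv z) ^ Q / absv z ^ k"
      by (simp add: absv_divide absv_mult absv_power zv power_divide)
    also have "\<dots> \<le> r ^ Q / absv z ^ k"
      using rv[OF v] by (intro divide_right_mono power_mono) auto
    also have "\<dots> < B" using N[of Q] M(3) z by (simp add: Q_def field_simps)
    finally show ?thesis .
  qed
  have "(\<Sum>v\<in>V m. 1 / (z - v) ^ k) = main + (\<Sum>v\<in>V m. 1 / (z - v) ^ k - (z - v) ^ K / z ^ Q)"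
    unfolding main_def sum_subtractf sum_divide_distrib by simp
  also have "absv \<dots> = absv main"
    using err B0 by (intro absv_add_dom) (auto simp: main intro!: absv_sum_less)
  finally show ?thesis unfolding main B_def .
qed

text \<open>For representatives \<open>u \<noteq> 0\<close> of the cosets of \<open>V m\<close> one has \<open>|z - u| = |u| > |z|\<close>, so the coset of 0
  contributes the largest value of a strictly decreasing function of the absolute value.\<close>

lemma coset_dominance:
  assumes k: "k \<ge> 1" and B: "B > 0" and e: "e > 0"
    and h: "\<And>y. y \<noteq> 0 \<Longrightarrow> \<forall>j<m. absv (lam j) < absv y \<Longrightarrow>
      absv (\<Sum>v\<in>V m. 1 / (y - v) ^ k) = B / absv y ^ e"
    and z: "z \<noteq> 0" "\<forall>j<m. absv (lam j) < absv z" "absv z < absv (lam m)"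
  shows "absv (Cfun \<Lambda> k z) = B / absv z ^ e"
proof -
  have fin: "absv (\<Sum>v\<in>V (m + d). 1 / (z - v) ^ k) = B / absv z ^ e" for d
  proof -
    have "(\<Sum>v\<in>V (m + d). 1 / (z - v) ^ k) = (\<Sum>u\<in>W m d. \<Sum>v\<in>V m. 1 / (z - u - v) ^ k)"
      unfolding sum_W_split by (simp add: algebra_simps)
    also have "absv \<dots> = absv (\<Sum>v\<in>V m. 1 / (z - 0 - v) ^ k)"
    proof (rule absv_sum_dominant[OF finite_W zero_in_W])
      fix u assume u: "u \<in> W m d" "u \<noteq> 0"
      have zu: "absv z < absv u" using W_nonzero_ge[OF u] z by simp
      hence a: "absv (z - u) = absv u" using absv_diff_dom[OF zu] absv_diff_commute[of z u] by simp
      hence n0: "z - u \<noteq> 0" using u by (metis absv_eq_0_iff)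
      have "absv (\<Sum>v\<in>V m. 1 / (z - u - v) ^ k) = B / absv u ^ e"
        using h[of "z - u"] n0 less_trans[OF _ zu] z(2) unfolding a by blast
      also have "\<dots> < B / absv z ^ e"
        using B e z zu u(2) by (intro divide_strict_left_mono power_strict_mono mult_pos_pos) auto
      finally show "absv (\<Sum>v\<in>V m. 1 / (z - u - v) ^ k) < absv (\<Sum>v\<in>V m. 1 / (z - 0 - v) ^ k)"
        using h[OF z(1,2)] by simp
    qed
    finally show ?thesis using h[OF z(1,2)] by simp
  qed
  have "(\<lambda>d. absv (\<Sum>v\<in>V (d + m). 1 / (z - v) ^ k)) \<longlonglongrightarrow> absv (Cfun \<Lambda> k z)"
    by (rule LIMSEQ_ignore_initial_segment[OF tendsto_absv[OF Cfun_limit[OF k]]])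
  hence "(\<lambda>d. B / absv z ^ e) \<longlonglongrightarrow> absv (Cfun \<Lambda> k z)" using fin by (simp add: add.commute)
  thus ?thesis using LIMSEQ_unique tendsto_const by blast
qed

lemma absv_C_regular:
  assumes k: "k \<ge> 1" and reg: "i_regular p q m k"
    and z: "z \<noteq> 0" "\<forall>j<m. absv (lam j) < absv z" "absv z < absv (lam m)"
  shows "absv (Cfun \<Lambda> k z) = (\<Prod>j<m. absv (lam j) ^ mu_exps k m j) / absv z ^ (k + mu k m)"
  using k by (intro coset_dominance[OF k _ _ absv_finite_C_regular[OF k reg] z] prod_pos) auto

text \<open>The numerator of the sum over the common denominator takes the same value at all points of
  \<open>V m\<close> by translation invariance, and its degree is smaller than their number, so it is
  constant.\<close>

lemma finite_C1_product:
  assumes "z \<notin> V m"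
  shows "(\<Sum>v\<in>V m. 1 / (z - v)) = (\<Prod>w\<in>V m - {0}. w) / (\<Prod>v\<in>V m. z - v)"
proof -
  define N where "N = (\<Sum>v\<in>V m. \<Prod>w\<in>V m - {v}. [:- w, 1:])"
  define c where "c = (\<Prod>w\<in>V m - {0}. w)"
  have ev: "poly N x = (\<Sum>v\<in>V m. \<Prod>w\<in>V m - {v}. x - w)" for x
    by (simp add: N_def poly_sum poly_prod)
  have roots: "poly N a = c" if a: "a \<in> V m" for a
  proof -
    have "poly N a = (\<Sum>v\<in>V m. if v = a then \<Prod>w\<in>V m - {a}. a - w else 0)"
      unfolding ev using a by (intro sum.cong) auto
    also have "\<dots> = (\<Prod>w\<in>V m - {a}. a - w)" using a by simp
    also have "\<dots> = c" unfolding c_def using a W_closed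
      by (intro prod.reindex_bij_witness[of _ "\<lambda>w. a - w" "\<lambda>w. a - w"]) auto
    finally show ?thesis .
  qed
  have deg: "degree N < q ^ m"
  proof -
    have "degree (\<Prod>w\<in>V m - {v}. [:- w, 1:]) < q ^ m" if "v \<in> V m" for v
    proof -
      have "degree (\<Prod>w\<in>V m - {v}. [:- w, 1:]) \<le> (\<Sum>w\<in>V m - {v}. degree [:- w, 1:])"
        using degree_prod_sum_le[of "V m - {v}" "\<lambda>w. [:- w, 1:]"] by (simp add: o_def)
      also have "\<dots> = q ^ m - 1" using that by (simp add: card_V)
      also have "\<dots> < q ^ m" using q_ge_2 by simp
      finally show ?thesis .
    qed
    thus ?thesis unfolding N_def using q_ge_2 by (intro degree_sum_less) auto
  qed
  have "N = [:c:]"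
  proof (rule ccontr)
    assume "N \<noteq> [:c:]"
    hence n0: "N - [:c:] \<noteq> 0" by simp
    have "V m \<subseteq> {x. poly (N - [:c:]) x = 0}" using roots by auto
    hence "card (V m) \<le> card {x. poly (N - [:c:]) x = 0}"
      by (intro card_mono poly_roots_finite n0)
    also have "\<dots> \<le> degree (N - [:c:])" by (rule card_poly_roots_bound[OF n0])
    also have "\<dots> \<le> degree N" by (intro degree_diff_le) auto
    finally show False using deg card_V by simp
  qed
  hence "c = (\<Sum>v\<in>V m. \<Prod>w\<in>V m - {v}. z - w)" using ev[of z] by simp
  also have "\<dots> = (\<Sum>v\<in>V m. 1 / (z - v)) * (\<Prod>v\<in>V m. z - v)"
    unfolding sum_distrib_right
  proof (intro sum.cong refl)
    fix v assume v: "v \<in> V m"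
    hence "z - v \<noteq> 0" using assms by auto
    thus "(\<Prod>w\<in>V m - {v}. z - w) = 1 / (z - v) * (\<Prod>v\<in>V m. z - v)"
      using v by (simp add: prod.remove[of "V m" v])
  qed
  finally have "c = (\<Sum>v\<in>V m. 1 / (z - v)) * (\<Prod>v\<in>V m. z - v)" .
  moreover have "(\<Prod>v\<in>V m. z - v) \<noteq> 0" using assms by (auto simp: prod_zero_iff)
  ultimately show ?thesis unfolding c_def by (simp add: field_simps)
qed

text \<open>There are \<open>(q - 1) q\<^sup>j\<close> elements of absolute value \<open>|\<lambda>\<^sub>j|\<close>.\<close>

lemma lg_prod_V: "lg (\<Prod>w\<in>V m - {0}. w) = (real q - 1) * (\<Sum>j<m. lg (lam j) * real q ^ j)"
proof -
  \<comment> \<open>Giving 0 the weight 0 turns the product into a sum over the whole layer, to which the recursion over layers applies.\<close>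
  define h where "h w = (if w = 0 then 0 else lg w)" for w
  have "lg (\<Prod>w\<in>V m - {0}. w) = (\<Sum>w\<in>V m. h w)"
    by (subst lg_prod) (auto simp: h_def intro!: sum.mono_neutral_cong_left split: if_splits)
  also have "\<dots> = (real q - 1) * (\<Sum>j<m. lg (lam j) * real q ^ j)"
  proof (induction m)
    case (Suc m)
    have "(\<Sum>w\<in>V (Suc m). h w) = (\<Sum>c\<in>UNIV. \<Sum>v\<in>V m. h (sc c * lam m + v))"
      unfolding sum_W_Suc by simp
    also have "\<dots> = (\<Sum>v\<in>V m. h v) + (\<Sum>c\<in>UNIV - {0}. \<Sum>v\<in>V m. h (sc c * lam m + v))"
      by (simp add: sum.remove[of UNIV 0])
    also have "(\<Sum>c\<in>UNIV - {0}. \<Sum>v\<in>V m. h (sc c * lam m + v)) = (\<Sum>c\<in>UNIV - {0::'a}. \<Sum>v\<in>V m. lg (lam m))"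
    proof (intro sum.cong refl)
      fix c v assume c: "c \<in> UNIV - {0::'a}" and v: "v \<in> V m"
      have a: "absv (sc c * lam m + v) = absv (lam m)" using absv_W_step[OF v, of c] c by simp
      hence "sc c * lam m + v \<noteq> 0" by (metis absv_eq_0_iff lam_neq_0)
      thus "h (sc c * lam m + v) = lg (lam m)" using a by (simp add: h_def lg_def)
    qed
    also have "\<dots> = (real q - 1) * real q ^ m * lg (lam m)"
      using card_q q_ge_2 by (simp add: card_V card_Diff_singleton of_nat_diff)
    finally show ?case unfolding Suc by (simp add: algebra_simps)
  qed (simp add: h_def)
  finally show ?thesis .
qed

lemma lg_C1:
  assumes z: "z \<noteq> 0" "\<forall>j<m. absv (lam j) < absv z" "absv z < absv (lam m)"
  shows "lg (Cfun \<Lambda> 1 z) = (real q - 1) * (\<Sum>j<m. lg (lam j) * real q ^ j) - real q ^ m * lg z"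
    "Cfun \<Lambda> 1 z \<noteq> 0"
proof -
  let ?B = "absv (\<Prod>w\<in>V m - {0}. w)"
  have B0: "?B > 0" by (simp add: prod_zero_iff)
  have eq: "absv (Cfun \<Lambda> 1 z) = ?B / absv z ^ (q ^ m)"
  proof (rule coset_dominance[OF _ B0 _ _ z])
    fix y :: 'c assume y: "y \<noteq> 0" "\<forall>j<m. absv (lam j) < absv y"
    have vy: "absv v < absv y" if "v \<in> V m" for v using V_less[OF y(2) _ that] y by simp
    hence "y \<notin> V m" by blast
    hence "absv (\<Sum>v\<in>V m. 1 / (y - v)) = ?B / (\<Prod>v\<in>V m. absv (y - v))"
      by (simp add: finite_C1_product absv_divide absv_prod)
    also have "(\<Prod>v\<in>V m. absv (y - v)) = (\<Prod>v\<in>V m. absv y)"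
      using vy by (intro prod.cong refl absv_diff_dom)
    finally show "absv (\<Sum>v\<in>V m. 1 / (y - v) ^ 1) = ?B / absv y ^ (q ^ m)" by (simp add: card_V)
  qed (use q_ge_2 in auto)
  show "Cfun \<Lambda> 1 z \<noteq> 0"
  proof
    assume "Cfun \<Lambda> 1 z = 0"
    thus False using eq B0 z by simp
  qed
  have "lg (Cfun \<Lambda> 1 z) = log (real q) (?B / absv z ^ (q ^ m))" unfolding lg_def eq ..
  also have "\<dots> = lg (\<Prod>w\<in>V m - {0}. w) - real (q ^ m) * lg z"
    using B0 z q_gt_1 by (simp add: log_divide log_nat_power lg_def)
  finally show "lg (Cfun \<Lambda> 1 z) = (real q - 1) * (\<Sum>j<m. lg (lam j) * real q ^ j) - real q ^ m * lg z"
    unfolding lg_prod_V by simp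
qed

end

section \<open>Goss polynomials\<close>

lemma partial_fractions:
  fixes y d :: "'c::field"
  assumes "d \<noteq> 0" "y \<noteq> 0" "y \<noteq> d"
  shows "1 / ((y - d) * y ^ k) = 1 / (d ^ k * (y - d)) - (\<Sum>i<k. 1 / (d ^ (k - i) * y ^ Suc i))"
proof (induction k)
  case (Suc k)
  have yd: "y - d \<noteq> 0" using assms by simp
  have "1 / ((y - d) * y ^ Suc k) = 1 / ((y - d) * y ^ k) / y" by (simp add: mult_ac)
  also have "\<dots> = 1 / (d ^ k * (y - d)) / y - (\<Sum>i<k. 1 / (d ^ (k - i) * y ^ Suc i)) / y"
    unfolding Suc by (rule diff_divide_distrib)
  also have "1 / (d ^ k * (y - d)) / y = 1 / (d ^ Suc k * (y - d)) - 1 / (d ^ Suc k * y)"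
  proof -
    have key: "1 / ((y - d) * y) = (1 / (y - d) - 1 / y) / d"
      using assms yd by (simp add: diff_frac_eq)
    have "1 / (d ^ k * (y - d)) / y = 1 / d ^ k * (1 / ((y - d) * y))" by simp
    also have "\<dots> = 1 / d ^ Suc k * (1 / (y - d) - 1 / y)"
      unfolding key by (simp only: times_divide_times_eq power_Suc2 mult_1 times_divide_eq_left times_divide_eq_right divide_divide_eq_left divide_divide_eq_right mult.commute)
    also have "\<dots> = 1 / d ^ Suc k * (1 / (y - d)) - 1 / d ^ Suc k * (1 / y)"
      by (rule right_diff_distrib)
    also have "\<dots> = 1 / (d ^ Suc k * (y - d)) - 1 / (d ^ Suc k * y)"
      by (simp only: times_divide_times_eq mult_1)
    finally show ?thesis .
  qed
  also have "(\<Sum>i<k. 1 / (d ^ (k - i) * y ^ Suc i)) / y = (\<Sum>i<k. 1 / (d ^ (Suc k - Suc i) * y ^ Suc (Suc i)))"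
    unfolding sum_divide_distrib by (simp add: mult_ac)
  also have "1 / (d ^ Suc k * (y - d)) - 1 / (d ^ Suc k * y) - (\<Sum>i<k. 1 / (d ^ (Suc k - Suc i) * y ^ Suc (Suc i)))
     = 1 / (d ^ Suc k * (y - d)) - (\<Sum>i<Suc k. 1 / (d ^ (Suc k - i) * y ^ Suc i))"
    unfolding sum.lessThan_Suc_shift by simp
  finally show ?case .
qed simp

context sep_lattice
begin

text \<open>Write \<open>C\<^sub>1 C\<^sub>k\<close> as a double sum over pairs w, w + d.  The diagonal d = 0 gives \<open>C\<^sub>k\<^sub>+\<^sub>1\<close>, and
  partial fractions apply for \<open>d \<noteq> 0\<close>.  As 1 / 0 = 0, the value of C at 0 is the
  Eisenstein sum over the nonzero elements, and the partial fraction expansion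
  may be summed over all d.\<close>

lemma finite_goss_recursion:
  fixes m k :: nat and z :: 'c
  defines "C j x \<equiv> (\<Sum>v\<in>V m. 1 / (x - v) ^ j)"
  assumes z: "z \<notin> V m" and k: "k \<ge> 1"
  shows "C (Suc k) z = C 1 z * C k z - C k 0 * C 1 z + (\<Sum>i<k. C (k - i) 0 * C (Suc i) z)"
proof -
  have E: "C j 0 = (\<Sum>d\<in>V m. 1 / d ^ j)" for j
    unfolding C_def using W_minus by (intro sum.reindex_bij_witness[of _ uminus uminus]) auto
  have C1: "(\<Sum>d\<in>V m. h (w + d)) = (\<Sum>v\<in>V m. h v)" if "w \<in> V m" for w and h :: "'c \<Rightarrow> 'c"
    using that W_plus W_closed by (intro sum.reindex_bij_witness[of _ "\<lambda>v. v - w" "\<lambda>v. w + v"]) auto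
  have C1': "(\<Sum>w\<in>V m. h (w + d)) = (\<Sum>v\<in>V m. h v)" if "d \<in> V m" for d and h :: "'c \<Rightarrow> 'c"
    using C1[OF that, of h] by (simp add: add.commute)
  have inner: "(\<Sum>d\<in>V m. 1 / ((z - (w + d)) * (z - w) ^ k)) = 1 / (z - w) ^ Suc k +
    (\<Sum>d\<in>V m. 1 / (d ^ k * (z - (w + d))) - (\<Sum>i<k. 1 / (d ^ (k - i) * (z - w) ^ Suc i)))"
    if w: "w \<in> V m" for w
  proof -
    have "(\<Sum>d\<in>V m. 1 / ((z - (w + d)) * (z - w) ^ k)) = 1 / (z - w) ^ Suc k +
      (\<Sum>d\<in>V m - {0}. 1 / ((z - (w + d)) * (z - w) ^ k))"
      by (simp add: sum.remove[of "V m" 0])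
    also have "(\<Sum>d\<in>V m - {0}. 1 / ((z - (w + d)) * (z - w) ^ k)) =
      (\<Sum>d\<in>V m. 1 / (d ^ k * (z - (w + d))) - (\<Sum>i<k. 1 / (d ^ (k - i) * (z - w) ^ Suc i)))"
    proof (rule sum.mono_neutral_cong_left)
      fix d assume d: "d \<in> V m - {0}"
      have "z - w \<noteq> 0" using z w by auto
      moreover have "z - w \<noteq> d" using z W_plus[OF w, of d] d by auto
      ultimately show "1 / ((z - (w + d)) * (z - w) ^ k) =
        1 / (d ^ k * (z - (w + d))) - (\<Sum>i<k. 1 / (d ^ (k - i) * (z - w) ^ Suc i))"
        using partial_fractions[of d "z - w" k] d by (simp add: diff_diff_eq)
    next
      show "\<forall>d\<in>V m - (V m - {0}). 1 / (d ^ k * (z - (w + d))) - (\<Sum>i<k. 1 / (d ^ (k - i) * (z - w) ^ Suc i)) = 0"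
        using k by (auto simp: zero_power)
    qed auto
    finally show ?thesis .
  qed
  have "C 1 z * C k z = (\<Sum>w\<in>V m. (\<Sum>d\<in>V m. 1 / (z - (w + d))) * (1 / (z - w) ^ k))"
    unfolding C_def sum_distrib_left
    by (intro sum.cong refl) (simp add: C1[of _ "\<lambda>v. 1 / (z - v)"])
  also have "\<dots> = (\<Sum>w\<in>V m. \<Sum>d\<in>V m. 1 / ((z - (w + d)) * (z - w) ^ k))"
    unfolding sum_distrib_right by simp
  also have "\<dots> = (\<Sum>w\<in>V m. 1 / (z - w) ^ Suc k) + (\<Sum>w\<in>V m. \<Sum>d\<in>V m. 1 / (d ^ k * (z - (w + d)))) -
     (\<Sum>w\<in>V m. \<Sum>d\<in>V m. \<Sum>i<k. 1 / (d ^ (k - i) * (z - w) ^ Suc i))"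
    by (simp add: inner sum.distrib sum_subtractf del: power_Suc)
  also have "(\<Sum>w\<in>V m. \<Sum>d\<in>V m. 1 / (d ^ k * (z - (w + d)))) = (\<Sum>d\<in>V m. 1 / d ^ k * (\<Sum>w\<in>V m. 1 / (z - (w + d))))"
    by (subst sum.swap) (simp add: sum_distrib_left)
  also have "\<dots> = C k 0 * C 1 z"
    unfolding E by (simp add: C1'[of _ "\<lambda>v. 1 / (z - v)"] C_def sum_distrib_right)
  also have "(\<Sum>w\<in>V m. \<Sum>d\<in>V m. \<Sum>i<k. 1 / (d ^ (k - i) * (z - w) ^ Suc i)) =
     (\<Sum>w\<in>V m. \<Sum>i<k. \<Sum>d\<in>V m. 1 / (d ^ (k - i) * (z - w) ^ Suc i))"
    by (intro sum.cong refl sum.swap)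
  also have "\<dots> = (\<Sum>i<k. \<Sum>w\<in>V m. \<Sum>d\<in>V m. 1 / (d ^ (k - i) * (z - w) ^ Suc i))"
    by (rule sum.swap)
  also have "\<dots> = (\<Sum>i<k. \<Sum>d\<in>V m. \<Sum>w\<in>V m. 1 / (d ^ (k - i) * (z - w) ^ Suc i))"
    by (intro sum.cong refl sum.swap)
  also have "\<dots> = (\<Sum>i<k. C (k - i) 0 * C (Suc i) z)"
    unfolding E unfolding C_def sum_product by simp
  finally show ?thesis unfolding C_def by (simp add: algebra_simps)
qed

lemma goss_recursion:
  assumes z: "z \<notin> \<Lambda>" and k: "k \<ge> 1"
  shows "Cfun \<Lambda> (Suc k) z = Cfun \<Lambda> 1 z * Cfun \<Lambda> k z - Cfun \<Lambda> k 0 * Cfun \<Lambda> 1 z +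
    (\<Sum>i<k. Cfun \<Lambda> (k - i) 0 * Cfun \<Lambda> (Suc i) z)"
proof -
  define C where "C m j x = (\<Sum>v\<in>V m. 1 / (x - v) ^ j)" for m j x
  have lim: "(\<lambda>m. C m j x) \<longlonglongrightarrow> Cfun \<Lambda> j x" if "j \<ge> 1" for j x
    unfolding C_def by (rule Cfun_limit[OF that])
  have minus: "a - b = a + (- 1) * b" for a b :: 'c by simp
  have "z \<notin> V m" for m using z V_subset by blast
  hence eq: "C m (Suc k) z = C m 1 z * C m k z - C m k 0 * C m 1 z + (\<Sum>i<k. C m (k - i) 0 * C m (Suc i) z)" for m
    unfolding C_def by (rule finite_goss_recursion[OF _ k])
  have "(\<lambda>m. C m (Suc k) z) \<longlonglongrightarrow> Cfun \<Lambda> 1 z * Cfun \<Lambda> k z - Cfun \<Lambda> k 0 * Cfun \<Lambda> 1 z +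
    (\<Sum>i<k. Cfun \<Lambda> (k - i) 0 * Cfun \<Lambda> (Suc i) z)"
    unfolding eq minus using k
    by (intro tendsto_plus tendsto_times tendsto_sum' tendsto_const lim) auto
  moreover have "(\<lambda>m. C m (Suc k) z) \<longlonglongrightarrow> Cfun \<Lambda> (Suc k) z" by (rule lim) simp
  ultimately show ?thesis by (rule LIMSEQ_unique[rotated])
qed

lemma goss_exists:
  assumes "k \<ge> 1"
  shows "\<exists>G. degree G = k \<and> lead_coeff G = 1 \<and> (\<forall>z. z \<notin> \<Lambda> \<longrightarrow> Cfun \<Lambda> k z = poly G (Cfun \<Lambda> 1 z))"
  using assms
proof (induction k rule: less_induct)
  case (less k)
  show ?case
  proof (cases "k = 1")
    case True
    thus ?thesis by (intro exI[of _ "[:0, 1:]"]) simp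
  next
    case False
    then obtain n where n: "k = Suc n" "n \<ge> 1" using less.prems by (cases k) auto
    let ?Q = "\<lambda>j G. degree G = j \<and> lead_coeff G = 1 \<and>
      (\<forall>z. z \<notin> \<Lambda> \<longrightarrow> Cfun \<Lambda> j z = poly G (Cfun \<Lambda> 1 z))"
    have "\<forall>j\<in>{1..n}. \<exists>G. ?Q j G"
    proof
      fix j assume "j \<in> {1..n}"
      hence "j < k" "1 \<le> j" using n by auto
      thus "\<exists>G. ?Q j G" by (rule less.IH)
    qed
    from bchoice[OF this] obtain G where GG: "\<forall>j\<in>{1..n}. ?Q j (G j)" by blast
    have G1: "degree (G j) = j" if "j \<in> {1..n}" for j
      by (rule conjunct1[OF bspec[OF GG that]])
    have G2: "lead_coeff (G j) = 1" if "j \<in> {1..n}" for j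
      by (rule conjunct1[OF conjunct2[OF bspec[OF GG that]]])
    have G3: "Cfun \<Lambda> j z = poly (G j) (Cfun \<Lambda> 1 z)" if "j \<in> {1..n}" "z \<notin> \<Lambda>" for j z
      by (rule mp[OF spec[OF conjunct2[OF conjunct2[OF bspec[OF GG that(1)]]]] that(2)])
    define R where "R = (\<Sum>i<n. smult (Cfun \<Lambda> (n - i) 0) (G (Suc i))) - smult (Cfun \<Lambda> n 0) [:0, 1:]"
    define H where "H = R + pCons 0 (G n)"
    have Gn: "degree (G n) = n" "lead_coeff (G n) = 1" using G1[of n] G2[of n] n(2) by (simp_all del: One_nat_def)
    hence Gn0: "G n \<noteq> 0" by auto
    have "degree R \<le> n"
      unfolding R_def
    proof (intro degree_diff_le degree_sum_le)
      fix i assume "i \<in> {..<n}"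
      thus "degree (smult (Cfun \<Lambda> (n - i) 0) (G (Suc i))) \<le> n"
        using degree_smult_le[of "Cfun \<Lambda> (n - i) 0" "G (Suc i)"] G1[of "Suc i"] by simp
    next
      show "degree (smult (Cfun \<Lambda> n 0) [:0, 1:]) \<le> n"
        using degree_smult_le[of "Cfun \<Lambda> n 0" "[:0, 1:]"] n by simp
    qed auto
    hence lt: "degree R < degree (pCons 0 (G n))" using Gn Gn0 by simp
    have "degree H = k" using degree_add_eq_right[OF lt] Gn Gn0 n by (simp add: H_def)
    moreover have "lead_coeff H = 1" using lead_coeff_add_le[OF lt] Gn Gn0 by (simp add: H_def)
    moreover have "Cfun \<Lambda> k z = poly H (Cfun \<Lambda> 1 z)" if z: "z \<notin> \<Lambda>" for z
    proof -
      define t where "t = Cfun \<Lambda> 1 z"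
      have Gn': "poly (G n) t = Cfun \<Lambda> n z" unfolding t_def by (rule G3[symmetric]) (use n(2) z in auto)
      have Gi: "poly (G (Suc i)) t = Cfun \<Lambda> (Suc i) z" if "i \<in> {..<n}" for i
        unfolding t_def by (rule G3[symmetric]) (use that z in auto)
      have "poly H t = t * poly (G n) t - Cfun \<Lambda> n 0 * t +
        (\<Sum>i<n. Cfun \<Lambda> (n - i) 0 * poly (G (Suc i)) t)"
        unfolding H_def R_def by (simp add: poly_sum algebra_simps)
      also have "(\<Sum>i<n. Cfun \<Lambda> (n - i) 0 * poly (G (Suc i)) t) =
        (\<Sum>i<n. Cfun \<Lambda> (n - i) 0 * Cfun \<Lambda> (Suc i) z)"
        by (intro sum.cong refl) (simp only: Gi)
      also have "t * poly (G n) t - Cfun \<Lambda> n 0 * t + (\<Sum>i<n. Cfun \<Lambda> (n - i) 0 * Cfun \<Lambda> (Suc i) z) = Cfun \<Lambda> k z"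
        unfolding Gn' unfolding n(1) t_def by (rule goss_recursion[OF z n(2), symmetric])
      finally show ?thesis unfolding t_def ..
    qed
    ultimately show ?thesis by blast
  qed
qed

lemma lattice_absv: "l \<in> \<Lambda> \<Longrightarrow> l \<noteq> 0 \<Longrightarrow> \<exists>j. absv l = absv (lam j)"
proof -
  assume l: "l \<in> \<Lambda>" "l \<noteq> 0"
  then obtain m where "l \<in> V m" unfolding lattice_eq_Union by blast
  thus ?thesis
  proof (induction m)
    case 0 thus ?case using l by simp
  next
    case (Suc m)
    then obtain c w where w: "l = sc c * lam m + w" "w \<in> V m" by auto
    show ?case
    proof (cases "c = 0")
      case True
      thus ?thesis using Suc.IH w by simp
    next
      case False
      thus ?thesis using absv_W_step[OF w(2) False] unfolding w(1) by auto
    qed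
  qed
qed

text \<open>For 0 < |z| < 1 one has \<open>|C\<^sub>1(z)| = 1 / |z|\<close>, so the values at the powers of 1/T are distinct.\<close>

lemma infinite_C1_values: "infinite (Cfun \<Lambda> 1 ` (- \<Lambda>))"
proof
  assume fin: "finite (Cfun \<Lambda> 1 ` (- \<Lambda>))"
  define z where "z n = \<iota> (fls_X_intpow (int (Suc n)))" for n
  have az: "absv (z n) = inverse (real q ^ Suc n)" for n
    unfolding z_def absv_emb[OF fls_X_intpow_nonzero]
    by (simp only: fls_subdegree_fls_X_intpow power_int_minus power_int_of_nat)
  have lt1: "absv (z n) < 1" for n
  proof -
    have "1 < real q ^ Suc n" using q_gt_1 by (intro one_less_power) auto
    thus ?thesis unfolding az by (simp add: inverse_less_1_iff del: power_Suc)
  qed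
  have z0: "z n \<noteq> 0" for n using az[of n] q_gt_1 by auto
  have zL: "z n \<notin> \<Lambda>" for n using lattice_absv[of "z n"] z0 lt1[of n] lam_ge_1 by (metis not_le)
  have lgz: "lg (z n) = - real (Suc n)" for n
    unfolding lg_def az using q_gt_1 by (simp add: log_inverse log_nat_power del: power_Suc)
  have "lg (Cfun \<Lambda> 1 (z n)) = real (Suc n)" for n
    using lg_C1(1)[of "z n" 0] z0[of n] lt1[of n] lgz[of n] by simp
  hence "inj (\<lambda>n. Cfun \<Lambda> 1 (z n))" by (intro injI) (metis Suc_inject of_nat_eq_iff)
  hence "infinite (range (\<lambda>n. Cfun \<Lambda> 1 (z n)))" by (simp add: finite_image_iff)
  moreover have "range (\<lambda>n. Cfun \<Lambda> 1 (z n)) \<subseteq> Cfun \<Lambda> 1 ` (- \<Lambda>)" using zL by blast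
  ultimately show False using fin finite_subset by blast
qed

lemma goss_poly_props:
  assumes "k \<ge> 1"
  shows "degree (goss_poly \<Lambda> k) = k" "lead_coeff (goss_poly \<Lambda> k) = 1"
    "z \<notin> \<Lambda> \<Longrightarrow> Cfun \<Lambda> k z = poly (goss_poly \<Lambda> k) (Cfun \<Lambda> 1 z)"
proof -
  obtain G where G: "degree G = k" "lead_coeff G = 1" "\<forall>z. z \<notin> \<Lambda> \<longrightarrow> Cfun \<Lambda> k z = poly G (Cfun \<Lambda> 1 z)"
    using goss_exists[OF assms] by blast
  have "goss_poly \<Lambda> k = G"
    unfolding goss_poly_def
  proof (rule the_equality)
    show "\<forall>z. z \<notin> \<Lambda> \<longrightarrow> Cfun \<Lambda> k z = poly G (Cfun \<Lambda> 1 z)" by (rule G(3))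
  next
    fix H assume H: "\<forall>z. z \<notin> \<Lambda> \<longrightarrow> Cfun \<Lambda> k z = poly H (Cfun \<Lambda> 1 z)"
    show "H = G"
    proof (rule ccontr)
      assume "H \<noteq> G"
      hence "finite {x. poly (H - G) x = 0}" by (intro poly_roots_finite) simp
      moreover have "Cfun \<Lambda> 1 ` (- \<Lambda>) \<subseteq> {x. poly (H - G) x = 0}" using H G(3) by auto
      ultimately show False using infinite_C1_values finite_subset by blast
    qed
  qed
  thus "degree (goss_poly \<Lambda> k) = k" "lead_coeff (goss_poly \<Lambda> k) = 1"
    "z \<notin> \<Lambda> \<Longrightarrow> Cfun \<Lambda> k z = poly (goss_poly \<Lambda> k) (Cfun \<Lambda> 1 z)" using G by simp_all
qed

end

section \<open>Zeroes and slopes of split polynomials\<close>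

lemma gap_right:
  fixes F :: "real set"
  assumes "finite F" "a < b"
  shows "\<exists>c. a < c \<and> c \<le> b \<and> (\<forall>x\<in>F. \<not> (a < x \<and> x < c))"
proof (cases "{x \<in> F. a < x} = {}")
  case True
  thus ?thesis using assms(2) by (intro exI[of _ b]) auto
next
  case False
  define c where "c = min b (Min {x \<in> F. a < x})"
  have "a < Min {x \<in> F. a < x}" using False assms(1) by (subst Min_gr_iff) auto
  moreover have "Min {x \<in> F. a < x} \<le> x" if "x \<in> F" "a < x" for x using that assms(1) by (intro Min_le) auto
  ultimately show ?thesis using assms(2) by (intro exI[of _ c]) (fastforce simp: c_def)
qed

lemma finite_pos_lower_bound:
  assumes "finite J" "\<And>j. j \<in> J \<Longrightarrow> 0 < (h j :: real)"
  shows "\<exists>e>0. \<forall>j\<in>J. e \<le> h j"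
  using assms
proof (induction J rule: finite_induct)
  case empty
  show ?case by (intro exI[of _ 1]) simp
next
  case (insert x J)
  then obtain e where e: "e > 0" "\<forall>j\<in>J. e \<le> h j" by auto
  show ?case using e insert.prems by (intro exI[of _ "min e (h x)"]) (auto intro: min.coboundedI1)
qed

lemma size_filter_mset_mono:
  "(\<And>x. P x \<Longrightarrow> Q x) \<Longrightarrow> size (filter_mset P A) \<le> size (filter_mset Q A)"
  by (induction A) auto

context C_infinity
begin

text \<open>The disjunct s = 0 is needed because the logarithm of 0 is 0 here, while
  0 has to count as a zero with logarithm \<open>-\<infinity>\<close>.\<close>

definition nroots_le :: "'c multiset \<Rightarrow> real \<Rightarrow> nat" where
  "nroots_le A t = size (filter_mset (\<lambda>s. s = 0 \<or> lg s \<le> t) A)"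

lemma lg_diff_cases:
  assumes "x \<noteq> 0" "s \<noteq> 0 \<Longrightarrow> lg s \<noteq> lg x"
  shows "x - s \<noteq> 0" "lg (x - s) = (if s = 0 then lg x else max (lg x) (lg s))"
proof -
  show "x - s \<noteq> 0" using assms by auto
  show "lg (x - s) = (if s = 0 then lg x else max (lg x) (lg s))"
  proof (cases "s = 0")
    case False
    hence "absv x \<noteq> absv s" using assms lg_eq_iff[of s x] by auto
    hence "absv (x - s) = max (absv x) (absv s)" by (rule absv_diff_max)
    thus ?thesis using lg_less_iff[OF assms(1) False] False by (auto simp: lg_def max_def)
  qed simp
qed

text \<open>A linear factor x - s grows like x when s is smaller than x, and stays constant while s is
  larger than x; for s in between its growth lies between these extremes.\<close>

lemma lg_linear_prod_growth:
  assumes "x \<noteq> 0" "y \<noteq> 0" "lg x < lg y" "\<And>s. s \<in># A \<Longrightarrow> s \<noteq> 0 \<Longrightarrow> lg s \<noteq> lg x \<and> lg s \<noteq> lg y"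
  shows "poly (linear_prod A) x \<noteq> 0 \<and> poly (linear_prod A) y \<noteq> 0 \<and>
    real (nroots_le A (lg x)) * (lg y - lg x) \<le> lg (poly (linear_prod A) y) - lg (poly (linear_prod A) x) \<and>
    lg (poly (linear_prod A) y) - lg (poly (linear_prod A) x) \<le> real (nroots_le A (lg y)) * (lg y - lg x)"
  using assms(4)
proof (induction A)
  case (add s A)
  have sx: "x - s \<noteq> 0" "lg (x - s) = (if s = 0 then lg x else max (lg x) (lg s))"
    using lg_diff_cases[of x s] assms(1) add.prems by auto
  have sy: "y - s \<noteq> 0" "lg (y - s) = (if s = 0 then lg y else max (lg y) (lg s))"
    using lg_diff_cases[of y s] assms(2) add.prems by auto
  have p: "poly (linear_prod (add_mset s A)) x = (x - s) * poly (linear_prod A) x"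
     "poly (linear_prod (add_mset s A)) y = (y - s) * poly (linear_prod A) y"
    by (simp_all add: algebra_simps)
  have ih: "poly (linear_prod A) x \<noteq> 0" "poly (linear_prod A) y \<noteq> 0"
    "real (nroots_le A (lg x)) * (lg y - lg x) \<le> lg (poly (linear_prod A) y) - lg (poly (linear_prod A) x)"
    "lg (poly (linear_prod A) y) - lg (poly (linear_prod A) x) \<le> real (nroots_le A (lg y)) * (lg y - lg x)"
    using add.IH add.prems by auto
  have n: "real (nroots_le (add_mset s A) t) = (if s = 0 \<or> lg s \<le> t then 1 else 0) + real (nroots_le A t)" for t
    by (simp add: nroots_le_def)
  have l: "lg (poly (linear_prod (add_mset s A)) x) = lg (x - s) + lg (poly (linear_prod A) x)"
    "lg (poly (linear_prod (add_mset s A)) y) = lg (y - s) + lg (poly (linear_prod A) y)"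
    unfolding p using ih(1,2) sx(1) sy(1) by (simp_all add: lg_mult)

  have b: "(if s = 0 \<or> lg s \<le> lg x then 1 else 0) * (lg y - lg x) \<le> lg (y - s) - lg (x - s)"
     "lg (y - s) - lg (x - s) \<le> (if s = 0 \<or> lg s \<le> lg y then 1 else 0) * (lg y - lg x)"
    using assms(3) unfolding sx(2) sy(2) by (auto simp: max_def)
  have "poly (linear_prod (add_mset s A)) x \<noteq> 0" "poly (linear_prod (add_mset s A)) y \<noteq> 0"
    unfolding p using sx(1) sy(1) ih(1,2) by simp_all
  moreover have "real (nroots_le (add_mset s A) (lg x)) * (lg y - lg x) \<le>
      lg (poly (linear_prod (add_mset s A)) y) - lg (poly (linear_prod (add_mset s A)) x)"
    using b(1) ih(3) unfolding n l distrib_right by linarith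
  moreover have "lg (poly (linear_prod (add_mset s A)) y) - lg (poly (linear_prod (add_mset s A)) x) \<le>
      real (nroots_le (add_mset s A) (lg y)) * (lg y - lg x)"
    using b(2) ih(4) unfolding n l distrib_right by linarith
  ultimately show ?case by blast
qed (simp_all add: nroots_le_def)

text \<open>Over a short interval the slope D is squeezed between the numbers of roots below its two ends, so these
  numbers do not change inside (a, b).  The hypothesis need only hold for a dense set of radii, which
  allows avoiding the radii of the roots.\<close>

lemma roots_of_linear_growth:
  assumes ab: "a < b"
    and growth: "\<And>a' b'. a \<le> a' \<Longrightarrow> a' < b' \<Longrightarrow> b' \<le> b \<Longrightarrow> \<exists>x. x \<noteq> 0 \<and> a' < lg x \<and> lg x < b' \<and>
      lg (poly (linear_prod A) x) = D * lg x + E"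
  shows "\<And>s. s \<in># A \<Longrightarrow> s \<noteq> 0 \<Longrightarrow> \<not> (a < lg s \<and> lg s < b)" "real (nroots_le A a) = D"
proof -
  let ?P = "poly (linear_prod A)"
  have generic: "\<exists>x. x \<noteq> 0 \<and> a' < lg x \<and> lg x < b' \<and> lg (?P x) = D * lg x + E \<and> (\<forall>s\<in>#A. lg s \<noteq> lg x)"
    if ab': "a \<le> a'" "a' < b'" "b' \<le> b" for a' b'
  proof -
    obtain c where c: "a' < c" "c \<le> b'" "\<forall>t\<in>lg ` set_mset A. \<not> (a' < t \<and> t < c)"
      using gap_right[of "lg ` set_mset A" a' b'] ab' by auto
    obtain x where "x \<noteq> 0" "a' < lg x" "lg x < c" "lg (?P x) = D * lg x + E"
      using growth[of a' c] ab' c by auto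
    thus ?thesis using c by (intro exI[of _ x]) auto
  qed
  have slope: "real (nroots_le A (lg x)) \<le> D" "D \<le> real (nroots_le A (lg y))"
    if "x \<noteq> 0" "lg (?P x) = D * lg x + E" "\<forall>s\<in>#A. lg s \<noteq> lg x"
      "y \<noteq> 0" "lg (?P y) = D * lg y + E" "\<forall>s\<in>#A. lg s \<noteq> lg y" "lg x < lg y" for x y
  proof -
    have "real (nroots_le A (lg x)) * (lg y - lg x) \<le> lg (?P y) - lg (?P x)"
      "lg (?P y) - lg (?P x) \<le> real (nroots_le A (lg y)) * (lg y - lg x)"
      using lg_linear_prod_growth[of x y A] that by auto
    hence "real (nroots_le A (lg x)) * (lg y - lg x) \<le> D * (lg y - lg x)"
      "D * (lg y - lg x) \<le> real (nroots_le A (lg y)) * (lg y - lg x)"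
      using that by (simp_all add: algebra_simps)
    thus "real (nroots_le A (lg x)) \<le> D" "D \<le> real (nroots_le A (lg y))"
      using that(7) by (simp_all add: mult_le_cancel_right)
  qed
  have mono: "nroots_le A t \<le> nroots_le A u" if "t \<le> u" for t u
    unfolding nroots_le_def using that by (intro size_filter_mset_mono) auto
  show no_root: "\<not> (a < lg s \<and> lg s < b)" if s: "s \<in># A" "s \<noteq> 0" for s
  proof
    assume as: "a < lg s \<and> lg s < b"
    define c where "c = (a + lg s) / 2"
    define e where "e = (lg s + b) / 2"
    have ce: "a < c" "c < lg s" "lg s < e" "e < b" using as unfolding c_def e_def by auto
    obtain x0 where x0: "x0 \<noteq> 0" "a < lg x0" "lg x0 < c" "lg (?P x0) = D * lg x0 + E" "\<forall>s\<in>#A. lg s \<noteq> lg x0"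
      using generic[of a c] ce by auto
    obtain x where x: "x \<noteq> 0" "c < lg x" "lg x < lg s" "lg (?P x) = D * lg x + E" "\<forall>s\<in>#A. lg s \<noteq> lg x"
      using generic[of c "lg s"] ce by auto
    obtain y where y: "y \<noteq> 0" "lg s < lg y" "lg y < e" "lg (?P y) = D * lg y + E" "\<forall>s\<in>#A. lg s \<noteq> lg y"
      using generic[of "lg s" e] ce by auto
    obtain y' where y': "y' \<noteq> 0" "e < lg y'" "lg y' < b" "lg (?P y') = D * lg y' + E" "\<forall>s\<in>#A. lg s \<noteq> lg y'"
      using generic[of e b] ce by auto
    have 1: "D \<le> real (nroots_le A (lg x))" using slope(2)[of x0 x] x0 x by auto
    have 2: "real (nroots_le A (lg y)) \<le> D" using slope(1)[of y y'] y y' by auto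
    have "nroots_le A (lg x) < nroots_le A (lg y)"
    proof -
      obtain B where A: "A = add_mset s B" using s(1) by (metis insert_DiffM)
      have "nroots_le B (lg x) \<le> nroots_le B (lg y)"
        unfolding nroots_le_def using x y by (intro size_filter_mset_mono) auto
      thus ?thesis using x y s(2) unfolding A nroots_le_def by simp
    qed
    thus False using 1 2 by linarith
  qed
  obtain x where x: "x \<noteq> 0" "a < lg x" "lg x < (a + b) / 2" "lg (?P x) = D * lg x + E" "\<forall>s\<in>#A. lg s \<noteq> lg x"
    using generic[of a "(a + b) / 2"] ab by auto
  obtain y where y: "y \<noteq> 0" "(a + b) / 2 < lg y" "lg y < b" "lg (?P y) = D * lg y + E" "\<forall>s\<in>#A. lg s \<noteq> lg y"
    using generic[of "(a + b) / 2" b] ab by auto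
  have "filter_mset (\<lambda>s. s = 0 \<or> lg s \<le> lg y) A = filter_mset (\<lambda>s. s = 0 \<or> lg s \<le> a) A"
    using no_root y by (intro filter_mset_cong refl) (smt (verit) x(2,3))
  hence "nroots_le A (lg y) = nroots_le A a" unfolding nroots_le_def by simp
  moreover have "nroots_le A a \<le> nroots_le A (lg x)" using x by (intro mono) simp
  ultimately show "real (nroots_le A a) = D" using slope[of x y] x y by (smt (verit) of_nat_mono)
qed

text \<open>Multiplying by X - a moves the dominant index up by one if a is smaller than r, and keeps it if
  a is larger than r.\<close>

lemma dominant_coefficient:
  assumes "r > 0" "\<And>s. s \<in># A \<Longrightarrow> absv s \<noteq> r"
  shows "\<exists>d. \<forall>j. j \<noteq> d \<longrightarrow> absv (coeff (linear_prod A) j :: 'c) * r ^ j < absv (coeff (linear_prod A) d) * r ^ d"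
  using assms(2)
proof (induction A)
  case empty
  show ?case by (intro exI[of _ 0]) (simp add: coeff_pCons split: nat.split)
next
  case (add a A)
  define c where "c j = absv (coeff (linear_prod A) j) * r ^ j" for j
  obtain d where d: "\<And>j. j \<noteq> d \<Longrightarrow> c j < c d" using add unfolding c_def by auto
  have le: "c j \<le> c d" for j using d[of j] by (cases "j = d") auto
  have c0: "c j \<ge> 0" for j unfolding c_def using assms(1) by simp
  have cd: "c d > 0" using d[of "Suc d"] c0[of "Suc d"] by simp
  define P where "P = linear_prod (add_mset a A)"
  define u where "u j = (case j of 0 \<Rightarrow> 0 | Suc i \<Rightarrow> coeff (linear_prod A) i)" for j
  have cf: "coeff P j = u j - a * coeff (linear_prod A) j" for j
    unfolding P_def u_def by (simp add: coeff_pCons split: nat.split)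
  have u: "absv (u j) * r ^ j = (case j of 0 \<Rightarrow> 0 | Suc i \<Rightarrow> r * c i)" for j
    unfolding u_def c_def by (simp split: nat.split)
  have w: "absv (a * coeff (linear_prod A) j) * r ^ j = absv a * c j" for j
    unfolding c_def absv_mult by simp
  have bound: "absv (coeff P j) * r ^ j \<le> max (absv (u j) * r ^ j) (absv a * c j)" for j
  proof -
    have "absv (coeff P j) * r ^ j \<le> max (absv (u j)) (absv (a * coeff (linear_prod A) j)) * r ^ j"
      unfolding cf using assms(1) by (intro mult_right_mono absv_diff) simp
    also have "\<dots> = max (absv (u j) * r ^ j) (absv a * c j)"
      unfolding w[symmetric] using assms(1) by (simp add: max_mult_distrib_right)
    finally show ?thesis .
  qed
  have rj: "r ^ j > 0" for j using assms(1) by simp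
  have "\<exists>d'. \<forall>j. j \<noteq> d' \<longrightarrow> absv (coeff P j) * r ^ j < absv (coeff P d') * r ^ d'"
  proof (cases "absv a < r")
    case True
    have "absv a * c (Suc d) < r * c d"
      using True d[of "Suc d"] c0[of "Suc d"] cd by (intro mult_strict_mono') auto
    hence "absv (a * coeff (linear_prod A) (Suc d)) * r ^ Suc d < absv (u (Suc d)) * r ^ Suc d"
      unfolding w u by simp
    hence "absv (a * coeff (linear_prod A) (Suc d)) < absv (u (Suc d))" using rj[of "Suc d"] by (simp only: mult_less_cancel_right_pos)
    hence "absv (coeff P (Suc d)) = absv (u (Suc d))" unfolding cf by (rule absv_diff_dom)
    hence top: "absv (coeff P (Suc d)) * r ^ Suc d = r * c d" using u[of "Suc d"] by simp
    have "absv (coeff P j) * r ^ j < r * c d" if "j \<noteq> Suc d" for j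
    proof -
      have "absv (u j) * r ^ j < r * c d" unfolding u using that d assms(1) cd by (cases j) auto
      moreover have "absv a * c j \<le> absv a * c d" using le by (intro mult_left_mono) auto
      moreover have "absv a * c d < r * c d" using True cd by simp
      ultimately show ?thesis using bound[of j] by linarith
    qed
    thus ?thesis unfolding top[symmetric] by blast
  next
    case False
    hence gt: "r < absv a" using add.prems[of a] by simp
    have ule: "absv (u j) * r ^ j < absv a * c d" for j
    proof -
      have "absv (u j) * r ^ j \<le> r * c d" unfolding u using le assms(1) cd by (cases j) auto
      also have "\<dots> < absv a * c d" using gt cd by simp
      finally show ?thesis .
    qed
    hence "absv (u d) * r ^ d < absv (a * coeff (linear_prod A) d) * r ^ d" unfolding w by simp
    hence "absv (u d) < absv (a * coeff (linear_prod A) d)" using rj[of d] by (simp only: mult_less_cancel_right_pos)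
    hence "absv (coeff P d) = absv (a * coeff (linear_prod A) d)"
      unfolding cf by (subst absv_diff_commute) (rule absv_diff_dom)
    hence top: "absv (coeff P d) * r ^ d = absv a * c d" using w[of d] by simp
    have "absv (coeff P j) * r ^ j < absv a * c d" if "j \<noteq> d" for j
      using bound[of j] ule[of j] d[OF that] gt assms(1)
      by (smt (verit) mult_strict_left_mono)
    thus ?thesis unfolding top[symmetric] by blast
  qed
  thus ?case unfolding P_def .
qed

text \<open>If no root has logarithm s, then a single coefficient d dominates on the corresponding sphere, that
  is, all other Newton points lie strictly above the line of slope s through the d-th point, and
  even above a wedge with its tip there.  A polygon above the wedge that touches its tip cannot be
  parallel to the line over an interval.\<close>

lemma newton_slope_imp_root:
  assumes "newton_slope q (linear_prod A) s"
  shows "\<exists>x\<in>#A. x \<noteq> 0 \<and> lg x = s"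
proof (rule ccontr)
  assume no: "\<not> ?thesis"
  define P where "P = linear_prod A"
  define r where "r = real q powr s"
  have r: "r > 0" using q_gt_1 by (simp add: r_def)
  have "absv x \<noteq> r" if "x \<in># A" for x
  proof
    assume x: "absv x = r"
    hence "x \<noteq> 0" using r by auto
    moreover have "lg x = s" unfolding lg_def x r_def using q_gt_1 by simp
    ultimately show False using no that by blast
  qed
  then obtain d where d: "\<And>j. j \<noteq> d \<Longrightarrow> absv (coeff P j) * r ^ j < absv (coeff P d) * r ^ d"
    using dominant_coefficient[OF r] unfolding P_def by blast
  have d0: "coeff P d \<noteq> 0"
  proof
    assume "coeff P d = 0"
    hence "absv (coeff P (Suc d)) * r ^ Suc d < 0" using d[of "Suc d"] by simp
    moreover have "absv (coeff P (Suc d)) * r ^ Suc d \<ge> 0" using r by (intro mult_nonneg_nonneg) auto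
    ultimately show False by linarith
  qed
  define y where "y j = - lg (coeff P j)" for j
  define J where "J = {j. coeff P j \<noteq> 0}"
  have finJ: "finite J" unfolding J_def using MOST_coeff_eq_0[of P] by (simp add: MOST_nat) 
     (metis (mono_tags, lifting) finite_nat_iff_bounded_le mem_Collect_eq not_le subsetI atMost_iff)
  have pts: "newton_points q P = (\<lambda>j. (real j, y j)) ` J"
    unfolding newton_points_def J_def y_def lg_def by auto
  have above: "y j > y d + s * (real j - real d)" if j: "j \<in> J" "j \<noteq> d" for j
  proof -
    have rlog: "log (real q) (r ^ i) = real i * s" for i
      unfolding r_def using q_gt_1 by (simp add: log_nat_power)
    have eq: "log (real q) (absv (coeff P i) * r ^ i) = - y i + real i * s" if "coeff P i \<noteq> 0" for i
      unfolding y_def lg_def using that r q_gt_1 by (simp add: log_mult rlog)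
    have "log (real q) (absv (coeff P j) * r ^ j) < log (real q) (absv (coeff P d) * r ^ d)"
      using d[OF j(2)] j(1) d0 r q_gt_1 by (subst log_less_cancel_iff) (auto simp: J_def)
    moreover have "coeff P j \<noteq> 0" using j(1) by (simp add: J_def)
    ultimately show ?thesis unfolding eq[OF d0] eq[OF \<open>coeff P j \<noteq> 0\<close>] by (simp add: algebra_simps)
  qed
  have "\<exists>e>0. \<forall>j\<in>J - {d}. e \<le> (y j - (y d + s * (real j - real d))) / \<bar>real j - real d\<bar>"
    using above finJ by (intro finite_pos_lower_bound) auto
  then obtain e where e: "e > 0" "\<And>j. j \<in> J - {d} \<Longrightarrow> e \<le> (y j - (y d + s * (real j - real d))) / \<bar>real j - real d\<bar>"
    by blast
  define l where "l x = y d + s * (x - real d)" for x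
  \<comment> \<open>The region above the wedge.\<close>
  define H where "H = {z. l (fst z) + e * \<bar>fst z - real d\<bar> \<le> snd z}"
  have "convex H"
  proof (rule convexI)
    fix v w :: "real \<times> real" and a b :: real
    assume vw: "v \<in> H" "w \<in> H" "0 \<le> a" "0 \<le> b" "a + b = 1"
    have "l (a * fst v + b * fst w) = a * l (fst v) + b * l (fst w)"
    proof -
      have b: "b = 1 - a" using vw by simp
      show ?thesis unfolding l_def b by (simp add: algebra_simps)
    qed
    moreover have "\<bar>a * fst v + b * fst w - real d\<bar> \<le> a * \<bar>fst v - real d\<bar> + b * \<bar>fst w - real d\<bar>"
    proof -
      have "a * fst v + b * fst w - real d = a * (fst v - real d) + b * (fst w - real d)"
      proof -
        have b: "b = 1 - a" using vw by simp
        show ?thesis unfolding b by (simp add: algebra_simps)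
      qed
      also have "\<bar>\<dots>\<bar> \<le> \<bar>a * (fst v - real d)\<bar> + \<bar>b * (fst w - real d)\<bar>" by (rule abs_triangle_ineq)
      finally show ?thesis using vw by (simp add: abs_mult)
    qed
    hence "e * \<bar>a * fst v + b * fst w - real d\<bar> \<le> e * (a * \<bar>fst v - real d\<bar> + b * \<bar>fst w - real d\<bar>)"
      using e by (intro mult_left_mono) auto
    moreover have "a * (l (fst v) + e * \<bar>fst v - real d\<bar>) \<le> a * snd v" "b * (l (fst w) + e * \<bar>fst w - real d\<bar>) \<le> b * snd w"
      using vw unfolding H_def by (auto intro: mult_left_mono)
    ultimately show "a *\<^sub>R v + b *\<^sub>R w \<in> H"
      unfolding H_def by (simp add: algebra_simps)
  qed
  moreover have "newton_points q P \<subseteq> H"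
  proof
    fix z assume "z \<in> newton_points q P"
    then obtain j where j: "z = (real j, y j)" "j \<in> J" unfolding pts by blast
    show "z \<in> H"
    proof (cases "j = d")
      case False
      hence "0 < \<bar>real j - real d\<bar>" by simp
      hence "e * \<bar>real j - real d\<bar> \<le> y j - (y d + s * (real j - real d))"
        using e(2)[of j] j(2) False by (simp add: pos_le_divide_eq)
      thus ?thesis unfolding H_def l_def j(1) by simp
    qed (simp add: H_def l_def j(1))
  qed
  ultimately have hull: "convex hull (newton_points q P) \<subseteq> H" by (simp add: hull_minimal)
  define C where "C = convex hull (newton_points q P)"
  have dC: "(real d, y d) \<in> C" unfolding C_def pts using d0 by (intro hull_inc) (auto simp: J_def)
  have lower: "l x + e * \<bar>x - real d\<bar> \<le> t" if "(x, t) \<in> C" for x t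
    using hull that unfolding C_def H_def by auto
  define N where "N = newton_polygon q P"
  have N: "N x = Inf {t. (x, t) \<in> C}" for x unfolding N_def newton_polygon_def C_def ..
  have Nle: "N x \<le> t" if "(x, t) \<in> C" for x t
    unfolding N using that lower by (intro cInf_lower) (auto intro!: bdd_belowI)
  have Nge: "b \<le> N x" if "x \<in> fst ` C" "\<And>t. (x, t) \<in> C \<Longrightarrow> b \<le> t" for x b
    unfolding N using that by (intro cInf_greatest) auto
  obtain u v where uv: "u < v" "{u..v} \<subseteq> fst ` C" "\<And>x. x \<in> {u..v} \<Longrightarrow> N x = N u + s * (x - u)"
    using assms unfolding newton_slope_def P_def[symmetric] C_def[symmetric] N_def[symmetric] by blast
  have const: "N x - l x = N u - l u" if "x \<in> {u..v}" for x
    unfolding uv(3)[OF that] l_def by (simp add: algebra_simps)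
  have Nlow: "l x + e * \<bar>x - real d\<bar> \<le> N x" if "x \<in> {u..v}" for x
    using uv(2) that lower by (intro Nge) auto
  \<comment> \<open>If w lies strictly between the tip and w', convexity makes the height above the line smaller at w than at w'.\<close>
  have outside: False if w: "w \<in> {u..v}" "w' \<in> {u..v}" "0 < t" "t < 1" "w = (1 - t) * real d + t * w'" "w \<noteq> real d" for w w' t
  proof -
    define c where "c = N w - l w"
    have c': "N w' = l w' + c" using const[OF w(1)] const[OF w(2)] unfolding c_def by simp
    have cpos: "c > 0"
    proof -
      have "e * \<bar>w - real d\<bar> > 0" using e w(6) by simp
      thus ?thesis using Nlow[OF w(1)] unfolding c_def by linarith
    qed
    have lw: "l w = (1 - t) * y d + t * l w'" unfolding l_def w(5) by (simp add: algebra_simps)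
    have "l w' + c / t \<le> N w'"
    proof (rule Nge)
      fix z assume z: "(w', z) \<in> C"
      have "(1 - t) *\<^sub>R (real d, y d) + t *\<^sub>R (w', z) \<in> C"
        using dC z w(3,4) unfolding C_def by (intro convexD convex_convex_hull) auto
      hence "(w, (1 - t) * y d + t * z) \<in> C" by (simp add: w(5))
      hence "N w \<le> (1 - t) * y d + t * z" by (rule Nle)
      hence "c \<le> t * (z - l w')" unfolding c_def lw by (simp add: algebra_simps)
      thus "l w' + c / t \<le> z" using w(3) by (simp add: field_simps)
    qed (use uv(2) w(2) in blast)
    hence "c / t \<le> c" using c' by simp
    hence "c \<le> c * t" using w(3) by (simp add: field_simps)
    thus False using cpos w(4) by simp
  qed
  consider "real d < u" | "v < real d" | "real d \<in> {u..v}" by force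
  thus False
  proof cases
    case 1
    define t where "t = (u - real d) / (v - real d)"
    have "t * (v - real d) = u - real d" using 1 uv(1) by (simp add: t_def)
    hence "u = (1 - t) * real d + t * v" by (simp add: algebra_simps)
    moreover have "0 < t" "t < 1" using 1 uv(1) by (simp_all add: t_def)
    ultimately show False using 1 uv(1) by (intro outside[of u v t]) auto
  next
    case 2
    define t where "t = (real d - v) / (real d - u)"
    have "t * (real d - u) = real d - v" using 2 uv(1) by (simp add: t_def)
    hence "v = (1 - t) * real d + t * u" by (simp add: algebra_simps)
    moreover have "0 < t" "t < 1" using 2 uv(1) by (simp_all add: t_def)
    ultimately show False using 2 uv(1) by (intro outside[of v u t]) auto
  next
    case 3
    have "N (real d) - l (real d) \<le> 0" using Nle[OF dC] by (simp add: l_def)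
    hence le0: "N x - l x \<le> 0" if "x \<in> {u..v}" for x using const[OF 3] const[OF that] by simp
    have "e * \<bar>u - real d\<bar> \<le> 0" "e * \<bar>v - real d\<bar> \<le> 0"
      using Nlow[of u] Nlow[of v] le0[of u] le0[of v] uv(1) by auto
    thus False using e(1) uv(1) by (auto simp: mult_le_0_iff)
  qed
qed

end

section \<open>Zeroes of regular Goss polynomials\<close>

lemma i_regular_mono: "i_regular p q m k \<Longrightarrow> n \<le> m \<Longrightarrow> i_regular p q n k"
  unfolding i_regular_def by auto

lemma regular_imp_i_regular: "regular p q k \<Longrightarrow> i_regular p q m k"
  unfolding regular_def by (cases "m = 0") (auto simp: i_regular_def)

lemma sum_count_filter: "(\<Sum>x | x \<in># A \<and> P x. count A x) = size (filter_mset P A)"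
  by (simp add: size_multiset_overloaded_eq)

lemma size_filter_split:
  assumes "\<And>x. x \<in># A \<Longrightarrow> P x \<longleftrightarrow> Q x \<or> R x" "\<And>x. \<not> (Q x \<and> R x)"
  shows "size (filter_mset P A) = size (filter_mset Q A) + size (filter_mset R A)"
  using assms(1)
proof (induction A)
  case (add x A)
  thus ?case using assms(2)[of x] by auto
qed simp

context sep_lattice
begin

lemma crit_eq: "crit q lam j = lg (lam j)"
  by (simp add: crit_def lg_def)

lemma critL_Suc: "critL q lam (Suc i) = critL q lam i - (lg (lam (Suc i)) - lg (lam i)) * real q ^ Suc i"
  by (simp add: critL_def crit_eq algebra_simps)

lemma lg_lam_less_iff: "lg (lam i) < lg (lam j) \<longleftrightarrow> i < j"
  by (simp add: lg_less_iff lam_less_iff)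

lemma critL_decreasing: "i < j \<Longrightarrow> critL q lam j < critL q lam i"
proof (rule lift_Suc_mono_less[of "\<lambda>i. - critL q lam i", simplified])
  fix n
  have "0 < (lg (lam (Suc n)) - lg (lam n)) * real q ^ Suc n"
    using lg_lam_less_iff[of n "Suc n"] q_gt_1 by (intro mult_pos_pos) auto
  thus "critL q lam (Suc n) < critL q lam n" unfolding critL_Suc by linarith
qed

lemma critL_antimono: "i \<le> j \<Longrightarrow> critL q lam j \<le> critL q lam i"
  using critL_decreasing[of i j] by (cases "i = j") auto

text \<open>As the critical radii are unbounded, this forces L to tend to \<open>-\<infinity>\<close>.\<close>

lemma critL_le: "critL q lam i \<le> - lg (lam i)"
proof (induction i)
  case 0
  show ?case by (simp add: critL_def crit_eq)
next
  case (Suc i)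
  have "1 \<le> real q ^ Suc i" using q_gt_1 by (intro one_le_power) simp
  moreover define P where "P = (lg (lam (Suc i)) - lg (lam i)) * real q ^ Suc i"
  ultimately have "(lg (lam (Suc i)) - lg (lam i)) * 1 \<le> P"
    unfolding P_def using lg_lam_less_iff[of i "Suc i"] by (intro mult_left_mono) auto
  hence "lg (lam (Suc i)) - lg (lam i) \<le> P" by simp
  thus ?case using Suc unfolding critL_Suc P_def[symmetric] by argo
qed

lemma critL_unbounded: "\<exists>m. critL q lam m < R"
proof -
  obtain n where "real q powr (- R) < absv (lam n)" using lam_unbounded by blast
  hence "log (real q) (real q powr (- R)) < lg (lam n)"
    unfolding lg_def using q_gt_1 by (subst log_less_cancel_iff) auto
  hence "- R < lg (lam n)" using q_gt_1 by simp
  thus ?thesis using critL_le[of n] by (intro exI[of _ n]) linarith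
qed

lemma between_radii_not_in_lattice:
  assumes "z \<noteq> 0" "\<forall>j<m. absv (lam j) < absv z" "absv z < absv (lam m)"
  shows "z \<notin> \<Lambda>"
proof
  assume "z \<in> \<Lambda>"
  then obtain j where "absv z = absv (lam j)" using lattice_absv assms(1) by blast
  thus False using assms lam_less_iff by (cases "j < m") auto
qed

lemma C_regular_nonzero:
  assumes k: "k \<ge> 1" and reg: "i_regular p q m k"
    and z: "z \<noteq> 0" "\<forall>j<m. absv (lam j) < absv z" "absv z < absv (lam m)"
  shows "Cfun \<Lambda> k z \<noteq> 0"
proof -
  have "absv (Cfun \<Lambda> k z) > 0"
    unfolding absv_C_regular[OF k reg z] using z(1) by (intro divide_pos_pos prod_pos) auto
  thus ?thesis by simp
qed

text \<open>A point off the critical spheres lies strictly between two neighbouring ones, or inside the first, and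
  there the value is known and not zero.\<close>

lemma zeroes_on_critical_spheres:
  assumes k: "k \<ge> 1" and reg: "i_regular p q (Suc i) k"
    and z: "z \<in> Czeroes \<Lambda> k" "vlog q z < ereal (crit q lam (Suc i))"
  shows "\<exists>j\<le>i. absv z = absv (lam j)"
proof (rule ccontr)
  assume no: "\<not> ?thesis"
  have z0: "z \<noteq> 0" "z \<notin> \<Lambda>" using z(1) V_subset[of 0] unfolding Czeroes_def by auto
  have zi: "absv z < absv (lam (Suc i))"
    using z(2) z0(1) lg_less_iff[of z "lam (Suc i)"] by (simp add: vlog_def crit_eq lg_def)
  define m where "m = (LEAST m. absv z < absv (lam m))"
  have m: "absv z < absv (lam m)" "m \<le> Suc i" unfolding m_def using zi by (auto intro: LeastI Least_le)
  have "absv (lam j) < absv z" if "j < m" for j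
    using not_less_Least[OF that[unfolded m_def]] no that m(2) by (metis Suc_leI Suc_le_mono linorder_less_linear order_trans)
  hence "Cfun \<Lambda> k z \<noteq> 0"
    using C_regular_nonzero[OF k i_regular_mono[OF reg m(2)] z0(1)] m(1) by blast
  thus False using z(1) by (simp add: Czeroes_def)
qed

lemma gamma_tilde_shell_eq:
  assumes k: "k \<ge> 1" and reg: "i_regular p q (Suc i) k" and j: "j \<le> i"
  shows "gamma_tilde_shell q \<Lambda> lam j k = gamma_tilde q \<Lambda> lam j k"
proof -
  have "ereal (crit q lam j) \<le> vlog q z \<and> vlog q z < ereal (crit q lam (Suc j)) \<longleftrightarrow> vlog q z = ereal (crit q lam j)"
    if z: "z \<in> Czeroes \<Lambda> k" for z
  proof
    assume v: "ereal (crit q lam j) \<le> vlog q z \<and> vlog q z < ereal (crit q lam (Suc j))"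
    have z0: "z \<noteq> 0" using z V_subset[of 0] unfolding Czeroes_def by auto
    have vz: "vlog q z = ereal (lg z)" using z0 by (simp add: vlog_def lg_def)
    obtain l where l: "absv z = absv (lam l)"
      using zeroes_on_critical_spheres[OF k i_regular_mono[OF reg, of "Suc j"] z] v j by auto
    hence "lg z = lg (lam l)" by (simp add: lg_def)
    hence "\<not> l < j" "l < Suc j" using v lg_lam_less_iff[of l j] lg_lam_less_iff[of l "Suc j"] unfolding vz crit_eq by auto
    hence "l = j" by simp
    thus "vlog q z = ereal (crit q lam j)" using \<open>lg z = lg (lam l)\<close> by (simp add: vz crit_eq)
  next
    assume "vlog q z = ereal (crit q lam j)"
    thus "ereal (crit q lam j) \<le> vlog q z \<and> vlog q z < ereal (crit q lam (Suc j))"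
      using lg_lam_less_iff[of j "Suc j"] by (simp add: crit_eq)
  qed
  hence "{z \<in> Czeroes \<Lambda> k. ereal (crit q lam j) \<le> vlog q z \<and> vlog q z < ereal (crit q lam (Suc j))} =
    {z \<in> Czeroes \<Lambda> k. vlog q z = ereal (crit q lam j)}" by blast
  thus ?thesis unfolding gamma_tilde_shell_def gamma_tilde_def by simp
qed

text \<open>For z between two critical radii, \<open>log C\<^sub>1(z)\<close> has slope \<open>-q\<^sup>m\<close> and \<open>log C\<^sub>k(z)\<close> has slope
  \<open>-(k + \<mu>\<^sub>m(k))\<close> in \<open>log z\<close>, and the former sweeps out the interval from L(m) to
  L(m - 1), or the half-line above L(0) if m = 0.\<close>

lemma goss_growth:
  assumes k: "k \<ge> 1" and reg: "i_regular p q m k"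
  shows "\<exists>E. \<forall>a b. critL q lam m \<le> a \<and> a < b \<and> (m > 0 \<longrightarrow> b \<le> critL q lam (m - 1)) \<longrightarrow>
    (\<exists>x. x \<noteq> 0 \<and> a < lg x \<and> lg x < b \<and>
      lg (poly (goss_poly \<Lambda> k) x) = real (k + mu k m) / real q ^ m * lg x + E)"
proof -
  define S where "S = (real q - 1) * (\<Sum>j<m. lg (lam j) * real q ^ j)"
  define D where "D = real (k + mu k m) / real q ^ m"
  define F where "F = log (real q) (\<Prod>j<m. absv (lam j) ^ mu_exps k m j)"
  have qm: "real q ^ m > 0" using q_gt_1 by simp
  have Sm: "S - critL q lam m = lg (lam m) * real q ^ m" by (simp add: S_def critL_def crit_eq)
  have Sm': "S - critL q lam (m - 1) = lg (lam (m - 1)) * real q ^ m" if "m > 0"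
    using that by (cases m) (simp_all add: S_def critL_def crit_eq algebra_simps)
  have "\<exists>x. x \<noteq> 0 \<and> a < lg x \<and> lg x < b \<and> lg (poly (goss_poly \<Lambda> k) x) = D * lg x + (F - D * S)"
    if ab: "critL q lam m \<le> a" "a < b" "m > 0 \<longrightarrow> b \<le> critL q lam (m - 1)" for a b
  proof -
    have "(S - b) / real q ^ m < (S - a) / real q ^ m" using ab qm by (simp add: divide_strict_right_mono)
    then obtain z where z: "z \<noteq> 0" "(S - b) / real q ^ m < lg z" "lg z < (S - a) / real q ^ m"
      using value_group_dense by blast
    have zl: "S - b < lg z * real q ^ m" "lg z * real q ^ m < S - a"
      using z qm by (simp_all add: pos_divide_less_eq pos_less_divide_eq)
    have "lg z * real q ^ m < lg (lam m) * real q ^ m" using zl(2) ab(1) Sm by linarith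
    hence up: "absv z < absv (lam m)" using qm z(1) by (simp add: lg_less_iff)
    have low: "\<forall>j<m. absv (lam j) < absv z"
    proof (intro allI impI)
      fix j assume j: "j < m"
      have "lg (lam (m - 1)) * real q ^ m < lg z * real q ^ m" using zl(1) ab(3) Sm' j by linarith
      hence "absv (lam (m - 1)) < absv z" using qm z(1) by (simp add: lg_less_iff)
      moreover have "absv (lam j) \<le> absv (lam (m - 1))" using j by (simp add: lam_le_iff)
      ultimately show "absv (lam j) < absv z" by linarith
    qed
    define x where "x = Cfun \<Lambda> 1 z"
    have x: "x \<noteq> 0" "lg x = S - real q ^ m * lg z"
      unfolding x_def S_def by (rule lg_C1[OF z(1) low up])+
    have "lg (poly (goss_poly \<Lambda> k) x) = lg (Cfun \<Lambda> k z)"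
      unfolding x_def using goss_poly_props(3)[OF k between_radii_not_in_lattice[OF z(1) low up]] by simp
    also have "\<dots> = F - real (k + mu k m) * lg z"
      unfolding lg_def absv_C_regular[OF k reg z(1) low up] F_def
      using z(1) q_gt_1 by (subst log_divide) (auto simp: log_nat_power prod_zero_iff intro!: prod_pos)
    also have "\<dots> = D * lg x + (F - D * S)"
      unfolding x(2) D_def using qm by (simp add: field_simps)
    finally show ?thesis using x zl by (intro exI[of _ x]) (simp add: mult.commute)
  qed
  thus ?thesis unfolding D_def[symmetric] by (intro exI[of _ "F - D * S"]) simp
qed

abbreviation goss_zeroes :: "nat \<Rightarrow> 'c multiset" where
  "goss_zeroes k \<equiv> proots (goss_poly \<Lambda> k)"

lemma goss_poly_splits:
  assumes "k \<ge> 1"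
  shows "goss_poly \<Lambda> k = linear_prod (goss_zeroes k)"
  using monic_splits[OF goss_poly_props(2)[OF assms]] by auto

text \<open>For m = 0 the interval is unbounded above, which is why the auxiliary endpoint b is arbitrary
  in that case.\<close>

lemma goss_zeroes_regular:
  assumes k: "k \<ge> 1" and reg: "i_regular p q m k"
  shows "real (nroots_le (goss_zeroes k) (critL q lam m)) = real (k + mu k m) / real q ^ m"
    "s \<in># goss_zeroes k \<Longrightarrow> s \<noteq> 0 \<Longrightarrow> critL q lam m < lg s \<Longrightarrow> m > 0 \<and> critL q lam (m - 1) \<le> lg s"
proof -
  define A where "A = goss_zeroes k"
  have A: "goss_poly \<Lambda> k = linear_prod A" unfolding A_def by (rule goss_poly_splits[OF k])
  have main: "real (nroots_le A (critL q lam m)) = real (k + mu k m) / real q ^ m"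
    "\<And>s. s \<in># A \<Longrightarrow> s \<noteq> 0 \<Longrightarrow> \<not> (critL q lam m < lg s \<and> lg s < b)"
    if b: "critL q lam m < b" "m > 0 \<longrightarrow> b \<le> critL q lam (m - 1)" for b
  proof -
    obtain E where E: "\<forall>a b. critL q lam m \<le> a \<and> a < b \<and> (m > 0 \<longrightarrow> b \<le> critL q lam (m - 1)) \<longrightarrow>
      (\<exists>x. x \<noteq> 0 \<and> a < lg x \<and> lg x < b \<and>
        lg (poly (linear_prod A) x) = real (k + mu k m) / real q ^ m * lg x + E)"
      using goss_growth[OF k reg] unfolding A by (rule exE)
    have gr: "\<exists>x. x \<noteq> 0 \<and> a' < lg x \<and> lg x < b' \<and>
        lg (poly (linear_prod A) x) = real (k + mu k m) / real q ^ m * lg x + E"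
      if "critL q lam m \<le> a'" "a' < b'" "b' \<le> b" for a' b'
      using that b by (intro E[rule_format]) auto
    show "real (nroots_le A (critL q lam m)) = real (k + mu k m) / real q ^ m"
      by (rule roots_of_linear_growth(2)[OF b(1) gr])
    show "\<not> (critL q lam m < lg s \<and> lg s < b)" if "s \<in># A" "s \<noteq> 0" for s
      by (rule roots_of_linear_growth(1)[OF b(1) gr that])
  qed
  show "real (nroots_le (goss_zeroes k) (critL q lam m)) = real (k + mu k m) / real q ^ m"
  proof (cases m)
    case 0
    thus ?thesis unfolding A_def[symmetric] by (intro main(1)[of "critL q lam m + 1"]) auto
  next
    case (Suc n)
    thus ?thesis unfolding A_def[symmetric]
      using critL_decreasing[of n m] by (intro main(1)[of "critL q lam n"]) auto
  qed
  show "m > 0 \<and> critL q lam (m - 1) \<le> lg s"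
    if s: "s \<in># goss_zeroes k" "s \<noteq> 0" "critL q lam m < lg s"
  proof (cases m)
    case 0
    thus ?thesis using main(2)[of "lg s + 1" s] s unfolding A_def by auto
  next
    case (Suc n)
    thus ?thesis using main(2)[of "critL q lam n" s] critL_decreasing[of n m] s unfolding A_def by auto
  qed
qed

text \<open>Take the least m with L(m) < t: the gap between L(m) and L(m - 1) leaves only t = L(m - 1).\<close>

lemma root_lg_is_critL:
  assumes gap: "\<And>m. m \<le> Suc i \<Longrightarrow> critL q lam m < t \<Longrightarrow> m > 0 \<and> critL q lam (m - 1) \<le> t"
    and t: "critL q lam (Suc i) < t"
  shows "\<exists>j\<le>i. t = critL q lam j"
proof -
  define m where "m = (LEAST m. critL q lam m < t)"
  have m: "critL q lam m < t" "m \<le> Suc i" unfolding m_def using t by (auto intro: LeastI Least_le)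
  have g: "m > 0" "critL q lam (m - 1) \<le> t" using gap[OF m(2,1)] by auto
  moreover have "\<not> critL q lam (m - 1) < t"
    using g(1) not_less_Least[of "m - 1" "\<lambda>m. critL q lam m < t"] unfolding m_def by simp
  ultimately show ?thesis using m(2) by (intro exI[of _ "m - 1"]) auto
qed

lemma newton_slope_regular:
  assumes k: "k \<ge> 1" and reg: "i_regular p q (Suc i) k"
    and s: "newton_slope q (goss_poly \<Lambda> k) s" "s > critL q lam (Suc i)"
  shows "\<exists>j\<le>i. s = critL q lam j"
proof -
  have "newton_slope q (linear_prod (goss_zeroes k)) s"
    by (subst goss_poly_splits[OF k, symmetric]) (rule s(1))
  then obtain x where x: "x \<in># goss_zeroes k" "x \<noteq> 0" "lg x = s"
    using newton_slope_imp_root[of "goss_zeroes k" s] by auto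
  show ?thesis
  proof (rule root_lg_is_critL[OF _ s(2)])
    fix m assume m: "m \<le> Suc i" "critL q lam m < s"
    show "m > 0 \<and> critL q lam (m - 1) \<le> s"
      using goss_zeroes_regular(2)[OF k i_regular_mono[OF reg m(1)] x(1,2)] m(2) unfolding x(3) by simp
  qed
qed

lemma gamma_eq:
  assumes A: "goss_poly \<Lambda> k = linear_prod A"
  shows "gamma q \<Lambda> lam j k = size (filter_mset (\<lambda>x. x \<noteq> 0 \<and> lg x = critL q lam j) A)"
    "gamma_shell q \<Lambda> lam j k = size (filter_mset (\<lambda>x. x \<noteq> 0 \<and> critL q lam (Suc j) < lg x \<and> lg x \<le> critL q lam j) A)"
    "gamma_zero \<Lambda> k = size (filter_mset (\<lambda>x. x = 0) A)"
proof -
  have ord: "order x (linear_prod A) = count A x" for x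
    using count_proots[of "linear_prod A" x] by simp
  have v1: "vlog q x = ereal t \<longleftrightarrow> x \<noteq> 0 \<and> lg x = t" for x t by (simp add: vlog_def lg_def)
  have v2: "ereal t < vlog q x \<and> vlog q x \<le> ereal u \<longleftrightarrow> x \<noteq> 0 \<and> t < lg x \<and> lg x \<le> u" for x t u
    by (simp add: vlog_def lg_def)
  show "gamma q \<Lambda> lam j k = size (filter_mset (\<lambda>x. x \<noteq> 0 \<and> lg x = critL q lam j) A)"
    unfolding gamma_def A ord v1 poly_linear_prod_eq_0_iff by (rule sum_count_filter)
  show "gamma_shell q \<Lambda> lam j k = size (filter_mset (\<lambda>x. x \<noteq> 0 \<and> critL q lam (Suc j) < lg x \<and> lg x \<le> critL q lam j) A)"
    unfolding gamma_shell_def A ord v2 poly_linear_prod_eq_0_iff by (rule sum_count_filter)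
  show "gamma_zero \<Lambda> k = size (filter_mset (\<lambda>x. x = 0) A)"
    unfolding gamma_zero_def A ord by (simp add: filter_eq_replicate_mset)
qed

lemma gamma_regular:
  assumes k: "k \<ge> 1" and reg: "i_regular p q (Suc j) k"
  shows "gamma_shell q \<Lambda> lam j k = gamma q \<Lambda> lam j k"
    "real (gamma q \<Lambda> lam j k) =
      ((real q - 1) * real k + real q * real (mu k j) - real (mu k (j + 1))) / real q ^ (j + 1)"
proof -
  note A = goss_poly_splits[OF k]
  have ge: "critL q lam j \<le> lg s" if "s \<in># goss_zeroes k" "s \<noteq> 0" "critL q lam (Suc j) < lg s" for s
    using goss_zeroes_regular(2)[OF k reg that] by simp
  show eq: "gamma_shell q \<Lambda> lam j k = gamma q \<Lambda> lam j k"
    unfolding gamma_eq[OF A]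
    using ge critL_decreasing[of j "Suc j"] by (intro arg_cong[of _ _ size] filter_mset_cong refl) fastforce
  have "nroots_le (goss_zeroes k) (critL q lam j) = nroots_le (goss_zeroes k) (critL q lam (Suc j)) + gamma_shell q \<Lambda> lam j k"
    unfolding nroots_le_def gamma_eq[OF A]
    using critL_decreasing[of j "Suc j"] by (intro size_filter_split) auto
  hence "real (gamma q \<Lambda> lam j k) = real (nroots_le (goss_zeroes k) (critL q lam j)) - real (nroots_le (goss_zeroes k) (critL q lam (Suc j)))"
    unfolding eq by simp
  also have "\<dots> = real (k + mu k j) / real q ^ j - real (k + mu k (Suc j)) / real q ^ Suc j"
    using goss_zeroes_regular(1)[OF k reg] goss_zeroes_regular(1)[OF k i_regular_mono[OF reg, of j]] by simp
  also have "real (k + mu k j) / real q ^ j = real q * real (k + mu k j) / real q ^ Suc j"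
    using q_gt_1 by simp
  also have "real q * real (k + mu k j) / real q ^ Suc j - real (k + mu k (Suc j)) / real q ^ Suc j =
      (real q * real (k + mu k j) - real (k + mu k (Suc j))) / real q ^ Suc j"
    by (rule diff_divide_distrib[symmetric])
  also have "real q * real (k + mu k j) - real (k + mu k (Suc j)) =
      (real q - 1) * real k + real q * real (mu k j) - real (mu k (Suc j))"
    by (simp add: algebra_simps)
  finally show "real (gamma q \<Lambda> lam j k) =
      ((real q - 1) * real k + real q * real (mu k j) - real (mu k (j + 1))) / real q ^ (j + 1)"
    by (simp only: Suc_eq_plus1)
qed

text \<open>Once L(m) is below the logarithms of all nonzero zeroes, only the zero at 0 is counted.\<close>

lemma gamma_zero_regular:
  assumes k: "k \<ge> 1" and reg: "regular p q k"
  shows "\<exists>M. \<forall>m\<ge>M. real (gamma_zero \<Lambda> k) = real (k + mu k m) / real q ^ m"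
proof -
  note A = goss_poly_splits[OF k]
  obtain M where M: "critL q lam M < Min (insert 0 (lg ` set_mset (goss_zeroes k)))" using critL_unbounded by blast
  have "real (gamma_zero \<Lambda> k) = real (k + mu k m) / real q ^ m" if "m \<ge> M" for m
  proof -
    have "critL q lam m < lg x" if "x \<in># goss_zeroes k" for x
    proof -
      have "critL q lam m \<le> critL q lam M" by (rule critL_antimono) fact
      also have "\<dots> < Min (insert 0 (lg ` set_mset (goss_zeroes k)))" by (rule M)
      also have "\<dots> \<le> lg x" using that by (intro Min_le) auto
      finally show ?thesis .
    qed
    hence "nroots_le (goss_zeroes k) (critL q lam m) = gamma_zero \<Lambda> k"
      unfolding nroots_le_def gamma_eq[OF A]
      by (intro arg_cong[of _ _ size] filter_mset_cong refl) fastforce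
    thus ?thesis using goss_zeroes_regular(1)[OF k regular_imp_i_regular[OF reg], of m] by simp
  qed
  thus ?thesis by blast
qed

end

theorem theorem5p7:
  fixes p f q k i :: nat
    and \<iota> :: "'a::{field,finite} fls \<Rightarrow> 'c::{field,complete_space}"
    and \<Lambda> :: "'c set" and lam :: "nat \<Rightarrow> 'c"
  assumes "prime p" and "f \<ge> 1" and "q = p ^ f"
    and "C_infinity q \<iota>"
    and "normalized_separable_lattice \<iota> \<Lambda> lam"
    and "k \<ge> 1"
    and "i_regular p q (i + 1) k"
  shows
    \<comment> \<open>(i)\<close>
    "((\<forall>z \<in> Czeroes \<Lambda> k. vlog q z < ereal (crit q lam (i + 1)) \<longrightarrow> (\<exists>j\<le>i. absv z = absv (lam j))) \<and>
      (\<forall>j\<le>i. gamma_tilde_shell q \<Lambda> lam j k = gamma_tilde q \<Lambda> lam j k) \<and>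
      (\<forall>j\<le>i. gamma_shell q \<Lambda> lam j k = gamma q \<Lambda> lam j k) \<and>
      (\<forall>s. newton_slope q (goss_poly \<Lambda> k) s \<and> s > critL q lam (i + 1) \<longrightarrow>
           (\<exists>j\<le>i. s = critL q lam j))) \<and>
    \<comment> \<open>(ii)\<close>
     (\<forall>j\<le>i.
        real (gamma q \<Lambda> lam j k) =
          ((real q - 1) * real k + real q * real (approx_num p q j k) - real (approx_num p q (j + 1) k))
            / real q ^ (j + 1) \<and>
        (\<forall>\<Lambda>' lam'. normalized_separable_lattice \<iota> \<Lambda>' lam' \<longrightarrow>
           gamma q \<Lambda>' lam' j k = gamma q \<Lambda> lam j k)) \<and>
    \<comment> \<open>(iii)\<close>
     (regular p q k \<longrightarrow>
        (\<forall>\<Lambda>' lam'. normalized_separable_lattice \<iota> \<Lambda>' lam' \<longrightarrow> gamma_zero \<Lambda>' k = gamma_zero \<Lambda> k))"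
proof -
  interpret C_infinity q \<iota> by fact
  have lattice: "sep_lattice q \<iota> p f \<Lambda>' lam'" if "normalized_separable_lattice \<iota> \<Lambda>' lam'" for \<Lambda>' lam'
    using assms(1-3) that by unfold_locales
  interpret L: sep_lattice q \<iota> p f \<Lambda> lam by (rule lattice) fact
  have reg: "i_regular p q (Suc i) k" using assms(7) by simp
  have regj: "i_regular p q (Suc j) k" if "j \<le> i" for j
    by (rule i_regular_mono[OF reg]) (use that in simp)
  have same_gamma: "gamma q \<Lambda>' lam' j k = gamma q \<Lambda> lam j k"
    if j: "j \<le> i" and l: "normalized_separable_lattice \<iota> \<Lambda>' lam'" for j \<Lambda>' lam'
  proof -
    have "real (gamma q \<Lambda>' lam' j k) = real (gamma q \<Lambda> lam j k)"
      unfolding L.gamma_regular(2)[OF assms(6) regj[OF j]]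
        sep_lattice.gamma_regular(2)[OF lattice[OF l] assms(6) regj[OF j]] ..
    thus ?thesis by (simp only: of_nat_eq_iff)
  qed
  have same_zero: "gamma_zero \<Lambda>' k = gamma_zero \<Lambda> k"
    if r: "regular p q k" and l: "normalized_separable_lattice \<iota> \<Lambda>' lam'" for \<Lambda>' lam'
  proof -
    obtain M where M: "\<forall>m\<ge>M. real (gamma_zero \<Lambda> k) = real (k + approx_num p q m k) / real q ^ m"
      using L.gamma_zero_regular[OF assms(6) r] by blast
    obtain M' where M': "\<forall>m\<ge>M'. real (gamma_zero \<Lambda>' k) = real (k + approx_num p q m k) / real q ^ m"
      using sep_lattice.gamma_zero_regular[OF lattice[OF l] assms(6) r] by blast
    have "real (gamma_zero \<Lambda>' k) = real (gamma_zero \<Lambda> k)"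
      using M[rule_format, of "max M M'"] M'[rule_format, of "max M M'"] by simp
    thus ?thesis by simp
  qed
  show ?thesis
  proof (intro conjI allI ballI impI; (elim conjE)?)
    fix z assume "z \<in> Czeroes \<Lambda> k" "vlog q z < ereal (crit q lam (i + 1))"
    thus "\<exists>j\<le>i. absv z = absv (lam j)"
      using L.zeroes_on_critical_spheres[OF assms(6) reg] by simp
  next
    fix j assume j: "j \<le> i"
    show "gamma_tilde_shell q \<Lambda> lam j k = gamma_tilde q \<Lambda> lam j k"
      by (rule L.gamma_tilde_shell_eq[OF assms(6) reg j])
    show "gamma_shell q \<Lambda> lam j k = gamma q \<Lambda> lam j k"
      by (rule L.gamma_regular(1)[OF assms(6) regj[OF j]])
    show "real (gamma q \<Lambda> lam j k) =
      ((real q - 1) * real k + real q * real (approx_num p q j k) - real (approx_num p q (j + 1) k)) / real q ^ (j + 1)"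
      by (rule L.gamma_regular(2)[OF assms(6) regj[OF j]])
  next
    fix s assume "newton_slope q (goss_poly \<Lambda> k) s" "critL q lam (i + 1) < s"
    thus "\<exists>j\<le>i. s = critL q lam j"
      using L.newton_slope_regular[OF assms(6) reg] by simp
  next
    fix j \<Lambda>' lam' assume "j \<le> i" "normalized_separable_lattice \<iota> \<Lambda>' lam'"
    thus "gamma q \<Lambda>' lam' j k = gamma q \<Lambda> lam j k" by (rule same_gamma)
  next
    fix \<Lambda>' lam' assume "regular p q k" "normalized_separable_lattice \<iota> \<Lambda>' lam'"
    thus "gamma_zero \<Lambda>' k = gamma_zero \<Lambda> k" by (rule same_zero)
  qed
qed

end
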